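(* Let $G$ be a near-bipartite brick other than $K_4$, with $n$ vertices. Then $G$ has at least $\frac{n-6}{2}$ removable edges. Moreover, $G$ has exactly $\frac{n-6}{2}$ removable edges if and only if $G$ is a tri-ladder (equivalently, a near-bipartite tri-ladder).
   Context: Graphs may have multiple edges but no loops. An edge of a graph is admissible if it lies in some perfect matching. A connected graph with at least two vertices is matching covered if every edge is admissible. An edge $e$ of a matching covered graph $G$ is removable if $G-e$ is matching covered. A brick is a 3-connected nonbipartite graph $G$ such that $G-x-y$ has a perfect matching for every two distinct vertices $x,y$. A nonbipartite matching covered graph $G$ is near-bipartite if it has a pair of edges $\{e_1,e_2\}$ such that $G-\{e_1,e_2\}$ is a bipartite matching covered graph. For $X\subseteq V(G)$, $\partial(X)$ is the set of edges with exactly one end in $X$; $G/X$ denotes the graph obtained by contracting $X$ to a single vertex $x$ (deleting edges with both ends in $X$), and $G/\overline{X}$ is defined analogously with $\overline{X}=V(G)\setminus X$ contracted to $\overline{x}$. We then say $G$ is a splicing of $G/X$ and $G/\overline{X}$ at $x$ and $\overline{x}$. $\overline{C_6}$ denotes the complement of the 6-cycle (the triangular prism). A graph $G$ is a tri-ladder if there is a sequence $G_0,G_1,\dots,G_r$ ($r\ge 0$) with $G_0=\overline{C_6}$, $G_r=G$, and for $1\le i\le r$, $G_i$ is a splicing of $G_{i-1}$ and $K_4$ at a vertex of $G_{i-1}$ lying in a triangle of $G_{i-1}$ and a vertex of $K_4$. *)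

theory Defs
  imports Complex_Main
begin

text \<open>Finite multigraphs (multiple edges allowed, no loops): a vertex set, an edge set
  and an endpoint map assigning to every edge its 2-element set of ends.\<close>

record ('v, 'e) mgraph =
  verts :: "'v set"
  edges :: "'e set"
  ends  :: "'e \<Rightarrow> 'v set"

definition wf_graph :: "('v, 'e) mgraph \<Rightarrow> bool" where
  "wf_graph G \<longleftrightarrow> finite (verts G) \<and> finite (edges G) \<and>
     (\<forall>e\<in>edges G. ends G e \<subseteq> verts G \<and> card (ends G e) = 2)"

definition adjacent :: "('v, 'e) mgraph \<Rightarrow> 'v \<Rightarrow> 'v \<Rightarrow> bool" where
  "adjacent G u v \<longleftrightarrow> (\<exists>e\<in>edges G. ends G e = {u, v})"

definition connected_graph :: "('v, 'e) mgraph \<Rightarrow> bool" where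
  "connected_graph G \<longleftrightarrow>
     (\<forall>u\<in>verts G. \<forall>v\<in>verts G. (u, v) \<in> {(x, y). adjacent G x y}\<^sup>*)"

definition perfect_matching :: "('v, 'e) mgraph \<Rightarrow> 'e set \<Rightarrow> bool" where
  "perfect_matching G M \<longleftrightarrow> M \<subseteq> edges G \<and>
     (\<forall>v\<in>verts G. \<exists>!e. e \<in> M \<and> v \<in> ends G e)"

definition admissible :: "('v, 'e) mgraph \<Rightarrow> 'e \<Rightarrow> bool" where
  "admissible G e \<longleftrightarrow> (\<exists>M. perfect_matching G M \<and> e \<in> M)"

definition matching_covered :: "('v, 'e) mgraph \<Rightarrow> bool" where
  "matching_covered G \<longleftrightarrow> wf_graph G \<and> connected_graph G \<and> card (verts G) \<ge> 2 \<and>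
     (\<forall>e\<in>edges G. admissible G e)"

definition delete_edges :: "('v, 'e) mgraph \<Rightarrow> 'e set \<Rightarrow> ('v, 'e) mgraph" where
  "delete_edges G F = G\<lparr>edges := edges G - F\<rparr>"

definition delete_verts :: "('v, 'e) mgraph \<Rightarrow> 'v set \<Rightarrow> ('v, 'e) mgraph" where
  "delete_verts G S = \<lparr>verts = verts G - S,
     edges = {e \<in> edges G. ends G e \<inter> S = {}}, ends = ends G\<rparr>"

definition removable :: "('v, 'e) mgraph \<Rightarrow> 'e \<Rightarrow> bool" where
  "removable G e \<longleftrightarrow> e \<in> edges G \<and> matching_covered (delete_edges G {e})"

definition bipartite :: "('v, 'e) mgraph \<Rightarrow> bool" where
  "bipartite G \<longleftrightarrow> (\<exists>A B. A \<inter> B = {} \<and> A \<union> B = verts G \<and>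
     (\<forall>e\<in>edges G. card (ends G e \<inter> A) = 1 \<and> card (ends G e \<inter> B) = 1))"

text \<open>3-connected: more than 3 vertices and no set of at most 2 vertices disconnects.\<close>
definition three_connected :: "('v, 'e) mgraph \<Rightarrow> bool" where
  "three_connected G \<longleftrightarrow> card (verts G) \<ge> 4 \<and>
     (\<forall>S. S \<subseteq> verts G \<and> card S \<le> 2 \<longrightarrow> connected_graph (delete_verts G S))"

definition brick :: "('v, 'e) mgraph \<Rightarrow> bool" where
  "brick G \<longleftrightarrow> wf_graph G \<and> three_connected G \<and> \<not> bipartite G \<and>
     (\<forall>x\<in>verts G. \<forall>y\<in>verts G. x \<noteq> y \<longrightarrow>
        (\<exists>M. perfect_matching (delete_verts G {x, y}) M))"

definition near_bipartite :: "('v, 'e) mgraph \<Rightarrow> bool" where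
  "near_bipartite G \<longleftrightarrow> \<not> bipartite G \<and> matching_covered G \<and>
     (\<exists>e1\<in>edges G. \<exists>e2\<in>edges G. e1 \<noteq> e2 \<and>
        bipartite (delete_edges G {e1, e2}) \<and> matching_covered (delete_edges G {e1, e2}))"

text \<open>Contraction of X to a single vertex named c (c is any vertex of X, so the
  new vertex is fresh w.r.t. the remaining vertices); edges inside X are deleted.\<close>
definition contract :: "('v, 'e) mgraph \<Rightarrow> 'v set \<Rightarrow> 'v \<Rightarrow> ('v, 'e) mgraph" where
  "contract G X c = \<lparr>verts = (verts G - X) \<union> {c},
     edges = {e \<in> edges G. \<not> ends G e \<subseteq> X},
     ends = (\<lambda>e. (\<lambda>v. if v \<in> X then c else v) ` ends G e)\<rparr>"

text \<open>Isomorphism of multigraphs mapping vertex a to vertex b.\<close>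
definition iso_pt :: "('v, 'e) mgraph \<Rightarrow> 'v \<Rightarrow> ('w, 'f) mgraph \<Rightarrow> 'w \<Rightarrow> bool" where
  "iso_pt G a H b \<longleftrightarrow> (\<exists>f g. bij_betw f (verts G) (verts H) \<and> bij_betw g (edges G) (edges H) \<and>
     (\<forall>e\<in>edges G. ends H (g e) = f ` ends G e) \<and> f a = b)"

definition graph_iso :: "('v, 'e) mgraph \<Rightarrow> ('w, 'f) mgraph \<Rightarrow> bool" where
  "graph_iso G H \<longleftrightarrow> (\<exists>f g. bij_betw f (verts G) (verts H) \<and> bij_betw g (edges G) (edges H) \<and>
     (\<forall>e\<in>edges G. ends H (g e) = f ` ends G e))"

text \<open>G is a splicing of H (at u) and K (at w): there is a cut partition X, X-bar of V(G)
  with G/X isomorphic to H (contracted vertex x to u) and G/X-bar isomorphic to K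
  (contracted vertex x-bar to w).\<close>
definition splicing :: "('v, 'e) mgraph \<Rightarrow> ('w, 'f) mgraph \<Rightarrow> 'w \<Rightarrow>
    ('x, 'h) mgraph \<Rightarrow> 'x \<Rightarrow> bool" where
  "splicing G H u K w \<longleftrightarrow> (\<exists>X x xb. X \<subseteq> verts G \<and> x \<in> X \<and> xb \<in> verts G - X \<and>
     iso_pt (contract G X x) x H u \<and> iso_pt (contract G (verts G - X) xb) xb K w)"

definition K4 :: "(nat, nat set) mgraph" where
  "K4 = \<lparr>verts = {0, 1, 2, 3}, edges = {{i, j} | i j. i < 4 \<and> j < 4 \<and> i \<noteq> j}, ends = id\<rparr>"

text \<open>Complement of the 6-cycle 0-1-2-3-4-5-0: the triangular prism with
  triangles {0,2,4}, {1,3,5} and the matching {0,3}, {1,4}, {2,5}.\<close>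
definition C6bar :: "(nat, nat set) mgraph" where
  "C6bar = \<lparr>verts = {0, 1, 2, 3, 4, 5},
     edges = {{i, j} | i j. i < 6 \<and> j < 6 \<and> i \<noteq> j \<and>
                  \<not> (j = (i + 1) mod 6 \<or> i = (j + 1) mod 6)},
     ends = id\<rparr>"

definition in_triangle :: "('v, 'e) mgraph \<Rightarrow> 'v \<Rightarrow> bool" where
  "in_triangle G u \<longleftrightarrow> (\<exists>a b. u \<in> verts G \<and> a \<in> verts G \<and> b \<in> verts G \<and>
     u \<noteq> a \<and> u \<noteq> b \<and> a \<noteq> b \<and> adjacent G u a \<and> adjacent G u b \<and> adjacent G a b)"

text \<open>The sequence G_0 = C6bar, ..., G_r (graphs represented with vertices and edges in nat;
  G_0 = C6bar up to isomorphism).\<close>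
inductive tri_ladder_seq :: "(nat, nat) mgraph \<Rightarrow> bool" where
  base: "graph_iso G C6bar \<Longrightarrow> tri_ladder_seq G"
| step: "tri_ladder_seq H \<Longrightarrow> u \<in> verts H \<Longrightarrow> in_triangle H u \<Longrightarrow> w \<in> verts K4 \<Longrightarrow>
         splicing G H u K4 w \<Longrightarrow> tri_ladder_seq G"

definition tri_ladder :: "('v, 'e) mgraph \<Rightarrow> bool" where
  "tri_ladder G \<longleftrightarrow> (\<exists>H. tri_ladder_seq H \<and> graph_iso G H)"

end

theory Submission
  imports Defs
begin

text \<open>Let the edges \<open>e1 = a1 a2\<close> and \<open>e2 = b1 b2\<close> be such that removing both leaves a bipartite
  matching covered graph with colour classes \<open>A\<close> (containing \<open>a1, a2\<close>) and \<open>B\<close> (containing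
  \<open>b1, b2\<close>). A perfect matching contains both of \<open>e1, e2\<close> or neither, so by Hall's theorem being a
  brick becomes a set of lower bounds on neighbourhoods, and an edge is nonremovable only if one of
  these bounds is almost tight. Uncrossing almost tight sets by submodularity shows that a vertex
  \<open>p\<close> of \<open>A\<close> other than \<open>a1, a2\<close> has at most two nonremovable edges, unless \<open>p, b1, b2\<close> span a
  triangle in which \<open>b1\<close> and \<open>b2\<close> are cubic; there is at most one such \<open>p\<close>. So all but three
  vertices of \<open>A\<close> have a removable edge, which is the bound.

  In the extremal case the graph is cubic, \<open>a, b1, b2\<close> is a triangle, and two nonremovable edges at
  every other vertex of \<open>A\<close> force the outer neighbour \<open>a'\<close> of \<open>a\<close> to be adjacent to the outer
  neighbour \<open>c1\<close> of \<open>b1\<close> or \<open>c2\<close> of \<open>b2\<close> (a rung). Contracting the triangle then yields a smaller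
  graph of the same kind, in which the contracted vertex lies in a triangle, down to the prism.
  Conversely a rung makes the contraction of a near-bipartite brick satisfy the same bounds, and the
  rung is the only edge that can become removable when the contraction is undone.\<close>

section \<open>Matchings in bipartite relations\<close>

text \<open>Both classes have n/2 vertices, so the bound asks for |A| - 3 removable edges. Neither
  special edge is removable (without one of them, no perfect matching contains the other). So a
  removable edge has exactly one end in \<open>A\<close>, and it suffices to find one at all
  vertices of \<open>A\<close> but three: the ends \<open>a1\<close>, \<open>a2\<close>, about which
  nothing is claimed, and the apex of a possible triangle. An edge with a parallel copy is removable
  at once, and 3-connectedness preserves connectivity, so the question is one about a relation
  between \<open>A\<close> and \<open>B\<close>.

  The obstacle is that two kinds of obstruction meet at a vertex: one against matchings through the
  special edges, which affects at most one edge, and one against matchings avoiding them, which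
  affects at most two. Showing that all three occur only at the apex of the triangle is the hard
  uncrossing step. In the equality case the count is applied to both classes: the triangle on
  \<open>b1\<close>, \<open>b2\<close> bounds the degrees of these two, and the triangle on
  \<open>a1\<close>, \<open>a2\<close> does so on the other side. What the contraction inherits is
  weaker than equality: two nonremovable edges at all vertices of \<open>A\<close> but
  three.\<close>

lemma hall_inj:
  assumes "finite P" and "\<And>p. p \<in> P \<Longrightarrow> finite (F `` {p})"
    and "\<And>S. S \<subseteq> P \<Longrightarrow> card S \<le> card (F `` S)"
  shows "\<exists>m. inj_on m P \<and> (\<forall>p\<in>P. (p, m p) \<in> F)"
  using assms
proof (induction "card P" arbitrary: P F rule: less_induct)
  case less
  have finIm: "finite (F `` S)" if "S \<subseteq> P" for S
  proof -
    have e: "F `` S = (\<Union>p\<in>S. F `` {p})" by auto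
    have "finite S" using that less.prems(1) by (rule finite_subset)
    then show ?thesis unfolding e using less.prems(2) that by blast
  qed
  show ?case
  proof (cases "P = {}")
    case True
    then show ?thesis by auto
  next
    case False
    \<comment> \<open>A proper nonempty set \<open>S\<close> without surplus splits the problem:
      \<open>S\<close> is matched into its own neighbourhood, and the rest keeps Hall's condition
      outside it. If there is no such set, any one edge can be fixed, since every proper nonempty
      set can afford to lose one neighbour.\<close>
    show ?thesis
    proof (cases "\<exists>S. S \<subset> P \<and> S \<noteq> {} \<and> card (F `` S) \<le> card S")
      case True
      then obtain S where S: "S \<subset> P" "S \<noteq> {}" "card (F `` S) \<le> card S" by blast
      have finS: "finite S" using S(1) less.prems(1) by (meson finite_subset psubset_imp_subset)
      have cS: "card (F `` S) = card S" using less.prems(3)[of S] S by auto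
      have "\<exists>m. inj_on m S \<and> (\<forall>p\<in>S. (p, m p) \<in> F)"
      proof (rule less.hyps)
        show "card S < card P" using S(1) less.prems(1) by (simp add: psubset_card_mono)
        show "finite S" by (rule finS)
        show "finite (F `` {p})" if "p \<in> S" for p using less.prems(2) that S(1) by blast
        show "card U \<le> card (F `` U)" if "U \<subseteq> S" for U using less.prems(3) that S(1) by blast
      qed
      then obtain m1 where m1: "inj_on m1 S" "\<And>p. p \<in> S \<Longrightarrow> (p, m1 p) \<in> F" by blast
      define F' where "F' = {(x, y) \<in> F. y \<notin> F `` S}"
      have "\<exists>m. inj_on m (P - S) \<and> (\<forall>p\<in>P - S. (p, m p) \<in> F')"
      proof (rule less.hyps)
        show "card (P - S) < card P" using S less.prems(1) by (intro psubset_card_mono) auto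
        show "finite (P - S)" using less.prems(1) by simp
        show "finite (F' `` {p})" if "p \<in> P - S" for p
          using less.prems(2)[of p] that by (auto simp: F'_def intro: finite_subset[of _ "F `` {p}"])
        show "card U \<le> card (F' `` U)" if U: "U \<subseteq> P - S" for U
        proof -
          have e: "F' `` U = F `` (S \<union> U) - F `` S" by (auto simp: F'_def)
          have "card (S \<union> U) \<le> card (F `` (S \<union> U))" using less.prems(3)[of "S \<union> U"] U S by auto
          moreover have "card (S \<union> U) = card S + card U"
            using U finS less.prems(1) by (intro card_Un_disjoint) (auto intro: finite_subset)
          moreover have "card (F `` (S \<union> U) - F `` S) = card (F `` (S \<union> U)) - card (F `` S)"
            using finIm[of S] S by (intro card_Diff_subset) auto
          ultimately show ?thesis using e cS by simp
        qed
      qed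
      then obtain m2 where m2: "inj_on m2 (P - S)" "\<And>p. p \<in> P - S \<Longrightarrow> (p, m2 p) \<in> F'" by blast
      define m where "m = (\<lambda>p. if p \<in> S then m1 p else m2 p)"
      have im2: "m2 p \<notin> F `` S \<and> (p, m2 p) \<in> F" if "p \<in> P - S" for p using m2(2)[OF that] by (auto simp: F'_def)
      have "inj_on m P"
      proof (rule inj_onI)
        fix x y assume xy: "x \<in> P" "y \<in> P" "m x = m y"
        have i1: "m1 z \<in> F `` S" if "z \<in> S" for z using m1(2)[OF that] that by blast
        show "x = y"
        proof (cases "x \<in> S"; cases "y \<in> S")
          assume "x \<in> S" "y \<in> S" then show ?thesis using xy m1(1) by (auto simp: m_def inj_on_def)
        next
          assume "x \<in> S" "y \<notin> S" then show ?thesis using xy i1[of x] im2[of y] by (auto simp: m_def)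
        next
          assume "x \<notin> S" "y \<in> S" then show ?thesis using xy i1[of y] im2[of x] by (auto simp: m_def)
        next
          assume "x \<notin> S" "y \<notin> S" then show ?thesis using xy m2(1) by (auto simp: m_def inj_on_def)
        qed
      qed
      moreover have "\<forall>p\<in>P. (p, m p) \<in> F" using m1(2) im2 by (auto simp: m_def)
      ultimately show ?thesis by blast
    next
      case noTight: False
      obtain p where p: "p \<in> P" using False by blast
      have "card {p} \<le> card (F `` {p})" using less.prems(3)[of "{p}"] p by simp
      then have "F `` {p} \<noteq> {}" by auto
      then obtain q where q: "(p, q) \<in> F" by blast
      define F' where "F' = {(x, y) \<in> F. y \<noteq> q}"
      have "\<exists>m. inj_on m (P - {p}) \<and> (\<forall>x\<in>P - {p}. (x, m x) \<in> F')"
      proof (rule less.hyps)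
        show "card (P - {p}) < card P" using p less.prems(1) by (meson card_Diff1_less)
        show "finite (P - {p})" using less.prems(1) by simp
        show "finite (F' `` {x})" if "x \<in> P - {p}" for x
          using less.prems(2)[of x] that by (auto simp: F'_def intro: finite_subset[of _ "F `` {x}"])
        show "card U \<le> card (F' `` U)" if U: "U \<subseteq> P - {p}" for U
        proof (cases "U = {}")
          case True then show ?thesis by simp
        next
          case False
          have e: "F' `` U = F `` U - {q}" by (auto simp: F'_def)
          have "U \<subset> P" using U p by blast
          then have "card U < card (F `` U)" using noTight False by (meson linorder_not_less)
          moreover have "card (F `` U - {q}) = card (F `` U) - (if q \<in> F `` U then 1 else 0)"
            by (simp add: card_Diff_singleton_if)
          ultimately show ?thesis unfolding e by (auto split: if_splits)
        qed
      qed
      then obtain m where m: "inj_on m (P - {p})" "\<And>x. x \<in> P - {p} \<Longrightarrow> (x, m x) \<in> F'" by blast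
      have "inj_on (m(p := q)) P"
        using m by (auto simp: inj_on_def F'_def split: if_splits)
      moreover have "\<forall>x\<in>P. (x, (m(p := q)) x) \<in> F" using m(2) q by (auto simp: F'_def)
      ultimately show ?thesis by blast
    qed
  qed
qed

definition matches :: "('a \<times> 'b) set \<Rightarrow> 'a set \<Rightarrow> 'b set \<Rightarrow> ('a \<Rightarrow> 'b) \<Rightarrow> bool" where
  "matches F P Q m \<longleftrightarrow> bij_betw m P Q \<and> (\<forall>p\<in>P. (p, m p) \<in> F)"

lemma hall_matches:
  assumes "finite P" "finite Q" "card P = card Q"
    and "\<And>S. S \<subseteq> P \<Longrightarrow> card S \<le> card (F `` S \<inter> Q)"
  shows "\<exists>m. matches F P Q m"
proof -
  define F' where "F' = {(x, y) \<in> F. y \<in> Q}"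
  have e: "F' `` S = F `` S \<inter> Q" for S by (auto simp: F'_def)
  have "\<exists>m. inj_on m P \<and> (\<forall>p\<in>P. (p, m p) \<in> F')"
    using assms e by (intro hall_inj) auto
  then obtain m where m: "inj_on m P" "\<And>p. p \<in> P \<Longrightarrow> (p, m p) \<in> F'" by blast
  have "m ` P \<subseteq> Q" using m(2) by (auto simp: F'_def)
  moreover have "card (m ` P) = card Q" using m(1) assms by (simp add: card_image)
  ultimately have "m ` P = Q" using assms(2) by (simp add: card_subset_eq)
  then have "matches F P Q m" using m by (auto simp: matches_def bij_betw_def F'_def)
  then show ?thesis by blast
qed

lemma matches_imp_hall:
  assumes "matches F P Q m" "finite Q" "S \<subseteq> P"
  shows "card S \<le> card (F `` S \<inter> Q)"
proof -
  have "m ` S \<subseteq> F `` S \<inter> Q" using assms by (auto simp: matches_def bij_betw_def)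
  moreover have "inj_on m S" using assms by (meson bij_betw_def inj_on_subset matches_def)
  ultimately show ?thesis using assms(2) by (metis card_image card_mono finite_Int)
qed

lemma matches_converse:
  assumes "matches F P Q m"
  shows "matches (F\<inverse>) Q P (inv_into P m)" "\<And>p. p \<in> P \<Longrightarrow> inv_into P m (m p) = p"
proof -
  have b: "bij_betw m P Q" using assms by (simp add: matches_def)
  show "matches (F\<inverse>) Q P (inv_into P m)"
    using assms b bij_betw_inv_into[OF b] bij_betw_inv_into_right[OF b] bij_betw_imp_surj_on[OF bij_betw_inv_into[OF b]]
    unfolding matches_def by (metis converse_iff imageI)
  show "\<And>p. p \<in> P \<Longrightarrow> inv_into P m (m p) = p" using b by (simp add: bij_betw_inv_into_left)
qed

text \<open>The two disjuncts are the perfect matchings avoiding both special edges and those containing both.\<close>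

definition admissible_pair :: "'a set \<Rightarrow> 'b set \<Rightarrow> 'a \<Rightarrow> 'a \<Rightarrow> 'b \<Rightarrow> 'b \<Rightarrow> ('a \<times> 'b) set \<Rightarrow> 'a \<Rightarrow> 'b \<Rightarrow> bool" where
  "admissible_pair A B a1 a2 b1 b2 F u v \<longleftrightarrow> (\<exists>m. matches F A B m \<and> m u = v) \<or>
     (\<exists>m. matches F (A - {a1, a2}) (B - {b1, b2}) m \<and> u \<notin> {a1, a2} \<and> m u = v)"

text \<open>The first condition on matchings keeps the two special edges admissible, the second
  keeps all other pairs admissible. Connectivity is left to
  \<open>three_connected_delete_edge\<close>.\<close>

definition removable_pair :: "'a set \<Rightarrow> 'b set \<Rightarrow> 'a \<Rightarrow> 'a \<Rightarrow> 'b \<Rightarrow> 'b \<Rightarrow> ('a \<times> 'b) set \<Rightarrow> 'a \<Rightarrow> 'b \<Rightarrow> bool" where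
  "removable_pair A B a1 a2 b1 b2 E p q \<longleftrightarrow> (p, q) \<in> E \<and>
     (\<exists>m. matches (E - {(p, q)}) (A - {a1, a2}) (B - {b1, b2}) m) \<and>
     (\<forall>u v. (u, v) \<in> E \<longrightarrow> (u, v) \<noteq> (p, q) \<longrightarrow> admissible_pair A B a1 a2 b1 b2 (E - {(p, q)}) u v)"

lemma admissible_pair_converse:
  assumes "admissible_pair A B a1 a2 b1 b2 F u v" "u \<in> A"
  shows "admissible_pair B A b1 b2 a1 a2 (F\<inverse>) v u"
  using assms(1) unfolding admissible_pair_def
proof (elim disjE exE conjE)
  fix m assume m: "matches F A B m" "m u = v"
  show "(\<exists>m. matches (F\<inverse>) B A m \<and> m v = u) \<or> (\<exists>m. matches (F\<inverse>) (B - {b1, b2}) (A - {a1, a2}) m \<and> v \<notin> {b1, b2} \<and> m v = u)"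
    using matches_converse[OF m(1)] m(2) assms(2) by blast
next
  fix m assume m: "matches F (A - {a1, a2}) (B - {b1, b2}) m" "u \<notin> {a1, a2}" "m u = v"
  have u: "u \<in> A - {a1, a2}" using m(2) assms(2) by blast
  then have "v \<in> B - {b1, b2}" using m(1,3) by (auto simp: matches_def bij_betw_def)
  then show "(\<exists>m. matches (F\<inverse>) B A m \<and> m v = u) \<or> (\<exists>m. matches (F\<inverse>) (B - {b1, b2}) (A - {a1, a2}) m \<and> v \<notin> {b1, b2} \<and> m v = u)"
    using matches_converse[OF m(1)] m(3) u by blast
qed

lemma removable_pair_converse1:
  assumes "removable_pair A B a1 a2 b1 b2 E p q" "E \<subseteq> A \<times> B"
  shows "removable_pair B A b1 b2 a1 a2 (E\<inverse>) q p"
proof -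
  have e: "E\<inverse> - {(q, p)} = (E - {(p, q)})\<inverse>" by auto
  have "\<exists>m. matches (E\<inverse> - {(q, p)}) (B - {b1, b2}) (A - {a1, a2}) m"
    using assms(1) matches_converse(1) unfolding removable_pair_def e by metis
  moreover have "admissible_pair B A b1 b2 a1 a2 (E\<inverse> - {(q, p)}) v u" if "(v, u) \<in> E\<inverse>" "(v, u) \<noteq> (q, p)" for u v
  proof -
    have "(u, v) \<in> E" "(u, v) \<noteq> (p, q)" using that by auto
    then have "admissible_pair A B a1 a2 b1 b2 (E - {(p, q)}) u v" "u \<in> A" using assms by (auto simp: removable_pair_def)
    then show ?thesis unfolding e by (rule admissible_pair_converse)
  qed
  ultimately show ?thesis using assms(1) unfolding removable_pair_def by auto
qed

lemma removable_pair_converse: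
  assumes "E \<subseteq> A \<times> B"
  shows "removable_pair B A b1 b2 a1 a2 (E\<inverse>) q p \<longleftrightarrow> removable_pair A B a1 a2 b1 b2 E p q"
proof -
  have "E\<inverse> \<subseteq> B \<times> A" using assms by auto
  then show ?thesis using removable_pair_converse1[of A B a1 a2 b1 b2 E p q] removable_pair_converse1[of B A b1 b2 a1 a2 "E\<inverse>" q p] assms
    by auto
qed

lemma removable_pair_swap:
  "removable_pair A B a2 a1 b1 b2 E p q = removable_pair A B a1 a2 b1 b2 E p q"
  "removable_pair A B a1 a2 b2 b1 E p q = removable_pair A B a1 a2 b1 b2 E p q"
  by (simp_all add: removable_pair_def admissible_pair_def insert_commute)

lemma card_sub: assumes "finite Y" "X \<subseteq> Y - Z" "Z \<subseteq> Y" shows "card X + card Z \<le> card Y"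
proof -
  have "card X + card Z = card (X \<union> Z)"
    using assms by (intro card_Un_disjoint[symmetric]) (auto intro: finite_subset)
  also have "\<dots> \<le> card Y" using assms by (intro card_mono) auto
  finally show ?thesis .
qed

lemma card_sub1: "finite Y \<Longrightarrow> X \<subseteq> Y - {a} \<Longrightarrow> a \<in> Y \<Longrightarrow> card X + 1 \<le> card Y"
  using card_sub[of Y X "{a}"] by simp

lemma card_sub2: "finite Y \<Longrightarrow> X \<subseteq> Y - {a, b} \<Longrightarrow> a \<in> Y \<Longrightarrow> b \<in> Y \<Longrightarrow> a \<noteq> b \<Longrightarrow> card X + 2 \<le> card Y"
  using card_sub[of Y X "{a, b}"] by simp

lemma card_sub3: "finite Y \<Longrightarrow> X \<subseteq> Y - {a, b, c} \<Longrightarrow> a \<in> Y \<Longrightarrow> b \<in> Y \<Longrightarrow> c \<in> Y \<Longrightarrow>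
   distinct [a, b, c] \<Longrightarrow> card X + 3 \<le> card Y"
  using card_sub[of Y X "{a, b, c}"] by simp

lemma card_sub4: "finite Y \<Longrightarrow> X \<subseteq> Y - {a, b, c, d} \<Longrightarrow> a \<in> Y \<Longrightarrow> b \<in> Y \<Longrightarrow> c \<in> Y \<Longrightarrow> d \<in> Y \<Longrightarrow>
   distinct [a, b, c, d] \<Longrightarrow> card X + 4 \<le> card Y"
  using card_sub[of Y X "{a, b, c, d}"] by simp

lemma extend_matches:
  assumes "matches F (P - {u}) (Q - {v}) m" "(u, v) \<in> F" "u \<in> P" "v \<in> Q"
  shows "matches F P Q (m(u := v))"
proof -
  have "bij_betw (m(u := v)) (P - {u}) (Q - {v}) = bij_betw m (P - {u}) (Q - {v})"
    by (rule bij_betw_cong) auto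
  then have "bij_betw (m(u := v)) (P - {u}) (Q - {v})" using assms(1) by (simp add: matches_def)
  then have "bij_betw (m(u := v)) (P - {u} \<union> {u}) (Q - {v} \<union> {(m(u := v)) u})"
    by (subst notIn_Un_bij_betw3[symmetric]) auto
  moreover have "P - {u} \<union> {u} = P" "Q - {v} \<union> {(m(u := v)) u} = Q" using assms by auto
  ultimately show ?thesis using assms by (auto simp: matches_def)
qed

lemma card_le_Diff1: "card X \<le> card (X - {v}) + 1"
proof -
  have "card (X - {v}) = card X - (if v \<in> X then 1 else 0)" by (simp add: card_Diff_singleton_if)
  then show ?thesis by (auto split: if_splits)
qed

lemma hall_fail:
  assumes "\<not> (\<exists>m. matches F P Q m)" "finite P" "finite Q" "card P = card Q"
  obtains S where "S \<subseteq> P" "card (F `` S \<inter> Q) < card S"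
proof (rule ccontr)
  assume "\<not> thesis"
  then have "\<And>S. S \<subseteq> P \<Longrightarrow> card S \<le> card (F `` S \<inter> Q)" using that linorder_not_le by blast
  then show False using hall_matches[OF assms(2-4)] assms(1) by blast
qed

text \<open>\<open>E\<close> is the adjacency relation between the colour classes. The assumption \<open>hall1\<close> says that the
  bipartite graph is matching covered; \<open>hall2\<close> and \<open>hall3\<close> say that deleting two vertices of the same
  colour leaves a perfect matching, which must then use exactly the special edge of the other colour.\<close>

locale core =
  fixes A :: "'a set" and B :: "'b set" and E :: "('a \<times> 'b) set" and a1 a2 :: 'a and b1 b2 :: 'b
  assumes finA: "finite A" and finB: "finite B" and cardAB: "card A = card B" and big: "3 \<le> card A"
    and EAB: "E \<subseteq> A \<times> B"
    and aA: "a1 \<in> A" "a2 \<in> A" "a1 \<noteq> a2" and bB: "b1 \<in> B" "b2 \<in> B" "b1 \<noteq> b2"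
    and hall1: "\<And>S. S \<subseteq> A \<Longrightarrow> S \<noteq> {} \<Longrightarrow> S \<noteq> A \<Longrightarrow> card S + 1 \<le> card (E `` S)"
    and hall2: "\<And>S. S \<subseteq> A \<Longrightarrow> card S + 2 \<le> card A \<Longrightarrow> card S \<le> card (E `` S - {b1, b2})"
    and hall3: "\<And>T. T \<subseteq> B \<Longrightarrow> card T + 2 \<le> card B \<Longrightarrow> card T \<le> card (E\<inverse> `` T - {a1, a2})"
begin

abbreviation N :: "'a set \<Rightarrow> 'b set" where "N S \<equiv> E `` S"

abbreviation rm :: "'a \<Rightarrow> 'b \<Rightarrow> bool" where "rm \<equiv> removable_pair A B a1 a2 b1 b2 E"

section \<open>Neighbourhood bounds and symmetries of the relation\<close>

lemma NB: "N S \<subseteq> B" using EAB by auto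
lemma finN [simp]: "finite (N S)" using NB finB finite_subset by blast
lemma finS: "S \<subseteq> A \<Longrightarrow> finite S" using finA finite_subset by blast

lemma N_ge: assumes "S \<subseteq> A" shows "card S \<le> card (N S)"
proof (cases "S = {} \<or> S = A")
  case True
  then show ?thesis
  proof
    assume "S = A"
    have "A - {a1} \<noteq> {}" using aA by blast
    then have "card (A - {a1}) + 1 \<le> card (N (A - {a1}))" using hall1[of "A - {a1}"] aA by blast
    moreover have "card (A - {a1}) + 1 = card A" using aA(1) finA big by (simp add: card_Diff_singleton)
    moreover have "card (N (A - {a1})) \<le> card (N A)" by (intro card_mono) auto
    ultimately show ?thesis using \<open>S = A\<close> by simp
  qed simp
next
  case False
  then show ?thesis using hall1[of S] assms by simp
qed

lemma N_A: "N A = B"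
  by (rule card_seteq[OF finB NB]) (use N_ge[of A] cardAB in simp)

lemma N_two: assumes "S \<subseteq> A" "S \<noteq> {}" shows "2 \<le> card (N S)"
proof -
  obtain p where p: "p \<in> S" using assms by blast
  have "{p} \<noteq> A" using big by auto
  then have "card {p} + 1 \<le> card (N {p})" using hall1[of "{p}"] p assms by auto
  moreover have "card (N {p}) \<le> card (N S)" using p by (intro card_mono) auto
  ultimately show ?thesis by simp
qed

text \<open>Apply \<open>hall3\<close> to the vertices of \<open>B\<close> outside
  \<open>N S\<close>: their neighbours avoid \<open>S\<close>, and \<open>a1\<close>,
  \<open>a2\<close> are two further vertices outside \<open>S\<close> that are not counted.\<close>

lemma D2: assumes "S \<subseteq> A" "S \<noteq> {}" "a1 \<notin> S" "a2 \<notin> S" shows "card S + 2 \<le> card (N S)"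
proof -
  define T where "T = B - N S"
  have cT: "card T + card (N S) = card B" unfolding T_def using card_Diff_subset[OF finN NB, of S] card_mono[OF finB NB, of S] by simp
  have "card T + 2 \<le> card B" using cT N_two[OF assms(1,2)] by simp
  then have "card T \<le> card (E\<inverse> `` T - {a1, a2})" using hall3[of T] by (auto simp: T_def)
  also have "\<dots> \<le> card (A - S - {a1, a2})"
    using EAB finA by (intro card_mono) (auto simp: T_def)
  finally have "card T \<le> card (A - S - {a1, a2})" .
  moreover have "card (A - S - {a1, a2}) + 2 \<le> card (A - S)"
    using aA assms finA by (intro card_sub2[of _ _ a1 a2]) auto
  moreover have "card (A - S) = card A - card S" using assms finA finS by (simp add: card_Diff_subset)
  moreover have "card S \<le> card A" using assms finA card_mono by blast
  ultimately show ?thesis using cT cardAB by linarith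
qed

text \<open>\<open>hall2\<close> does not count \<open>b1\<close> and \<open>b2\<close>; they supply
  the surplus of two.\<close>

lemma B2: assumes "S \<subseteq> A" "card S + 2 \<le> card A" "b1 \<in> N S" "b2 \<in> N S" shows "card S + 2 \<le> card (N S)"
  using hall2[OF assms(1,2)] card_sub2[OF finN order_refl assms(3,4) bB(3)] by simp

lemma deg3: assumes "p \<in> A" "p \<noteq> a1" "p \<noteq> a2" shows "3 \<le> card (N {p})"
  using D2[of "{p}"] assms by simp

text \<open>Stated with \<open>N S \<inter> N W\<close> instead of \<open>N (S \<inter> W)\<close>,
  because uncrossing exploits the gap between \<open>N S \<inter> N W\<close> and the neighbourhood
  of \<open>S \<inter> W\<close> without \<open>p\<close>.\<close>

lemma submod: "card (N (S \<union> W)) + card (N S \<inter> N W) = card (N S) + card (N W)"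
  using card_Un_Int[of "N S" "N W"] by (simp add: Image_Un)

lemma card_N_Int_le: "card (N (S \<inter> W)) \<le> card (N S \<inter> N W)"
  by (intro card_mono) auto

text \<open>The vertices of \<open>A\<close> not adjacent to \<open>T\<close> have all their
  neighbours in \<open>B - T\<close>, so their surplus turns into a surplus of
  \<open>T\<close>.\<close>

lemma hall1_dual: assumes "T \<subseteq> B" "T \<noteq> {}" "T \<noteq> B" shows "card T + 1 \<le> card (E\<inverse> `` T)"
proof -
  define S where "S = A - E\<inverse> `` T"
  have sub: "E\<inverse> `` T \<subseteq> A" using EAB by auto
  have cS: "card S + card (E\<inverse> `` T) = card A" unfolding S_def
    using card_Diff_subset[OF finite_subset[OF sub finA] sub] card_mono[OF finA sub] by simp
  have NS: "N S \<subseteq> B - T" using NB by (auto simp: S_def)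
  have "card (B - T) = card B - card T" "card T \<le> card B"
    using assms(1) finB by (auto simp: card_Diff_subset finite_subset card_mono)
  moreover have "card (N S) \<le> card (B - T)" using NS finB by (intro card_mono) auto
  moreover have "S \<noteq> A"
  proof
    assume "S = A"
    then have "B \<subseteq> B - T" using NS N_A by simp
    then show False using assms by blast
  qed
  moreover have "S = {} \<Longrightarrow> card T < card B" using assms(1,3) finB by (simp add: psubset_card_mono psubsetI)
  moreover have "S \<subseteq> A" by (auto simp: S_def)
  ultimately show ?thesis using hall1[of S] cS cardAB by (cases "S = {}") simp_all
qed

text \<open>\<open>hall2\<close> and \<open>hall3\<close> trade places, and \<open>hall1\<close> is
  carried over by complementation. Every result on vertices of \<open>A\<close> thereby has a
  version for \<open>B\<close>.\<close>

lemma dual: "core B A (E\<inverse>) b1 b2 a1 a2"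
proof unfold_locales
  show "E\<inverse> \<subseteq> B \<times> A" using EAB by blast
  show "3 \<le> card B" using big cardAB by simp
  show "card S \<le> card ((E\<inverse>)\<inverse> `` S - {b1, b2})" if "S \<subseteq> A" "card S + 2 \<le> card A" for S
    using hall2[OF that] by simp
qed (fact finB finA cardAB[symmetric] bB aA hall1_dual hall3)+

lemma swap_b: "core A B E a1 a2 b2 b1"
proof unfold_locales
  show "card S \<le> card (E `` S - {b2, b1})" if "S \<subseteq> A" "card S + 2 \<le> card A" for S
    using hall2[OF that] by (simp add: insert_commute)
qed (fact finB finA cardAB big EAB bB bB(3)[symmetric] aA hall1 hall3)+

text \<open>Deleting \<open>p q\<close> destroys every perfect matching through the special edges exactly if such an \<open>S\<close>
  exists. If \<open>tight S p q\<close>, then deleting \<open>p q\<close> leaves no perfect matching that avoids them and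
  joins \<open>A - S\<close> to \<open>N S - {q}\<close>. In both cases \<open>p\<close> is the only neighbour of \<open>q\<close> in \<open>S\<close>.\<close>

definition cutI :: "'a set \<Rightarrow> 'a \<Rightarrow> 'b \<Rightarrow> bool" where
  "cutI S p q \<longleftrightarrow> S \<subseteq> A - {a1, a2} \<and> p \<in> S \<and> card (N S) = card S + 2 \<and> b1 \<in> N S \<and> b2 \<in> N S \<and>
     q \<noteq> b1 \<and> q \<noteq> b2 \<and> (p, q) \<in> E \<and> (\<forall>s\<in>S. (s, q) \<in> E \<longrightarrow> s = p)"

definition tight :: "'a set \<Rightarrow> 'a \<Rightarrow> 'b \<Rightarrow> bool" where
  "tight S p q \<longleftrightarrow> S \<subseteq> A \<and> p \<in> S \<and> card (N S) = card S + 1 \<and> (p, q) \<in> E \<and> (\<forall>s\<in>S. (s, q) \<in> E \<longrightarrow> s = p)"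

text \<open>The Hall form of the following: once \<open>p q\<close> is deleted, no perfect matching
  through both special edges contains \<open>u v\<close>. The first four disjuncts are the pairs
  that meet a special edge.\<close>

definition blocked :: "'a \<Rightarrow> 'b \<Rightarrow> 'a \<Rightarrow> 'b \<Rightarrow> bool" where
  "blocked p q u v \<longleftrightarrow> u = a1 \<or> u = a2 \<or> v = b1 \<or> v = b2 \<or>
    (\<exists>W \<subseteq> A - {a1, a2, u}. card ((E - {(p, q)}) `` W - {b1, b2, v}) < card W)"

text \<open>Without \<open>p q\<close> the set \<open>S\<close> has exactly \<open>card S\<close>
  neighbours, so a perfect matching avoiding the special edges spends all of them on
  \<open>S\<close> and cannot contain \<open>u v\<close>; \<open>blocked\<close> excludes the other
  matchings. So \<open>u v\<close> becomes inadmissible.\<close>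

definition tight_blocked :: "'a set \<Rightarrow> 'a \<Rightarrow> 'b \<Rightarrow> bool" where
  "tight_blocked S p q \<longleftrightarrow> tight S p q \<and> (\<exists>u v. (u, v) \<in> E \<and> u \<notin> S \<and> v \<in> N S \<and> v \<noteq> q \<and> blocked p q u v)"

section \<open>From a nonremovable pair to a violating set\<close>

lemma Image_del_lost: "\<forall>s\<in>S. (s, q) \<in> E \<longrightarrow> s = p \<Longrightarrow> (E - {(p, q)}) `` S = N S - {q}"
  by (rule set_eqI) (simp add: Image_iff, blast)

lemma Image_del_keep: assumes "s \<in> S" "(s, q) \<in> E" "s \<noteq> p" shows "(E - {(p, q)}) `` S = N S"
  using assms by (intro set_eqI) (simp add: Image_iff, blast)

lemma Image_del_cases:
  obtains "p \<in> S" "(p, q) \<in> E" "\<forall>s\<in>S. (s, q) \<in> E \<longrightarrow> s = p" "(E - {(p, q)}) `` S = N S - {q}" "q \<in> N S"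
  | "(E - {(p, q)}) `` S = N S"
proof (cases "\<exists>s\<in>S. (s, q) \<in> E \<and> s \<noteq> p")
  case True
  then show ?thesis using that(2) Image_del_keep by metis
next
  case False
  show ?thesis
  proof (cases "p \<in> S \<and> (p, q) \<in> E")
    case True
    then show ?thesis using that(1) False Image_del_lost[of S q p] by blast
  next
    case F2: False
    then have "q \<notin> N S" using False by blast
    then show ?thesis using that(2) False Image_del_lost[of S q p] by (metis Diff_empty Diff_insert0)
  qed
qed

lemma Image_lost:
  assumes "(E - {(p, q)}) `` S \<noteq> N S"
  shows "p \<in> S" "\<forall>s\<in>S. (s, q) \<in> E \<longrightarrow> s = p" "(E - {(p, q)}) `` S = N S - {q}" "q \<in> N S"
proof -
  have "p \<in> S \<and> (\<forall>s\<in>S. (s, q) \<in> E \<longrightarrow> s = p) \<and> (E - {(p, q)}) `` S = N S - {q} \<and> q \<in> N S"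
    by (rule Image_del_cases[of p S q]) (use assms in blast)+
  then show "p \<in> S" "\<forall>s\<in>S. (s, q) \<in> E \<longrightarrow> s = p" "(E - {(p, q)}) `` S = N S - {q}" "q \<in> N S" by blast+
qed

text \<open>A failure of \<open>removable_pair\<close> is a failure of Hall's condition after
  \<open>p q\<close> is deleted. Since the bounds of \<open>core\<close> hold before the deletion,
  the violating set must lose the neighbour \<open>q\<close>, and its bound must hold with equality;
  \<open>cutI\<close> and \<open>tight\<close> record just this.\<close>

lemma nonrmv_cases:
  assumes "(p, q) \<in> E" "\<not> rm p q"
  shows "(\<exists>S. cutI S p q) \<or> (\<exists>S. tight_blocked S p q)"
proof -
  let ?F = "E - {(p, q)}"
  consider "\<not> (\<exists>m. matches ?F (A - {a1, a2}) (B - {b1, b2}) m)"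
    | u v where "(u, v) \<in> E" "(u, v) \<noteq> (p, q)" "\<not> admissible_pair A B a1 a2 b1 b2 ?F u v"
    using assms unfolding removable_pair_def by blast
  then show ?thesis
  proof cases
    case 1
    have "card (A - {a1, a2}) = card (B - {b1, b2})"
      using aA bB cardAB finA finB by (simp add: card_Diff_subset)
    then obtain S where S: "S \<subseteq> A - {a1, a2}" "card (?F `` S \<inter> (B - {b1, b2})) < card S"
      using hall_fail[OF 1] finA finB by blast
    have e: "?F `` S \<inter> (B - {b1, b2}) = ?F `` S - {b1, b2}" using EAB by blast
    note S2 = S(2)[unfolded e]
    have ne: "S \<noteq> {}" using S by auto
    have SA: "S \<subseteq> A" "a1 \<notin> S" "a2 \<notin> S" using S(1) by auto
    have cd: "card S + 2 \<le> card (N S)" using D2 SA ne by auto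
    have cA: "card S + 2 \<le> card A" using S(1) aA finA by (intro card_sub2[of A S a1 a2]) auto
    have h: "card S \<le> card (N S - {b1, b2})" using hall2[OF SA(1) cA] .
    have "?F `` S \<noteq> N S" using S2 h by (metis linorder_not_less)
    note lost = Image_lost[OF this]
    have qN: "q \<in> N S" using lost(1) assms(1) by blast
    have qb: "q \<noteq> b1 \<and> q \<noteq> b2"
    proof (rule ccontr)
      assume "\<not> ?thesis"
      then have "N S - {q} - {b1, b2} = N S - {b1, b2}" by blast
      then show False using S2 h unfolding lost(3) by simp
    qed
    have "card (N S - {b1, b2} - {q}) + 1 = card (N S - {b1, b2})"
      using card_Suc_Diff1[of "N S - {b1, b2}" q] qN qb by simp
    moreover have "N S - {b1, b2} - {q} = N S - {q} - {b1, b2}" by blast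
    ultimately have c1: "card (N S - {b1, b2}) = card S" using S2 h unfolding lost(3) by simp
    have "b1 \<in> N S \<and> b2 \<in> N S \<and> card (N S) = card S + 2"
    proof -
      have "N S = (N S - {b1, b2}) \<union> (N S \<inter> {b1, b2})" by blast
      then have "card (N S) \<le> card (N S - {b1, b2}) + card (N S \<inter> {b1, b2})" by (metis card_Un_le)
      moreover have "card (N S \<inter> {b1, b2}) \<le> card {b1, b2}" by (intro card_mono) auto
      moreover have "card {b1, b2} = 2" using bB by simp
      ultimately have c3: "card (N S \<inter> {b1, b2}) = card {b1, b2}" "card (N S) = card S + 2" using cd c1 by auto
      then have "N S \<inter> {b1, b2} = {b1, b2}" by (intro card_subset_eq) auto
      then show ?thesis using c3(2) by blast
    qed
    then have "cutI S p q" unfolding cutI_def using S(1) lost(1,2) assms(1) qb by blast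
    then show ?thesis by blast
  next
    case 2
    have uv: "u \<in> A" "v \<in> B" "(u, v) \<in> ?F" using 2 EAB by auto
    have "\<not> (\<exists>m. matches ?F (A - {u}) (B - {v}) m)"
    proof
      assume "\<exists>m. matches ?F (A - {u}) (B - {v}) m"
      then obtain m where "matches ?F (A - {u}) (B - {v}) m" by blast
      from extend_matches[OF this uv(3,1,2)] have "matches ?F A B (m(u := v)) \<and> (m(u := v)) u = v" by simp
      then show False using 2(3) unfolding admissible_pair_def by blast
    qed
    moreover have "card (A - {u}) = card (B - {v})" using uv finA finB cardAB by simp
    ultimately obtain S where S: "S \<subseteq> A - {u}" "card (?F `` S \<inter> (B - {v})) < card S"
      using hall_fail[of ?F "A - {u}" "B - {v}"] finA finB by blast
    have e: "?F `` S \<inter> (B - {v}) = ?F `` S - {v}" using EAB by blast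
    note S2 = S(2)[unfolded e]
    have ne: "S \<noteq> {}" using S by auto
    have h: "card S + 1 \<le> card (N S)" using hall1[of S] S(1) ne uv(1) by blast
    have cF: "card (?F `` S) \<le> card S" using S2 card_le_Diff1[of "?F `` S" v] by linarith
    then have "?F `` S \<noteq> N S" using h by auto
    note lost = Image_lost[OF this]
    have qN: "q \<in> N S" using lost(1) assms(1) by blast
    have cN: "card (N S) = card (?F `` S) + 1" using card_Suc_Diff1[OF finN qN] lost(3) by simp
    then have cN': "card (N S) = card S + 1" using h cF by simp
    have vF: "v \<in> ?F `` S"
    proof (rule ccontr)
      assume "v \<notin> ?F `` S"
      then have "?F `` S - {v} = ?F `` S" by blast
      then show False using S2 cN cN' by simp
    qed
    have t: "tight S p q" unfolding tight_def using S(1) lost(1,2) cN' assms(1) by blast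
    have "blocked p q u v"
    proof (rule ccontr)
      \<comment> \<open>If \<open>u v\<close> were not blocked, it could be completed to a perfect
        matching through the special edges and would be admissible.\<close>
      assume nb: "\<not> blocked p q u v"
      then have nn: "u \<noteq> a1" "u \<noteq> a2" "v \<noteq> b1" "v \<noteq> b2" unfolding blocked_def by blast+
      let ?P = "A - {a1, a2} - {u}" and ?Q = "B - {b1, b2} - {v}"
      have "card ?P = card ?Q" using nn uv aA bB finA finB cardAB by (simp add: card_Diff_subset)
      moreover have "card W \<le> card (?F `` W \<inter> ?Q)" if "W \<subseteq> ?P" for W
      proof -
        have "W \<subseteq> A - {a1, a2, u}" using that by auto
        then have "card W \<le> card (?F `` W - {b1, b2, v})" using nb unfolding blocked_def by (simp add: linorder_not_less)
        moreover have "?F `` W - {b1, b2, v} = ?F `` W \<inter> ?Q" using EAB by blast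
        ultimately show ?thesis by simp
      qed
      ultimately obtain m where "matches ?F ?P ?Q m" using hall_matches[of ?P ?Q ?F] finA finB by auto
      then have "matches ?F (A - {a1, a2}) (B - {b1, b2}) (m(u := v))"
        using extend_matches[of ?F "A - {a1, a2}" u "B - {b1, b2}" v m] uv nn by simp
      moreover have "(m(u := v)) u = v" "u \<notin> {a1, a2}" using nn by simp_all
      ultimately have "admissible_pair A B a1 a2 b1 b2 ?F u v" unfolding admissible_pair_def by blast
      then show False using 2 by blast
    qed
    moreover have "u \<notin> S" "v \<in> N S" "v \<noteq> q" using S(1) vF lost(3) by blast+
    ultimately have "tight_blocked S p q" unfolding tight_blocked_def using t 2(1) by blast
    then show ?thesis by blast
  qed
qed


section \<open>Uncrossing the obstructions at one vertex\<close>

lemma card_Un_Int_A: "S \<subseteq> A \<Longrightarrow> W \<subseteq> A \<Longrightarrow> card (S \<union> W) + card (S \<inter> W) = card S + card W"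
  using card_Un_Int[of S W] finS by simp

text \<open>Within \<open>S\<close> only \<open>p\<close> sees \<open>q\<close>, and within
  \<open>W\<close> only \<open>p\<close> sees \<open>q'\<close>. So taking \<open>p\<close> out of
  \<open>S \<inter> W\<close> gives up two common neighbours for one vertex. This gain of one drives
  all the uncrossing below.\<close>

lemma N_Diff2:
  assumes "\<forall>s\<in>S. (s, q) \<in> E \<longrightarrow> s = p" "\<forall>s\<in>W. (s, q') \<in> E \<longrightarrow> s = p"
    "p \<in> S" "p \<in> W" "(p, q) \<in> E" "(p, q') \<in> E" "q \<noteq> q'"
  shows "card (N (S \<inter> W - {p})) + 2 \<le> card (N S \<inter> N W)"
proof (rule card_sub2[of _ _ q q'])
  show "N (S \<inter> W - {p}) \<subseteq> N S \<inter> N W - {q, q'}" using assms by blast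
  show "q \<in> N S \<inter> N W" "q' \<in> N S \<inter> N W" using assms(3-6) by blast+
qed (use assms(7) in simp_all)

lemma card_minus: "S \<subseteq> A \<Longrightarrow> p \<in> S \<Longrightarrow> card (S - {p}) + 1 = card S"
  using card_Suc_Diff1[OF finS] by simp

lemma four_le: assumes "finite X" "{x, y, z, w} \<subseteq> X" "distinct [x, y, z, w]" shows "4 \<le> card X"
  using card_mono[OF assms(1,2)] assms(3) by simp

lemma three_le: assumes "finite X" "{x, y, z} \<subseteq> X" "distinct [x, y, z]" shows "3 \<le> card X"
  using card_mono[OF assms(1,2)] assms(3) by simp

text \<open>By \<open>D2\<close> for the union, \<open>N S \<inter> N W\<close> has at most two
  elements more than \<open>S \<inter> W\<close>. Removing \<open>p\<close> costs two of them and
  would contradict \<open>D2\<close> unless \<open>S \<inter> W = {p}\<close>. But then three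
  elements would have to accommodate \<open>b1\<close>, \<open>b2\<close>, \<open>q\<close> and
  \<open>q'\<close>.\<close>

lemma cutI_unique:
  assumes S: "cutI S p q" and W: "cutI W p q'" shows "q = q'"
proof (rule ccontr)
  assume ne: "q \<noteq> q'"
  note s = S[unfolded cutI_def] and w = W[unfolded cutI_def]
  have A': "S \<subseteq> A" "W \<subseteq> A" using s w by blast+
  have "card (S \<union> W) + 2 \<le> card (N (S \<union> W))" using s w by (intro D2) blast+
  then have cap: "card (N S \<inter> N W) \<le> card (S \<inter> W) + 2"
    using submod[of S W] card_Un_Int_A[OF A'] s w by linarith
  have d: "card (N (S \<inter> W - {p})) + 2 \<le> card (N S \<inter> N W)" using s w ne by (intro N_Diff2) blast+
  have cm: "card (S \<inter> W - {p}) + 1 = card (S \<inter> W)" using A' s w by (intro card_minus) blast+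
  have e: "S \<inter> W - {p} = {}"
  proof (rule ccontr)
    assume "S \<inter> W - {p} \<noteq> {}"
    then have "card (S \<inter> W - {p}) + 2 \<le> card (N (S \<inter> W - {p}))" using s w by (intro D2) blast+
    then show False using cap d cm by linarith
  qed
  have "card (N S \<inter> N W) \<le> 3" using cap cm unfolding e by simp
  moreover have "4 \<le> card (N S \<inter> N W)" 
  proof (rule four_le[of _ b1 b2 q q'])
    show "{b1, b2, q, q'} \<subseteq> N S \<inter> N W" using s w by blast
    show "distinct [b1, b2, q, q']" using s w ne bB(3) by (simp, blast)
  qed simp
  ultimately show False by linarith
qed

text \<open>The same uncrossing with \<open>hall1\<close> in place of \<open>D2\<close>: if the
  union is proper, then \<open>S \<inter> W = {p}\<close> and \<open>p\<close> has at most two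
  neighbours, too few for a vertex that is not an end of \<open>e1\<close>.\<close>

lemma tight_union:
  assumes S: "tight S p q" and W: "tight W p q'" and ne: "q \<noteq> q'" and p: "p \<noteq> a1" "p \<noteq> a2" shows "S \<union> W = A"
proof (rule ccontr)
  assume nA: "S \<union> W \<noteq> A"
  note s = S[unfolded tight_def] and w = W[unfolded tight_def]
  have A': "S \<subseteq> A" "W \<subseteq> A" "p \<in> A" using s w by blast+
  have "card (S \<union> W) + 1 \<le> card (N (S \<union> W))" using s w nA by (intro hall1) blast+
  then have cap: "card (N S \<inter> N W) \<le> card (S \<inter> W) + 1"
    using submod[of S W] card_Un_Int_A[OF A'(1,2)] s w by linarith
  have d: "card (N (S \<inter> W - {p})) + 2 \<le> card (N S \<inter> N W)" using s w ne by (intro N_Diff2) blast+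
  have cm: "card (S \<inter> W - {p}) + 1 = card (S \<inter> W)" using A' s w by (intro card_minus) blast+
  have e: "S \<inter> W - {p} = {}"
  proof (rule ccontr)
    assume "S \<inter> W - {p} \<noteq> {}"
    then have "card (S \<inter> W - {p}) + 1 \<le> card (N (S \<inter> W - {p}))" using A' by (intro hall1) blast+
    then show False using cap d cm by linarith
  qed
  have "card (N S \<inter> N W) \<le> 2" using cap cm unfolding e by simp
  moreover have "card (N {p}) \<le> card (N S \<inter> N W)" using s w by (intro card_mono) (simp, blast)
  ultimately show False using deg3[OF A'(3) p] by linarith
qed

lemma dual_deg3: assumes "q \<in> B" "q \<noteq> b1" "q \<noteq> b2" shows "3 \<le> card (E\<inverse> `` {q})"
  using core.deg3[OF dual assms] .

lemma dual_two: assumes "q \<in> B" shows "2 \<le> card (E\<inverse> `` {q})"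
  using core.N_two[OF dual, of "{q}"] assms by simp

text \<open>A tight set missing one vertex already sees all of \<open>B\<close>. The only possible
  neighbours of \<open>q\<close> are then \<open>p\<close> and the missing vertex, and degree two
  singles out \<open>b1\<close> and \<open>b2\<close>.\<close>

lemma tight_corank1:
  assumes "tight S p q" "card A \<le> card S + 1"
  shows "N S = B" "card (E\<inverse> `` {q}) = 2" "q = b1 \<or> q = b2"
proof -
  note s = assms(1)[unfolded tight_def]
  show NS: "N S = B" using s assms(2) cardAB by (intro card_seteq[OF finB NB]) simp
  have qB: "q \<in> B" using s EAB by blast
  have "E\<inverse> `` {q} \<subseteq> insert p (A - S)" using s EAB by blast
  then have "card (E\<inverse> `` {q}) \<le> card (insert p (A - S))" using finA by (intro card_mono) simp_all
  also have "\<dots> \<le> card (A - S) + 1" by (simp add: card_insert_if finA)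
  also have "card (A - S) = card A - card S" using s finS by (simp add: card_Diff_subset)
  finally have "card (E\<inverse> `` {q}) \<le> 2" using assms(2) by linarith
  then show "card (E\<inverse> `` {q}) = 2" "q = b1 \<or> q = b2" using dual_two[OF qB] dual_deg3[OF qB] by fastforce+
qed

text \<open>A surplus of one is too small for \<open>B2\<close>, so a tight set cannot see both
  \<open>b1\<close> and \<open>b2\<close>, unless it misses just one vertex; then \<open>q\<close>
  is itself one of the two.\<close>

lemma tight_b: assumes "tight S p q" shows "b1 \<notin> N S - {q} \<or> b2 \<notin> N S - {q}"
proof (cases "card S + 2 \<le> card A")
  case True
  note s = assms[unfolded tight_def]
  have "\<not> (b1 \<in> N S \<and> b2 \<in> N S)"
  proof
    assume "b1 \<in> N S \<and> b2 \<in> N S"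
    then have "card S + 2 \<le> card (N S)" using B2[of S] s True by blast
    then show False using s by linarith
  qed
  then show ?thesis by blast
next
  case False
  then have "q = b1 \<or> q = b2" using tight_corank1(3)[OF assms] by linarith
  then show ?thesis by blast
qed

text \<open>Otherwise \<open>p\<close> would be the only neighbour of \<open>w\<close>, but every
  vertex has at least two.\<close>

lemma tight_cover:
  assumes S: "tight S p q" and W: "tight W p q'" and SW: "S \<union> W = A" and w: "w \<in> B"
  shows "w \<in> N S - {q} \<or> w \<in> N W - {q'}"
proof (rule ccontr)
  assume "\<not> ?thesis"
  then have "E\<inverse> `` {w} \<subseteq> {p}" using S W SW EAB unfolding tight_def by blast
  then have "card (E\<inverse> `` {w}) \<le> 1" using card_mono[of "{p}" "E\<inverse> `` {w}"] by simp
  then show False using dual_two[OF w] by linarith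
qed

text \<open>Pigeonhole: each of the three sets misses \<open>b1\<close> or \<open>b2\<close>, so two
  of them miss the same one, while any two of them cover \<open>A\<close> and hence \<open>B\<close>
  by \<open>tight_cover\<close>.\<close>

lemma tight_three:
  assumes "tight S p q" "tight W p q'" "tight V p q''" "q \<noteq> q'" "q \<noteq> q''" "q' \<noteq> q''" "p \<noteq> a1" "p \<noteq> a2"
  shows False
proof -
  have "S \<union> W = A" "S \<union> V = A" "W \<union> V = A" using tight_union assms by blast+
  then show False
    using tight_b[OF assms(1)] tight_b[OF assms(2)] tight_b[OF assms(3)] tight_cover[OF assms(1,2)] tight_cover[OF assms(1,3)]
      tight_cover[OF assms(2,3)] bB by metis
qed

text \<open>\<open>D2\<close> on the intersection and \<open>B2\<close> on the union would give a
  total surplus of four, but the two sets together have only three. So the union is too large for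
  \<open>B2\<close>.\<close>

lemma cutI_tight:
  assumes S: "cutI S p q" and W: "tight W p' q'" and SW: "S \<inter> W \<noteq> {}" shows "card A \<le> card (S \<union> W) + 1"
proof (rule ccontr)
  assume n: "\<not> ?thesis"
  note s = S[unfolded cutI_def] and w = W[unfolded tight_def]
  have A': "S \<subseteq> A" "W \<subseteq> A" using s w by blast+
  have "card (S \<inter> W) + 2 \<le> card (N (S \<inter> W))" using s SW by (intro D2) blast+
  then have "card (S \<inter> W) + 2 \<le> card (N S \<inter> N W)" using card_N_Int_le[of S W] by linarith
  then have "card (N (S \<union> W)) \<le> card (S \<union> W) + 1"
    using submod[of S W] card_Un_Int_A[OF A'] s w by linarith
  moreover have "card (S \<union> W) + 2 \<le> card (N (S \<union> W))" 
  proof (rule B2)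
    show "S \<union> W \<subseteq> A" using A' by blast
    show "card (S \<union> W) + 2 \<le> card A" using n by linarith
    show "b1 \<in> N (S \<union> W)" "b2 \<in> N (S \<union> W)" using s by blast+
  qed
  ultimately show False by linarith
qed

text \<open>Uncrossing gives \<open>S \<inter> S1 = {p}\<close>, hence
  \<open>S \<subseteq> S2\<close>, so by \<open>cutI_tight\<close> the set \<open>S2\<close> misses
  only one vertex and \<open>q2 = \<beta>2\<close> has degree two. Now \<open>p\<close> alone sees
  both \<open>q\<close> and \<open>\<beta>2\<close> within \<open>S\<close>, which forces
  \<open>S = {p}\<close>; so \<open>S\<close> also lies in \<open>S1\<close>, and the argument
  repeats for \<open>\<beta>1\<close>.\<close>

lemma cutI_tight_proper:
  assumes S: "cutI S p q" and S1: "tight S1 p q1" and S2: "tight S2 p q2" and ne: "q \<noteq> q1" "q \<noteq> q2" "q1 \<noteq> q2"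
    and un: "S1 \<union> S2 = A" and be: "\<beta>1 \<notin> N S1 - {q1}" "\<beta>2 \<notin> N S2 - {q2}" "{\<beta>1, \<beta>2} \<subseteq> {b1, b2}"
    and pr: "S \<union> S1 \<noteq> A"
  shows "(p, \<beta>1) \<in> E \<and> (p, \<beta>2) \<in> E \<and> card (E\<inverse> `` {\<beta>1}) = 2 \<and> card (E\<inverse> `` {\<beta>2}) = 2"
proof -
  note s = S[unfolded cutI_def] and s1 = S1[unfolded tight_def] and s2 = S2[unfolded tight_def]
  have A': "S \<subseteq> A" "S1 \<subseteq> A" "S2 \<subseteq> A" "p \<in> A" using s s1 s2 by blast+
  have "card (S \<union> S1) + 1 \<le> card (N (S \<union> S1))" using s s1 pr by (intro hall1) blast+
  then have cap: "card (N S \<inter> N S1) \<le> card (S \<inter> S1) + 2"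
    using submod[of S S1] card_Un_Int_A[OF A'(1,2)] s s1 by linarith
  have d: "card (N (S \<inter> S1 - {p})) + 2 \<le> card (N S \<inter> N S1)" using s s1 ne by (intro N_Diff2) blast+
  have cm: "card (S \<inter> S1 - {p}) + 1 = card (S \<inter> S1)" using A' s s1 by (intro card_minus) blast+
  have e: "S \<inter> S1 - {p} = {}"
  proof (rule ccontr)
    assume "S \<inter> S1 - {p} \<noteq> {}"
    then have "card (S \<inter> S1 - {p}) + 2 \<le> card (N (S \<inter> S1 - {p}))" using s by (intro D2) blast+
    then show False using cap d cm by linarith
  qed
  have dj: "S \<inter> (A - S2) = {}" using e un s2 by blast
  have S2un: "S \<union> S2 \<subseteq> A - (A - S2)" using A' dj by blast
  have "card (S \<union> S2) \<le> card S2"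
    using dj A' finA finS by (intro card_mono) blast+
  moreover have "S \<inter> S2 \<noteq> {}" "S \<inter> S1 \<noteq> {}" using s s1 s2 by blast+
  ultimately have c2: "card A \<le> card S2 + 1" using cutI_tight[OF S S2] by linarith
  have b2q: "\<beta>2 = q2" using tight_corank1(1)[OF S2 c2] be bB by blast
  have r2: "card (E\<inverse> `` {\<beta>2}) = 2" "(p, \<beta>2) \<in> E" using tight_corank1(2)[OF S2 c2] b2q s2 by simp_all
  have "S - {p} = {}"
  proof (rule ccontr)
    assume n: "S - {p} \<noteq> {}"
    have "\<forall>x\<in>S. (x, \<beta>2) \<in> E \<longrightarrow> x = p" using s2 dj A' b2q by blast
    moreover have "q \<noteq> \<beta>2" using s be(3) by blast
    ultimately have "card (N (S \<inter> S - {p})) + 2 \<le> card (N S \<inter> N S)" using s r2(2) by (intro N_Diff2[of _ q _ _ \<beta>2]) blast+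
    then have "card (N (S - {p})) + 2 \<le> card (N S)" by simp
    moreover have "card (S - {p}) + 2 \<le> card (N (S - {p}))" using s n by (intro D2) blast+
    moreover have "card (S - {p}) + 1 = card S" using A' s by (intro card_minus) blast+
    ultimately show False using s by linarith
  qed
  then have "S \<union> S1 = S1" using s s1 by blast
  then have c1: "card A \<le> card S1 + 1" using cutI_tight[OF S S1] \<open>S \<inter> S1 \<noteq> {}\<close> by simp
  have "\<beta>1 = q1" using tight_corank1(1)[OF S1 c1] be bB by blast
  then have "card (E\<inverse> `` {\<beta>1}) = 2" "(p, \<beta>1) \<in> E" using tight_corank1(2)[OF S1 c1] s1 by simp_all
  then show ?thesis using r2 by blast
qed


text \<open>The bounds force \<open>W \<union> S1\<close> to miss only \<open>u\<close>. If \<open>p \<in> W\<close> this forces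
  \<open>W \<inter> S1 = {p}\<close>, too small for the neighbours \<open>q, q1, q2, v\<close>; otherwise all of \<open>B - (N S1 - {q1})\<close>
  lies in \<open>N W\<close>, which makes \<open>N W\<close> too large.\<close>

lemma blocked_inside:
  assumes S: "cutI S p q" and S1: "tight S1 p q1" and S2: "tight S2 p q2" and ne: "q \<noteq> q1" "q \<noteq> q2" "q1 \<noteq> q2"
    and un: "S1 \<union> S2 = A" and be: "\<beta>2 \<notin> N S2 - {q2}" "\<beta>2 = b1 \<or> \<beta>2 = b2" and cov: "S \<union> S1 = A"
    and u: "u \<in> A" "u \<notin> S1" and v: "v \<in> N S1" "v \<noteq> q" "v \<noteq> q1" "v \<noteq> q2"
    and W: "W \<subseteq> S" "u \<notin> W" "b1 \<in> N W" "b2 \<in> N W" "v \<in> N W" "card (N W) = card W + 2"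
  shows False
proof -
  note s = S[unfolded cutI_def] and s1 = S1[unfolded tight_def] and s2 = S2[unfolded tight_def]
  have A': "S \<subseteq> A" "S1 \<subseteq> A" "S2 \<subseteq> A" "p \<in> A" "W \<subseteq> A" using s s1 s2 W by blast+
  \<comment> \<open>A vertex of \<open>W\<close> adjacent to \<open>\<beta>2\<close> must lie in
    \<open>S1\<close>: outside \<open>S1\<close> it would be a vertex of \<open>S2\<close> other
    than \<open>p\<close>, and none of those sees \<open>\<beta>2\<close>.\<close>
  have "\<beta>2 \<in> N W" using be W by blast
  then obtain z where z: "z \<in> W" "(z, \<beta>2) \<in> E" by blast
  have "z \<in> S1"
  proof (rule ccontr)
    assume zn: "z \<notin> S1"
    then have "z \<in> S2" "z \<noteq> p" using un z A' s1 by blast+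
    then show False using be z s2 by blast
  qed
  then have Pne: "W \<inter> S1 \<noteq> {}" using z by blast
  have cP: "card (W \<inter> S1) + 2 \<le> card (N (W \<inter> S1))" using Pne W s by (intro D2) blast+
  then have cP': "card (W \<inter> S1) + 2 \<le> card (N W \<inter> N S1)" using card_N_Int_le[of W S1] by linarith
  have cU: "card (N (W \<union> S1)) \<le> card (W \<union> S1) + 1"
    using submod[of W S1] card_Un_Int_A[OF A'(5) A'(2)] W s1 cP' by linarith
  have big': "card A \<le> card (W \<union> S1) + 1"
  proof (rule ccontr)
    assume n: "\<not> ?thesis"
    have "card (W \<union> S1) + 2 \<le> card (N (W \<union> S1))"
    proof (rule B2)
      show "W \<union> S1 \<subseteq> A" using A' by blast
      show "card (W \<union> S1) + 2 \<le> card A" using n by linarith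
      show "b1 \<in> N (W \<union> S1)" "b2 \<in> N (W \<union> S1)" using W by blast+
    qed
    then show False using cU by linarith
  qed
  have Weq: "W \<union> S1 = A - {u}"
  proof (rule card_seteq)
    show "finite (A - {u})" using finA by simp
    show "W \<union> S1 \<subseteq> A - {u}" using A' W u by blast
    show "card (A - {u}) \<le> card (W \<union> S1)" using big' card_minus[OF order_refl u(1)] by linarith
  qed
  have "card (W \<union> S1) + 1 \<le> card (N (W \<union> S1))" using Weq Pne u by (intro hall1) blast+
  then have "card (N W \<inter> N S1) \<le> card (W \<inter> S1) + 2"
    using submod[of W S1] card_Un_Int_A[OF A'(5) A'(2)] W s1 by linarith
  then have cle: "card (N W \<inter> N S1) \<le> card (N (W \<inter> S1))" "card (N (W \<inter> S1)) = card (W \<inter> S1) + 2"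
    using cP card_N_Int_le[of W S1] by linarith+
  have NP: "N (W \<inter> S1) = N W \<inter> N S1"
  proof (rule card_seteq)
    show "N (W \<inter> S1) \<subseteq> N W \<inter> N S1" by blast
  qed (use cle(1) in simp_all)
  note cNP = cle(2)
  show False
  proof (cases "p \<in> W")
    case True
    have e: "W \<inter> S1 - {p} = {}"
    proof (rule ccontr)
      assume n: "W \<inter> S1 - {p} \<noteq> {}"
      have "card (N (W \<inter> S1 - {p})) + 2 \<le> card (N W \<inter> N S1)"
        using s s1 W True ne by (intro N_Diff2[of _ q _ _ q1]) blast+
      moreover have "card (W \<inter> S1 - {p}) + 2 \<le> card (N (W \<inter> S1 - {p}))" using n W s by (intro D2) blast+
      moreover have "card (W \<inter> S1 - {p}) + 1 = card (W \<inter> S1)" using A' True s1 by (intro card_minus) blast+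
      ultimately show False using cNP NP by simp
    qed
    then have P: "W \<inter> S1 = {p}" using True s1 by blast
    have "4 \<le> card (N W \<inter> N S1)"
    proof (rule four_le[of _ q q1 q2 v])
      show "{q, q1, q2, v} \<subseteq> N W \<inter> N S1" using True s s1 s2 v W by blast
      show "distinct [q, q1, q2, v]" using ne v(2-4) by auto
    qed simp
    then show False using cNP NP P by simp
  next
    case False
    have T1: "B - (N S1 - {q1}) \<subseteq> N W"
    proof
      fix w assume w: "w \<in> B - (N S1 - {q1})"
      show "w \<in> N W"
      proof (rule ccontr)
        assume wn: "w \<notin> N W"
        \<comment> \<open>In \<open>S1\<close> only \<open>p\<close> can see such a
          \<open>w\<close>, and then only if \<open>w = q1\<close>; outside \<open>W\<close> and
          \<open>S1\<close> only \<open>u\<close> is left. Degree at most two makes \<open>w\<close>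
          one of \<open>b1\<close>, \<open>b2\<close>, and both are in \<open>N W\<close>.\<close>
        have sub: "E\<inverse> `` {w} \<subseteq> {p, u}" using w wn Weq s1 EAB by blast
        then have "card (E\<inverse> `` {w}) \<le> card {p, u}" by (intro card_mono) simp_all
        also have "card {p, u} \<le> 2" by (simp add: card_insert_if)
        finally have "w = b1 \<or> w = b2" using dual_deg3[of w] w by fastforce
        then show False using wn W by blast
      qed
    qed
    have q1P: "q1 \<notin> N (W \<inter> S1)" using False s1 by blast
    \<comment> \<open>Both parts lie in \<open>N W\<close>, and they are disjoint because
      \<open>q1\<close> is not seen from \<open>W \<inter> S1\<close>. Together they exceed
      \<open>card W + 2\<close> by one.\<close>
    have "card (N (W \<inter> S1)) + card (B - (N S1 - {q1})) = card (N (W \<inter> S1) \<union> (B - (N S1 - {q1})))"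
      using finB q1P NP by (intro card_Un_disjoint[symmetric]) (simp, simp, blast)
    also have "\<dots> \<le> card (N W)" using T1 NP by (intro card_mono) (simp, blast)
    finally have f1: "card (N (W \<inter> S1)) + card (B - (N S1 - {q1})) \<le> card (N W)" .
    have "card (B - (N S1 - {q1})) = card B - card (N S1 - {q1})"
      using NB by (intro card_Diff_subset) (simp, blast)
    moreover have "q1 \<in> N S1" using s1 by blast
    then have "card (N S1 - {q1}) + 1 = card (N S1)" using card_Suc_Diff1[OF finN] by simp
    moreover have "card (N S1 - {q1}) \<le> card B" using NB finB by (intro card_mono) blast+
    ultimately have f2: "card (B - (N S1 - {q1})) + card S1 = card A" using s1 cardAB by linarith
    have "card (W \<union> S1) + 1 = card A" using Weq card_minus[OF order_refl u(1)] by simp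
    then have "card W + card S1 + 1 = card A + card (W \<inter> S1)" using card_Un_Int_A[OF A'(5) A'(2)] by linarith
    then show False using f1 f2 cNP W by linarith
  qed
qed

text \<open>As \<open>S\<close> and \<open>S1\<close> cover \<open>A\<close>, the vertex
  \<open>u\<close> of the blocked pair is in \<open>S\<close>, and \<open>v\<close> differs from
  \<open>b1\<close>, \<open>b2\<close>, \<open>q\<close> and \<open>q2\<close>. So the pair meets no
  special edge and is blocked by a violating set \<open>W\<close>. Every way in which
  \<open>W\<close> can violate the condition leads to a set as in \<open>blocked_inside\<close>, to
  too many common neighbours of \<open>S\<close> and \<open>W\<close>, or to a second
  \<open>cutI\<close> at \<open>p\<close>.\<close>

lemma cutI_tight_blocked_not_cover:
  assumes S: "cutI S p q" and S1: "tight_blocked S1 p q1" and S2: "tight S2 p q2" and ne: "q \<noteq> q1" "q \<noteq> q2" "q1 \<noteq> q2"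
    and un: "S1 \<union> S2 = A" and be: "\<beta>1 \<notin> N S1 - {q1}" "\<beta>2 \<notin> N S2 - {q2}" "{\<beta>1, \<beta>2} = {b1, b2}"
    and cov: "S \<union> S1 = A"
  shows False
proof -
  have S10: "tight S1 p q1" using S1 by (simp add: tight_blocked_def)
  note s = S[unfolded cutI_def] and s1 = S10[unfolded tight_def] and s2 = S2[unfolded tight_def]
  obtain u v where uv: "(u, v) \<in> E" "u \<notin> S1" "v \<in> N S1" "v \<noteq> q1" "blocked p q1 u v" using S1 unfolding tight_blocked_def by blast
  have uA: "u \<in> A" "u \<in> S" "u \<in> S2" "u \<noteq> p" using uv EAB cov un s1 by blast+
  have u12: "u \<noteq> a1" "u \<noteq> a2" using uA s by blast+
  have vb1: "v \<noteq> \<beta>1" using uv be by blast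
  have vb2: "v \<noteq> \<beta>2" using uv(1) be(2) uA s2 by blast
  have vb: "v \<noteq> b1" "v \<noteq> b2" using vb1 vb2 be(3) by (metis doubleton_eq_iff)+
  have vq: "v \<noteq> q" using uv(1) uA s by blast
  have vq2: "v \<noteq> q2" using uv(1) uA s2 by blast
  note bi = blocked_inside[OF S S10 S2 ne un be(2) _ cov uA(1) uv(2,3) vq uv(4) vq2]
  have b2: "\<beta>2 = b1 \<or> \<beta>2 = b2" using be(3) by blast
  \<comment> \<open>Uncrossing with \<open>S\<close> moves the set into \<open>S\<close> without
    changing its surplus, where \<open>blocked_inside\<close> refutes it.\<close>
  have iii: False if W: "W \<subseteq> A - {a1, a2, u}" "b1 \<in> N W" "b2 \<in> N W" "v \<in> N W" "card (N W) = card W + 2" for W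
  proof -
    have A': "S \<subseteq> A" "W \<subseteq> A" using s W by blast+
    have "card (S \<union> W) + 2 \<le> card (N (S \<union> W))" using s W by (intro D2) blast+
    then have cap: "card (N S \<inter> N W) \<le> card (S \<inter> W) + 2"
      using submod[of S W] card_Un_Int_A[OF A'] s W by linarith
    have "3 \<le> card (N S \<inter> N W)"
    proof (rule three_le[of _ b1 b2 v])
      show "{b1, b2, v} \<subseteq> N S \<inter> N W" using s W uA uv by blast
      show "distinct [b1, b2, v]" using bB(3) vb by simp
    qed simp
    then have "S \<inter> W \<noteq> {}" using cap by force
    then have c: "card (S \<inter> W) + 2 \<le> card (N (S \<inter> W))" using s W by (intro D2) blast+
    then have cle: "card (N S \<inter> N W) \<le> card (N (S \<inter> W))" "card (N (S \<inter> W)) = card (S \<inter> W) + 2"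
      using cap card_N_Int_le[of S W] by linarith+
    have e: "N (S \<inter> W) = N S \<inter> N W"
    proof (rule card_seteq)
      show "N (S \<inter> W) \<subseteq> N S \<inter> N W" by blast
    qed (use cle(1) in simp_all)
    show False
    proof (rule bi[OF b2])
      show "S \<inter> W \<subseteq> S" "u \<notin> S \<inter> W" using W by blast+
      show "b1 \<in> N (S \<inter> W)" "b2 \<in> N (S \<inter> W)" "v \<in> N (S \<inter> W)"
        unfolding e using s W uA uv by blast+
    qed (fact cle(2))
  qed
  obtain W where W: "W \<subseteq> A - {a1, a2, u}" "card ((E - {(p, q1)}) `` W - {b1, b2, v}) < card W"
    using uv(5) u12 vb unfolding blocked_def by blast
  have Wne: "W \<noteq> {}" using W(2) by force
  have A': "S \<subseteq> A" "W \<subseteq> A" using s W by blast+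
  have cW: "card W + 2 \<le> card (N W)" using W(1) Wne by (intro D2) blast+
  have "card (S \<union> W) + 2 \<le> card (N (S \<union> W))" using s W by (intro D2) blast+
  then have cap: "card (N S \<inter> N W) + card W \<le> card (S \<inter> W) + card (N W)"
    using submod[of S W] card_Un_Int_A[OF A'] s W by linarith
  have diff: "card X \<le> card (X - Y) + card (X \<inter> Y)" if "finite X" for X Y :: "'b set"
    using card_Int_Diff[OF that, of Y] by linarith
  show False
  \<comment> \<open>If deleting \<open>p q1\<close> costs \<open>W\<close> no neighbour, the
    violation can only come from \<open>b1\<close>, \<open>b2\<close> and \<open>v\<close>, all
    three of which must lie in \<open>N W\<close>. Otherwise \<open>q1\<close> is a fourth
    candidate, and the surplus of \<open>W\<close> may be two or three.\<close>
  proof (cases "(E - {(p, q1)}) `` W = N W")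
    case True
    have c: "card (N W) \<le> card (N W - {b1, b2, v}) + card (N W \<inter> {b1, b2, v})" by (intro diff) simp
    have "card (N W \<inter> {b1, b2, v}) \<le> card {b1, b2, v}" by (intro card_mono) simp_all
    then have c3: "card (N W \<inter> {b1, b2, v}) \<le> 3" using bB(3) vb by simp
    have "card (N W) = card W + 2" "3 \<le> card (N W \<inter> {b1, b2, v})" using c c3 W(2) cW unfolding True by linarith+
    moreover from this(2) have "N W \<inter> {b1, b2, v} = {b1, b2, v}" using bB(3) vb by (intro card_seteq) simp_all
    ultimately show False using iii[OF W(1)] by blast
  next
    case lost0: False
    note lost = Image_lost[OF lost0]
    have q1W: "q1 \<in> N W" "q1 \<in> N S" "q \<in> N S" "q \<in> N W" "q2 \<in> N S" "q2 \<in> N W" "v \<in> N S" using lost s s1 s2 uA uv by blast+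
    have "N W - {q1} - {b1, b2, v} = N W - {q1, b1, b2, v}" by blast
    then have W2: "card (N W - {q1, b1, b2, v}) < card W" using W(2) unfolding lost(3) by simp
    have c: "card (N W) \<le> card (N W - {q1, b1, b2, v}) + card (N W \<inter> {q1, b1, b2, v})" by (intro diff) simp
    have "card (N W \<inter> {q1, b1, b2, v}) \<le> card {q1, b1, b2, v}" by (intro card_mono) simp_all
    then have c4: "card (N W \<inter> {q1, b1, b2, v}) \<le> 4" "card {q1, b1, b2, v} \<le> 4"
      by (auto simp: card_insert_if split: if_splits intro: order_trans)
    have dI: "card (N (S \<inter> W - {p})) + 2 \<le> card (N S \<inter> N W)" using s s1 lost ne by (intro N_Diff2[of _ q _ _ q1]) blast+
    have cm: "card (S \<inter> W - {p}) + 1 = card (S \<inter> W)" using A' s lost by (intro card_minus) blast+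
    consider "card (N W) = card W + 2" | "card (N W) = card W + 3" using c c4 W2 cW by linarith
    then show False
    proof cases
      case 1
      show False
      proof (cases "v \<in> N W")
        case True
        have e: "S \<inter> W - {p} = {}"
        proof (rule ccontr)
          assume "S \<inter> W - {p} \<noteq> {}"
          then have "card (S \<inter> W - {p}) + 2 \<le> card (N (S \<inter> W - {p}))" using s by (intro D2) blast+
          then show False using cap dI cm 1 by linarith
        qed
        have "4 \<le> card (N S \<inter> N W)"
        proof (rule four_le[of _ q q1 q2 v])
          show "{q, q1, q2, v} \<subseteq> N S \<inter> N W" using q1W True by blast
          show "distinct [q, q1, q2, v]" using ne vq vq2 uv(4) by auto
        qed simp
        moreover have "card (S \<inter> W - {p}) = 0" unfolding e by simp
        ultimately show False using cap cm 1 by linarith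
      next
        case False
        have e3: "N W \<inter> {q1, b1, b2, v} = N W \<inter> {q1, b1, b2}" using False by blast
        have "3 \<le> card (N W \<inter> {q1, b1, b2})" using c W2 1 unfolding e3 by linarith
        moreover have c33: "card {q1, b1, b2} \<le> 3" by (simp add: card_insert_if)
        ultimately have e: "N W \<inter> {q1, b1, b2} = {q1, b1, b2}" by (intro card_seteq) simp_all
        then have "card {q1, b1, b2} = 3" using \<open>3 \<le> card (N W \<inter> {q1, b1, b2})\<close> c33 by simp
        then have "q1 \<noteq> b1" "q1 \<noteq> b2" by (auto simp: card_insert_if split: if_splits)
        moreover have "b1 \<in> N W" "b2 \<in> N W" using e by blast+
        moreover have "(p, q1) \<in> E" using s1 by blast
        \<comment> \<open>With surplus two and \<open>v\<close> not a neighbour, the violation uses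
          exactly \<open>q1\<close>, \<open>b1\<close>, \<open>b2\<close>, so \<open>W\<close>
          obstructs \<open>p q1\<close> in the same way as \<open>S\<close> obstructs
          \<open>p q\<close>.\<close>
        ultimately have "cutI W p q1" unfolding cutI_def using W(1) lost(1,2) 1 by blast
        then show False using cutI_unique[OF S] ne by blast
      qed
    next
      case 2
      have "4 \<le> card (N W \<inter> {q1, b1, b2, v})" using c W2 2 by linarith
      then have e: "N W \<inter> {q1, b1, b2, v} = {q1, b1, b2, v}" using c4 by (intro card_seteq) simp_all
      then have c44: "card {q1, b1, b2, v} = 4" using \<open>4 \<le> card (N W \<inter> {q1, b1, b2, v})\<close> c4 by simp
      then have qb: "q1 \<noteq> b1" "q1 \<noteq> b2" by (auto simp: card_insert_if split: if_splits)
      have five: "{q, q1, b1, b2, v} \<subseteq> N S \<inter> N W" using e q1W s by blast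
      have "card {q, q1, b1, b2, v} = 5" using c44 ne(1) s vq by (auto simp: card_insert_if)
      then have c5: "5 \<le> card (N S \<inter> N W)" using card_mono[OF _ five] by simp
      have ne': "S \<inter> W - {p} \<noteq> {}"
      proof
        assume "S \<inter> W - {p} = {}"
        then have "card (S \<inter> W - {p}) = 0" by (metis card.empty)
        then show False using cap c5 cm 2 by linarith
      qed
      then have D: "card (S \<inter> W - {p}) + 2 \<le> card (N (S \<inter> W - {p}))" using s by (intro D2) blast+
      have sub: "N (S \<inter> W - {p}) \<subseteq> N S \<inter> N W - {q, q1}" using s lost by blast
      have "card (N S \<inter> N W - {q, q1}) + 2 \<le> card (N S \<inter> N W)"
        using q1W ne(1) by (intro card_sub2[of _ _ q q1]) (simp, simp, blast, blast, blast)
      then have ce: "card (N S \<inter> N W - {q, q1}) \<le> card (S \<inter> W - {p}) + 2" using cap cm 2 by linarith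
      \<comment> \<open>With surplus three, dropping \<open>p\<close> from
        \<open>S \<inter> W\<close> loses exactly \<open>q\<close> and \<open>q1\<close>; the
        remaining set has surplus two and still sees \<open>b1\<close>, \<open>b2\<close> and
        \<open>v\<close>.\<close>
      have eq: "N (S \<inter> W - {p}) = N S \<inter> N W - {q, q1}"
      proof (rule card_seteq[OF _ sub])
        show "card (N S \<inter> N W - {q, q1}) \<le> card (N (S \<inter> W - {p}))" using ce D by linarith
      qed simp
      show False
      proof (rule iii)
        show "S \<inter> W - {p} \<subseteq> A - {a1, a2, u}" using W by blast
        show "b1 \<in> N (S \<inter> W - {p})" "b2 \<in> N (S \<inter> W - {p})" "v \<in> N (S \<inter> W - {p})"
          unfolding eq using five qb s vq uv(4) by blast+
        show "card (N (S \<inter> W - {p})) = card (S \<inter> W - {p}) + 2" using D ce unfolding eq by linarith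
      qed
    qed
  qed
qed

text \<open>The two tight sets cover \<open>A\<close> and each misses one of \<open>b1\<close>,
  \<open>b2\<close>, so they miss different ones; this fixes \<open>\<beta>1\<close> and
  \<open>\<beta>2\<close>. The covering case being impossible, \<open>cutI_tight_proper\<close>
  yields the triangle.\<close>

lemma nonrmv_triangle:
  assumes S: "cutI S p q" and S1: "tight_blocked S1 p q1" and S2: "tight_blocked S2 p q2" and ne: "q \<noteq> q1" "q \<noteq> q2" "q1 \<noteq> q2"
  shows "(p, b1) \<in> E \<and> (p, b2) \<in> E \<and> card (E\<inverse> `` {b1}) = 2 \<and> card (E\<inverse> `` {b2}) = 2"
proof -
  have t: "tight S1 p q1" "tight S2 p q2" using S1 S2 by (simp_all add: tight_blocked_def)
  have p: "p \<noteq> a1" "p \<noteq> a2" using S by (auto simp: cutI_def)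
  have un: "S1 \<union> S2 = A" using tight_union[OF t ne(3) p] .
  have un': "S2 \<union> S1 = A" using un by blast
  have main: "(p, \<beta>1) \<in> E \<and> (p, \<beta>2) \<in> E \<and> card (E\<inverse> `` {\<beta>1}) = 2 \<and> card (E\<inverse> `` {\<beta>2}) = 2"
    if be: "\<beta>1 \<notin> N S1 - {q1}" "\<beta>2 \<notin> N S2 - {q2}" "{\<beta>1, \<beta>2} = {b1, b2}" for \<beta>1 \<beta>2
  proof (cases "S \<union> S1 = A")
    case True
    then show ?thesis using cutI_tight_blocked_not_cover[OF S S1 t(2) ne un be] by blast
  next
    case False
    show ?thesis using cutI_tight_proper[OF S t ne un be(1,2) _ False] be(3) by blast
  qed
  have "b1 \<notin> N S1 - {q1} \<or> b2 \<notin> N S1 - {q1}" "b1 \<notin> N S2 - {q2} \<or> b2 \<notin> N S2 - {q2}"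
    using tight_b t by blast+
  then consider "b1 \<notin> N S1 - {q1}" "b2 \<notin> N S2 - {q2}" | "b2 \<notin> N S1 - {q1}" "b1 \<notin> N S2 - {q2}"
    using tight_cover[OF t un] bB by blast
  then show ?thesis
  proof cases
    case 1 then show ?thesis using main[of b1 b2] by blast
  next
    case 2 then show ?thesis using main[of b2 b1] by (simp add: insert_commute)
  qed
qed

section \<open>Counting nonremovable pairs at a vertex\<close>

definition nonrem :: "'a \<Rightarrow> 'b set" where "nonrem p = {q. (p, q) \<in> E \<and> \<not> rm p q}"

lemma card_ge3_obtain: assumes "3 \<le> card X" obtains x y z where "{x, y, z} \<subseteq> X" "distinct [x, y, z]"
proof -
  obtain Y where "Y \<subseteq> X" "card Y = 3" using assms by (meson obtain_subset_with_card_n)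
  then show thesis using that unfolding card_3_iff by (metis distinct_length_2_or_more distinct_singleton)
qed

text \<open>At most one pair at \<open>p\<close> is obstructed by a \<open>cutI\<close> and at most
  two by tight sets. Three nonremovable pairs therefore need one obstruction of the first kind and
  two of the second.\<close>

lemma nonrem_card:
  assumes "p \<in> A" "p \<noteq> a1" "p \<noteq> a2"
  shows "card (nonrem p) \<le> 3"
    "3 \<le> card (nonrem p) \<Longrightarrow> (p, b1) \<in> E \<and> (p, b2) \<in> E \<and> card (E\<inverse> `` {b1}) = 2 \<and> card (E\<inverse> `` {b2}) = 2"
proof -
  define X1 where "X1 = {q \<in> nonrem p. \<exists>S. cutI S p q}"
  define X2 where "X2 = nonrem p - X1"
  have fin: "finite (nonrem p)" by (rule finite_subset[of _ "N {p}"]) (auto simp: nonrem_def)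
  have "nonrem p = X1 \<union> X2" "X1 \<inter> X2 = {}" by (auto simp: X1_def X2_def)
  then have c: "card (nonrem p) = card X1 + card X2" using fin by (metis card_Un_disjoint finite_Un)
  have t2: "\<exists>S. tight_blocked S p q" if "q \<in> X2" for q using that nonrmv_cases[of p q] by (auto simp: X2_def X1_def nonrem_def)
  have "finite X1" using fin by (simp add: X1_def)
  then have c1: "card X1 \<le> 1"
    using cutI_unique card_le_Suc0_iff_eq[of X1] unfolding One_nat_def X1_def by blast
  have c2: "card X2 \<le> 2"
  proof (rule ccontr)
    assume "\<not> ?thesis"
    then obtain x y z where xyz: "{x, y, z} \<subseteq> X2" "distinct [x, y, z]" using card_ge3_obtain[of X2] by (metis Suc_leI numeral_2_eq_2 numeral_3_eq_3 linorder_not_less)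
    then have "\<exists>S. tight S p x" "\<exists>S. tight S p y" "\<exists>S. tight S p z" using t2 by (auto simp: tight_blocked_def)
    then show False using tight_three assms xyz(2) by (metis distinct_length_2_or_more)
  qed
  show "card (nonrem p) \<le> 3" using c c1 c2 by simp
  assume "3 \<le> card (nonrem p)"
  then have cc: "card X1 = 1" "card X2 = 2" using c c1 c2 by linarith+
  obtain q where q: "X1 = {q}" using cc(1) card_1_singletonE by blast
  obtain q1 q2 where q12: "X2 = {q1, q2}" "q1 \<noteq> q2" using cc(2) by (meson card_2_iff)
  have "X1 \<inter> X2 = {}" by (auto simp: X2_def)
  then have ne: "q \<noteq> q1" "q \<noteq> q2" using q q12 by blast+
  obtain S where S: "cutI S p q" using q by (auto simp: X1_def)
  obtain S1 where S1: "tight_blocked S1 p q1" using t2[of q1] q12 by blast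
  obtain S2 where S2: "tight_blocked S2 p q2" using t2[of q2] q12 by blast
  show "(p, b1) \<in> E \<and> (p, b2) \<in> E \<and> card (E\<inverse> `` {b1}) = 2 \<and> card (E\<inverse> `` {b2}) = 2"
    using nonrmv_triangle[OF S S1 S2 ne q12(2)] .
qed

text \<open>Two such vertices would be the only neighbours of both \<open>b1\<close> and
  \<open>b2\<close>, but \<open>{b1, b2}\<close> must have at least three neighbours.\<close>

lemma nonrem_card3_unique:
  assumes "p \<in> A" "p \<noteq> a1" "p \<noteq> a2" "3 \<le> card (nonrem p)" "p' \<in> A" "p' \<noteq> a1" "p' \<noteq> a2" "3 \<le> card (nonrem p')"
  shows "p = p'"
proof (rule ccontr)
  assume ne: "p \<noteq> p'"
  have two: "E\<inverse> `` {\<beta>} = {p, p'}" if "(p, \<beta>) \<in> E" "(p', \<beta>) \<in> E" "card (E\<inverse> `` {\<beta>}) = 2" for \<beta>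
  proof (rule card_seteq[symmetric])
    show "finite (E\<inverse> `` {\<beta>})" using that(3) by (metis card.infinite zero_neq_numeral)
  qed (use that ne in auto)
  have e: "E\<inverse> `` {b1} = {p, p'}" "E\<inverse> `` {b2} = {p, p'}"
    using two nonrem_card(2)[OF assms(1-4)] nonrem_card(2)[OF assms(5-8)] by blast+
  have "E\<inverse> `` {b1, b2} = E\<inverse> `` {b1} \<union> E\<inverse> `` {b2}" by blast
  then have e2: "E\<inverse> `` {b1, b2} = {p, p'}" using e by blast
  have "{b1, b2} \<noteq> B"
  proof
    assume "{b1, b2} = B"
    then have "card B = card {b1, b2}" by simp
    then show False using bB(3) big cardAB by simp
  qed
  then have "card {b1, b2} + 1 \<le> card (E\<inverse> `` {b1, b2})" using bB by (intro hall1_dual) blast+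
  then show False unfolding e2 using bB(3) ne by simp
qed

end

text \<open>The triangle \<open>a b1 b2\<close>, whose outer neighbours are \<open>a'\<close>, \<open>c1\<close> and \<open>c2\<close> respectively.\<close>

locale tri = core +
  fixes a :: 'a and a' :: 'b and c1 c2 :: 'a
  assumes a: "a \<in> A" "a \<noteq> a1" "a \<noteq> a2" and Na: "E `` {a} = {b1, b2, a'}"
    and Nb1: "E\<inverse> `` {b1} = {a, c1}" and Nb2: "E\<inverse> `` {b2} = {a, c2}"
begin

lemma ab: "(a, b1) \<in> E" "(a, b2) \<in> E" "(a, a') \<in> E" "(c1, b1) \<in> E" "(c2, b2) \<in> E"
  using Na Nb1 Nb2 by blast+

lemma a_only: "(a, q) \<in> E \<Longrightarrow> q = b1 \<or> q = b2 \<or> q = a'" using Na by blast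

lemma b1_only: "(p, b1) \<in> E \<Longrightarrow> p = a \<or> p = c1" using Nb1 by blast

lemma b2_only: "(p, b2) \<in> E \<Longrightarrow> p = a \<or> p = c2" using Nb2 by blast

lemma cA: "c1 \<in> A" "c2 \<in> A" "a' \<in> B" using ab EAB by blast+

text \<open>Degree bounds at \<open>a\<close>, \<open>b1\<close> and \<open>b2\<close>;
  \<open>c1 \<noteq> c2\<close> because \<open>{b1, b2}\<close> has at least three
  neighbours.\<close>

lemma ne: "a' \<noteq> b1" "a' \<noteq> b2" "c1 \<noteq> a" "c2 \<noteq> a" "c1 \<noteq> c2"
proof -
  have d: "3 \<le> card {b1, b2, a'}" using deg3[OF a] unfolding Na .
  then show "a' \<noteq> b1" "a' \<noteq> b2" by (auto simp: card_insert_if split: if_splits)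
  have "2 \<le> card {a, c1}" using dual_two[OF bB(1)] unfolding Nb1 .
  then show 1: "c1 \<noteq> a" by auto
  have "2 \<le> card {a, c2}" using dual_two[OF bB(2)] unfolding Nb2 .
  then show 2: "c2 \<noteq> a" by auto
  show "c1 \<noteq> c2"
  proof
    assume e: "c1 = c2"
    have "E\<inverse> `` {b1, b2} = E\<inverse> `` {b1} \<union> E\<inverse> `` {b2}" by blast
    then have e2: "E\<inverse> `` {b1, b2} = {a, c1}" using Nb1 Nb2 e by blast
    have "{b1, b2} \<noteq> B"
    proof
      assume "{b1, b2} = B"
      then have "card B = card {b1, b2}" by simp
      then show False using bB(3) big cardAB by simp
    qed
    then have "card {b1, b2} + 1 \<le> card (E\<inverse> `` {b1, b2})" using bB by (intro hall1_dual) blast+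
    then show False unfolding e2 using bB(3) 1 by simp
  qed
qed

lemma c_cross: "(c1, b2) \<notin> E" "(c2, b1) \<notin> E"
  using b1_only[of c2] b2_only[of c1] ne by blast+

lemma swap: "tri A B E a1 a2 b2 b1 a a' c2 c1"
  unfolding tri_def tri_axioms_def using swap_b a Na Nb1 Nb2 by (simp add: insert_commute)

end

section \<open>Cubic graphs with a triangle: existence of a rung\<close>

locale cubic_tri = tri +
  assumes dA: "\<And>p. p \<in> A \<Longrightarrow> p \<noteq> a1 \<Longrightarrow> p \<noteq> a2 \<Longrightarrow> card (E `` {p}) = 3"
    and da: "card (E `` {a1}) = 2" "card (E `` {a2}) = 2"
    and dB: "\<And>q. q \<in> B \<Longrightarrow> q \<noteq> b1 \<Longrightarrow> q \<noteq> b2 \<Longrightarrow> card (E\<inverse> `` {q}) = 3"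
begin

lemma swap_cubic: "cubic_tri A B E a1 a2 b2 b1 a a' c2 c1"
  unfolding cubic_tri_def cubic_tri_axioms_def using swap dA da dB by blast

lemma da_le: "p \<in> A \<Longrightarrow> card (N {p}) \<le> 3"
  using dA[of p] da by fastforce

lemma dual_D2: "T \<subseteq> B \<Longrightarrow> T \<noteq> {} \<Longrightarrow> b1 \<notin> T \<Longrightarrow> b2 \<notin> T \<Longrightarrow> card T + 2 \<le> card (E\<inverse> `` T)"
  using core.D2[OF dual] .

lemma card_Image_sum: "finite Z \<Longrightarrow> card (Z \<inter> {z. P z}) = (\<Sum>z\<in>Z. if P z then 1 else 0)"
  by (simp add: sum.If_cases)

text \<open>Counting edges, each of the \<open>card D - 1\<close> vertices of \<open>K\<close> would send three edges into \<open>D\<close>, so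
  \<open>N K \<subseteq> D\<close> would violate the neighbourhood bound unless \<open>K\<close> is empty.\<close>

lemma single_from_count:
  assumes D: "D \<subseteq> B" "b1 \<notin> D" "b2 \<notin> D" "D \<noteq> {}" and cD: "card (E\<inverse> `` D) = card D + 2"
    and z: "{a, c1, c2} \<subseteq> E\<inverse> `` D" and z1: "\<And>z. z \<in> {a, c1, c2} \<Longrightarrow> card (N {z} \<inter> D) \<le> 1"
  shows "card D = 1"
proof -
  define Z where "Z = E\<inverse> `` D"
  define K where "K = Z - {a, c1, c2}"
  have ZA: "Z \<subseteq> A" using EAB by (auto simp: Z_def)
  have fZ: "finite Z" using ZA finA finite_subset by blast
  have fD: "finite D" using D finB finite_subset by blast
  have c3: "card {a, c1, c2} = 3" using ne by simp
  have cK: "card K + 1 = card D"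
  proof -
    have "card K = card Z - card {a, c1, c2}" unfolding K_def using z by (intro card_Diff_subset) (simp_all add: Z_def)
    moreover have "card {a, c1, c2} \<le> card Z" using z fZ unfolding Z_def by (intro card_mono) 
    ultimately show ?thesis using cD c3 by (simp add: Z_def)
  qed
  have "3 * card D = (\<Sum>d\<in>D. card (E\<inverse> `` {d}))"
    using dB D by (subst sum.cong[OF refl, of D _ "\<lambda>_. 3"]) auto
  also have "\<dots> = (\<Sum>d\<in>D. \<Sum>x\<in>Z. if (x, d) \<in> E then 1 else 0)"
  proof (rule sum.cong[OF refl])
    fix d assume "d \<in> D"
    then have "E\<inverse> `` {d} = Z \<inter> {x. (x, d) \<in> E}" by (auto simp: Z_def)
    then show "card (E\<inverse> `` {d}) = (\<Sum>x\<in>Z. if (x, d) \<in> E then 1 else 0)" using card_Image_sum[OF fZ] by simp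
  qed
  also have "\<dots> = (\<Sum>x\<in>Z. \<Sum>d\<in>D. if (x, d) \<in> E then 1 else 0)" by (rule sum.swap)
  also have "\<dots> = (\<Sum>x\<in>Z. card (N {x} \<inter> D))"
  proof (rule sum.cong[OF refl])
    fix x
    have "N {x} \<inter> D = D \<inter> {d. (x, d) \<in> E}" by auto
    then show "(\<Sum>d\<in>D. if (x, d) \<in> E then 1 else 0) = card (N {x} \<inter> D)" using card_Image_sum[OF fD] by simp
  qed
  also have "\<dots> = (\<Sum>x\<in>K. card (N {x} \<inter> D)) + (\<Sum>x\<in>{a, c1, c2}. card (N {x} \<inter> D))"
    unfolding K_def using z fZ by (intro sum.subset_diff) (simp_all add: Z_def)
  also have "(\<Sum>x\<in>{a, c1, c2}. card (N {x} \<inter> D)) \<le> (\<Sum>x\<in>{a, c1, c2}. 1)"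
    using z1 by (intro sum_mono) blast
  also have "(\<Sum>x\<in>{a, c1, c2}. 1::nat) = 3" using c3 by simp
  finally have ge: "3 * card K \<le> (\<Sum>x\<in>K. card (N {x} \<inter> D))" using cK by simp
  have le: "card (N {x} \<inter> D) \<le> card (N {x})" for x by (intro card_mono) simp_all
  have KA: "K \<subseteq> A" using ZA by (auto simp: K_def)
  have fK: "finite K" using KA finA finite_subset by blast
  have all3: "card (N {x} \<inter> D) = 3" if x: "x \<in> K" for x
  proof (rule ccontr)
    assume "card (N {x} \<inter> D) \<noteq> 3"
    then have "card (N {x} \<inter> D) < 3" using le[of x] da_le[of x] x KA by fastforce
    then have "(\<Sum>x\<in>K. card (N {x} \<inter> D)) < (\<Sum>x\<in>K. 3)"
      using x fK le da_le KA by (intro sum_strict_mono_ex1) (auto intro: order_trans)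
    then show False using ge by simp
  qed
  show ?thesis
  proof (cases "K = {}")
    case True
    then show ?thesis using cK by simp
  next
    case False
    have sub: "N {x} \<subseteq> D \<and> x \<noteq> a1 \<and> x \<noteq> a2" if x: "x \<in> K" for x
    proof -
      have "card (N {x}) \<le> card (N {x} \<inter> D)" using all3[OF x] da_le[of x] x KA by auto
      then have "N {x} \<inter> D = N {x}" by (intro card_seteq) simp_all
      moreover have "x \<noteq> a1" "x \<noteq> a2" using all3[OF x] le[of x] da by auto
      ultimately show ?thesis by blast
    qed
    then have "N K \<subseteq> D" by blast
    then have "card (N K) \<le> card D" using fD by (intro card_mono)
    moreover have "card K + 2 \<le> card (N K)" using False KA sub by (intro D2) blast+
    ultimately show ?thesis using cK by linarith
  qed
qed

text \<open>Passes from a tight set to its complement. Since \<open>w \<noteq> b1\<close>, the set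
  sees \<open>b1\<close> and therefore misses \<open>b2\<close>; dropping \<open>b2\<close> leaves a
  set \<open>U\<close> in \<open>B\<close> that attains equality in \<open>dual_D2\<close>, as
  \<open>single_from_count\<close> requires.\<close>

lemma tight_cut:
  assumes S: "tight S c1 w" and w: "w \<noteq> b1"
  defines "U \<equiv> B - (N S - {w}) - {b2}"
  shows "w \<in> U" "a' \<in> U" "U \<subseteq> B" "b1 \<notin> U" "b2 \<notin> U" "E\<inverse> `` U = insert c1 (A - S)"
    "card (E\<inverse> `` U) = card U + 2" "a \<in> A - S" "c2 \<in> A - S" "\<And>x. (c1, x) \<in> E \<Longrightarrow> x \<in> U \<Longrightarrow> x = w"
    "b2 \<in> B - (N S - {w})"
proof -
  note s = S[unfolded tight_def]
  have b1S: "b1 \<in> N S - {w}" using s w ab by blast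
  have wb2: "w \<noteq> b2" using s c_cross by blast
  have b2S: "b2 \<notin> N S" using tight_b[OF S] b1S wb2 by blast
  show ac2: "a \<in> A - S" "c2 \<in> A - S" using b2S ab a cA by blast+
  show wU: "w \<in> U" using s wb2 EAB unfolding U_def by blast
  show "U \<subseteq> B" "b1 \<notin> U" "b2 \<notin> U" using b1S unfolding U_def by blast+
  show u: "\<And>x. (c1, x) \<in> E \<Longrightarrow> x \<in> U \<Longrightarrow> x = w" using s unfolding U_def by blast
  show b2T: "b2 \<in> B - (N S - {w})" using b2S bB by blast
  have fU: "finite U" unfolding U_def using finB by simp
  have cS: "card (A - S) + card S = card A" using s finS finA card_mono[OF finA, of S] by (simp add: card_Diff_subset)
  have cN: "card (N S - {w}) + 1 = card (N S)"
  proof -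
    have "w \<in> N S" using s by blast
    then show ?thesis using card_Suc_Diff1[OF finN] by simp
  qed
  have "card (B - (N S - {w})) + card (N S - {w}) = card B"
    using NB[of S] finB card_mono[OF finB, of "N S - {w}"] by (simp add: card_Diff_subset subset_iff)
  then have cT: "card (B - (N S - {w})) = card (A - S)" using cS cN s cardAB by linarith
  have cU: "card U + 1 = card (A - S)"
    unfolding U_def using b2T card_Suc_Diff1[of "B - (N S - {w})" b2] finB cT by simp
  have subU: "E\<inverse> `` U \<subseteq> insert c1 (A - S)" using s EAB unfolding U_def by blast
  have D: "card U + 2 \<le> card (E\<inverse> `` U)" using wU b1S by (intro dual_D2) (auto simp: U_def)
  \<comment> \<open>Without \<open>a'\<close> the vertex \<open>a\<close> would not be a neighbour
    of \<open>U\<close>, and this one missing neighbour already contradicts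
    \<open>dual_D2\<close>.\<close>
  show a'U: "a' \<in> U"
  proof (rule ccontr)
    assume "a' \<notin> U"
    then have "a \<notin> E\<inverse> `` U" using a_only b1S unfolding U_def by blast
    then have "E\<inverse> `` U \<subseteq> insert c1 (A - S) - {a}" using subU by blast
    then have "card (E\<inverse> `` U) + 1 \<le> card (insert c1 (A - S))" using ac2 finA by (intro card_sub1[of _ _ a]) simp_all
    also have "\<dots> \<le> card (A - S) + 1" using finA by (simp add: card_insert_if)
    finally show False using cU D by linarith
  qed
  have ci: "card (insert c1 (A - S)) \<le> card (A - S) + 1" using finA by (simp add: card_insert_if)
  show eq: "E\<inverse> `` U = insert c1 (A - S)"
  proof (rule card_seteq[OF _ subU])
    show "card (insert c1 (A - S)) \<le> card (E\<inverse> `` U)" using ci D cU by linarith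
  qed (simp add: finA)
  show "card (E\<inverse> `` U) = card U + 2" using D ci cU unfolding eq by linarith
qed

text \<open>\<open>S\<close> already sees \<open>b1\<close> and \<open>b2\<close>, so adding
  \<open>a\<close> contributes at most the one neighbour \<open>a'\<close>, and \<open>D2\<close>
  keeps the surplus at two.\<close>

lemma cutI_with_a:
  assumes S: "cutI S c1 w" and w: "w \<noteq> a'"
  obtains S' where "cutI S' c1 w" "a \<in> S'"
proof -
  note s = S[unfolded cutI_def]
  have "b1 \<in> N S" "b2 \<in> N S" using s by blast+
  then have "{b1, b2, a'} \<union> N S = insert a' (N S)" by blast
  moreover have "N (insert a S) = {b1, b2, a'} \<union> N S" unfolding Na[symmetric] by (rule Image_Un[of E "{a}" S, simplified])
  ultimately have NS: "N (insert a S) = insert a' (N S)" by (rule trans[rotated])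
  have D: "card (insert a S) + 2 \<le> card (N (insert a S))" using s a by (intro D2) blast+
  have "cutI (insert a S) c1 w \<or> a \<in> S"
  proof (cases "a \<in> S")
    case False
    have f: "finite S" using s finS[of S] by blast
    have "card (insert a S) = card S + 1" using f False by simp
    moreover have "card (insert a' (N S)) \<le> card (N S) + 1" by (simp add: card_insert_if)
    ultimately have c: "card (N (insert a S)) = card (insert a S) + 2"
      using D s unfolding NS by linarith
    have "w \<notin> {b1, b2, a'}" using s w by blast
    then have "(a, w) \<notin> E" using a_only by blast
    moreover have "b1 \<in> N (insert a S)" "b2 \<in> N (insert a S)" using ab by blast+
    ultimately have "cutI (insert a S) c1 w" unfolding cutI_def using s c a by blast
    then show ?thesis by blast
  qed simp
  then show thesis
  proof
    assume "cutI (insert a S) c1 w" then show thesis using that[of "insert a S"] by blast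
  next
    assume "a \<in> S" then show thesis using that[OF S] by blast
  qed
qed

text \<open>Removing \<open>a\<close> and \<open>c1\<close> from \<open>S\<close> gives up the three
  neighbours \<open>b1\<close>, \<open>b2\<close>, \<open>w\<close>, which contradicts
  \<open>D2\<close> unless \<open>S = {a, c1}\<close>. Then \<open>N S\<close> consists of
  \<open>b1\<close>, \<open>b2\<close>, \<open>a'\<close> and \<open>w\<close>, and the third
  neighbour of \<open>c1\<close> can only be \<open>a'\<close>.\<close>

lemma rung_cutI_small:
  assumes S: "cutI S c1 w" and aS: "a \<in> S" and c2S: "c2 \<notin> S" and w: "w \<noteq> a'"
  shows "(c1, a') \<in> E"
proof -
  note s = S[unfolded cutI_def]
  have SA: "S \<subseteq> A" using s by blast
  have wS: "w \<in> N S" using s by blast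
  have "card (N (S - {a, c1})) + 3 \<le> card (N S)"
  proof (rule card_sub3[of _ _ b1 b2 w])
    show "N (S - {a, c1}) \<subseteq> N S - {b1, b2, w}" using s b1_only b2_only c2S by blast
    show "distinct [b1, b2, w]" using s bB(3) by auto
  qed (use s wS in simp_all)
  moreover have cm: "card (S - {a, c1}) + 2 = card S"
  proof -
    have "card (S - {a, c1}) = card S - card {a, c1}" using s aS by (intro card_Diff_subset) auto
    moreover have "card {a, c1} \<le> card S" using s aS finS[OF SA] by (intro card_mono) auto
    moreover have "card {a, c1} = 2" using ne by simp
    ultimately show ?thesis by linarith
  qed
  ultimately have c: "card (N (S - {a, c1})) \<le> card (S - {a, c1}) + 1" using s by linarith
  have e: "S - {a, c1} = {}"
  proof (rule ccontr)
    assume n: "S - {a, c1} \<noteq> {}"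
    have "card (S - {a, c1}) + 2 \<le> card (N (S - {a, c1}))" using n s by (intro D2) blast+
    then show False using c by linarith
  qed
  have "card (S - {a, c1}) = 0" unfolding e by simp
  then have c4: "card (N S) = 4" using cm s by linarith
  have sub: "{b1, b2, a', w} \<subseteq> N S" using s aS ab wS by blast
  have "distinct [b1, b2, a', w]" using bB(3) ne s w by auto
  then have "card {b1, b2, a', w} = 4" by simp
  then have NS: "{b1, b2, a', w} = N S" using sub c4 by (intro card_seteq) simp_all
  show ?thesis
  proof (rule ccontr)
    assume n: "(c1, a') \<notin> E"
    have "N {c1} \<subseteq> N S" using s by blast
    then have "N {c1} \<subseteq> {b1, w}" unfolding NS[symmetric] using n c_cross by blast
    then have "card (N {c1}) \<le> card {b1, w}" by (intro card_mono) simp_all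
    also have "\<dots> \<le> 2" by (simp add: card_insert_if)
    finally show False using deg3[of c1] s by fastforce
  qed
qed

text \<open>The same idea for the intersection: removing the three vertices \<open>a\<close>,
  \<open>c1\<close>, \<open>c2\<close> gives up the four neighbours \<open>b1\<close>,
  \<open>b2\<close>, \<open>w\<close>, \<open>w2\<close>, so nothing else is in it, and
  \<open>a'\<close> is the only candidate for the third neighbour of \<open>c1\<close>.\<close>

lemma rung_cutI_cutI:
  assumes S: "cutI S c1 w" and W: "cutI W c2 w2" and sub: "{a, c1, c2} \<subseteq> S \<inter> W" and w: "w \<noteq> a'" "w2 \<noteq> a'"
  shows "(c1, a') \<in> E"
proof -
  note s = S[unfolded cutI_def] and t = W[unfolded cutI_def]
  have A': "S \<subseteq> A" "W \<subseteq> A" using s t by blast+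
  define P where "P = S \<inter> W"
  have "card (S \<union> W) + 2 \<le> card (N (S \<union> W))" using s t by (intro D2) blast+
  then have cap: "card (N S \<inter> N W) \<le> card P + 2"
    using submod[of S W] card_Un_Int_A[OF A'] s t unfolding P_def by linarith
  have "card P + 2 \<le> card (N P)" unfolding P_def using s t sub by (intro D2) blast+
  then have cNP: "card (N P) = card P + 2" using cap card_N_Int_le[of S W] unfolding P_def by linarith
  have NP: "N P = N S \<inter> N W"
  proof (rule card_seteq)
    show "N P \<subseteq> N S \<inter> N W" unfolding P_def by blast
  qed (use cap cNP in simp_all)
  have ww: "w \<noteq> w2" using s t sub ne by blast
  have cm: "card (P - {a, c1, c2}) + 3 = card P"
  proof -
    have "card (P - {a, c1, c2}) = card P - card {a, c1, c2}" using sub unfolding P_def by (intro card_Diff_subset) auto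
    moreover have "card {a, c1, c2} \<le> card P" using sub finS[of P] A' unfolding P_def by (intro card_mono) auto
    moreover have "card {a, c1, c2} = 3" using ne by simp
    ultimately show ?thesis by linarith
  qed
  have dd: "distinct [b1, b2, w, w2]" using s t bB(3) ww by auto
  have wP: "w \<in> N P" "w2 \<in> N P" "b1 \<in> N P" "b2 \<in> N P" using s t sub unfolding P_def using ab by blast+
  have "card (N (P - {a, c1, c2})) + 4 \<le> card (N P)"
  proof (rule card_sub4[of _ _ b1 b2 w w2])
    show "N (P - {a, c1, c2}) \<subseteq> N P - {b1, b2, w, w2}" using s t b1_only b2_only unfolding P_def by blast
  qed (use wP dd in simp_all)
  then have c: "card (N (P - {a, c1, c2})) \<le> card (P - {a, c1, c2}) + 1" using cm cNP by linarith
  have e: "P - {a, c1, c2} = {}"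
  proof (rule ccontr)
    assume n: "P - {a, c1, c2} \<noteq> {}"
    have "card (P - {a, c1, c2}) + 2 \<le> card (N (P - {a, c1, c2}))" using n s unfolding P_def by (intro D2) blast+
    then show False using c by linarith
  qed
  have "card (P - {a, c1, c2}) = 0" unfolding e by simp
  then have c5: "card (N P) = 5" using cm cNP by linarith
  have sub: "{b1, b2, a', w, w2} \<subseteq> N P" using wP ab sub unfolding P_def by blast
  have "distinct [b1, b2, a', w, w2]" using dd ne w by auto
  then have "card {b1, b2, a', w, w2} = 5" by simp
  then have NP': "{b1, b2, a', w, w2} = N P" using sub c5 by (intro card_seteq) simp_all
  show ?thesis
  proof (rule ccontr)
    assume n: "(c1, a') \<notin> E"
    have "c1 \<in> P" using assms(3) unfolding P_def by blast
    then have "N {c1} \<subseteq> N P" by blast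
    moreover have "(c1, w2) \<notin> E" using t assms(3) ne by blast
    ultimately have "N {c1} \<subseteq> {b1, w}" unfolding NP'[symmetric] using n c_cross by blast
    then have "card (N {c1}) \<le> card {b1, w}" by (intro card_mono) simp_all
    also have "\<dots> \<le> 2" by (simp add: card_insert_if)
    finally show False using deg3[of c1] s by fastforce
  qed
qed


lemma card_le_one: "N {z} \<inter> D \<subseteq> {w} \<Longrightarrow> card (N {z} \<inter> D) \<le> 1"
  using card_mono[of "{w}"] by simp

lemma cutI_swap: "core.cutI A E a1 a2 b2 b1 S p q \<longleftrightarrow> cutI S p q"
  unfolding cutI_def core.cutI_def[OF swap_b] by blast

lemma nonrem_swap: "core.nonrem A B E a1 a2 b2 b1 p = nonrem p"
  unfolding nonrem_def core.nonrem_def[OF swap_b] by (simp add: removable_pair_swap)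

lemma a_single: "a' \<in> U \<Longrightarrow> b1 \<notin> U \<Longrightarrow> b2 \<notin> U \<Longrightarrow> card (N {a} \<inter> U) \<le> 1"
  using a_only by (intro card_le_one[of _ _ a']) blast

lemma singleton_eq: "card D = 1 \<Longrightarrow> x \<in> D \<Longrightarrow> D = {x}"
  by (metis card_1_singletonE singletonD)

text \<open>The complementary sets \<open>U\<close> and \<open>V\<close> share \<open>a'\<close>, so
  their intersection again attains equality in \<open>dual_D2\<close>. Counting edges shrinks it to
  \<open>{a'}\<close>, and \<open>c1\<close> is among its neighbours.\<close>

lemma rung_tight_tight:
  assumes S: "tight S c1 w" "w \<noteq> b1" and W: "tight W c2 w2" "w2 \<noteq> b2"
  shows "(c1, a') \<in> E"
proof -
  interpret sw: cubic_tri A B E a1 a2 b2 b1 a a' c2 c1 by (rule swap_cubic)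
  define U where "U = B - (N S - {w}) - {b2}"
  define V where "V = B - (N W - {w2}) - {b1}"
  note u = tight_cut[OF S, folded U_def] and v = sw.tight_cut[OF W, folded V_def]
  define D where "D = U \<inter> V"
  have a'D: "a' \<in> D" using u(2) v(2) by (simp add: D_def)
  have DB: "D \<subseteq> B" "b1 \<notin> D" "b2 \<notin> D" "D \<noteq> {}" using u(3-5) a'D by (auto simp: D_def)
  have g1: "card D + 2 \<le> card (E\<inverse> `` D)" using DB by (intro dual_D2)
  have "card (U \<union> V) + 2 \<le> card (E\<inverse> `` (U \<union> V))" using u(3-5) v(3-5) a'D by (intro dual_D2) (auto simp: D_def)
  moreover have "card (E\<inverse> `` (U \<union> V)) + card (E\<inverse> `` U \<inter> E\<inverse> `` V) = card (E\<inverse> `` U) + card (E\<inverse> `` V)"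
    by (rule core.submod[OF dual])
  moreover have "card (U \<union> V) + card D = card U + card V"
    unfolding D_def by (rule core.card_Un_Int_A[OF dual]) (fact u(3) v(3))+
  ultimately have g2: "card (E\<inverse> `` U \<inter> E\<inverse> `` V) \<le> card D + 2" using u(7) v(7) by linarith
  have g3: "E\<inverse> `` D \<subseteq> E\<inverse> `` U \<inter> E\<inverse> `` V" by (auto simp: D_def)
  have fin: "finite (E\<inverse> `` U \<inter> E\<inverse> `` V)" using core.finN[OF dual] by blast
  have eq: "E\<inverse> `` D = E\<inverse> `` U \<inter> E\<inverse> `` V"
    by (rule card_seteq[OF fin g3]) (use g1 g2 in linarith)
  have cD: "card (E\<inverse> `` D) = card D + 2" using g1 g2 unfolding eq by linarith
  have z: "{a, c1, c2} \<subseteq> E\<inverse> `` D" unfolding eq u(6) v(6) using u(8,9) v(8,9) by blast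
  have "card D = 1"
  proof (rule single_from_count[OF DB cD z])
    fix z assume "z \<in> {a, c1, c2}"
    then consider "z = a" | "z = c1" | "z = c2" by blast
    then show "card (N {z} \<inter> D) \<le> 1"
    proof cases
      case 1 then show ?thesis using a_single a'D DB by blast
    next
      case 2 then show ?thesis using u(10) by (intro card_le_one[of _ _ w]) (auto simp: D_def)
    next
      case 3 then show ?thesis using v(10) by (intro card_le_one[of _ _ w2]) (auto simp: D_def)
    qed
  qed
  then have "D = {a'}" using a'D by (rule singleton_eq)
  then show ?thesis using z by blast
qed

text \<open>By \<open>cutI_tight\<close> the sets \<open>S\<close> and \<open>W\<close> miss at most
  one vertex together, so \<open>w\<close> cannot lie in \<open>U\<close>, where it would have
  degree at most two. Of the at most three neighbours of \<open>c1\<close>, both \<open>b1\<close>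
  and \<open>w\<close> are thus outside \<open>U\<close>, and the counting argument applies to
  \<open>U\<close> itself.\<close>

lemma rung_cutI_tight:
  assumes S: "cutI S c1 w" and aS: "a \<in> S" "c2 \<in> S" and W: "tight W c2 w2" "w2 \<noteq> b2"
  shows "(c1, a') \<in> E"
proof -
  interpret sw: cubic_tri A B E a1 a2 b2 b1 a a' c2 c1 by (rule swap_cubic)
  define U where "U = B - (N W - {w2}) - {b1}"
  note u = sw.tight_cut[OF W, folded U_def]
  note s = S[unfolded cutI_def] and t = W(1)[unfolded tight_def]
  have "S \<inter> W \<noteq> {}" using aS t by blast
  then have cov: "card A \<le> card (S \<union> W) + 1" using cutI_tight[OF S W(1)] by blast
  have wU: "w \<notin> U"
  proof
    assume wU: "w \<in> U"
    have "w \<noteq> w2" using s t aS ne by blast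
    then have "w \<notin> N W" using wU unfolding U_def by blast
    then have sub: "E\<inverse> `` {w} \<subseteq> insert c1 (A - (S \<union> W))" using s EAB by blast
    have SW: "S \<union> W \<subseteq> A" using s t by blast
    have "card (S \<union> W) + card (A - (S \<union> W)) = card A"
      using card_Diff_subset[OF finS[OF SW] SW] card_mono[OF finA SW] by linarith
    then have "card (A - (S \<union> W)) \<le> 1" using cov by linarith
    moreover have "card (E\<inverse> `` {w}) \<le> card (insert c1 (A - (S \<union> W)))" using sub finA by (intro card_mono) simp_all
    moreover have "card (insert c1 (A - (S \<union> W))) \<le> card (A - (S \<union> W)) + 1" using finA by (simp add: card_insert_if)
    moreover have "3 \<le> card (E\<inverse> `` {w})" using s EAB by (intro dual_deg3) blast+
    ultimately show False by linarith
  qed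
  have z: "{a, c1, c2} \<subseteq> E\<inverse> `` U" unfolding u(6) using u(8,9) by blast
  have "card U = 1"
  proof (rule single_from_count[OF u(3,5,4) _ u(7) z])
    show "U \<noteq> {}" using u(2) by blast
    fix z assume "z \<in> {a, c1, c2}"
    then consider "z = a" | "z = c1" | "z = c2" by blast
    then show "card (N {z} \<inter> U) \<le> 1"
    proof cases
      case 1 then show ?thesis using a_single u(2,4,5) by blast
    next
      case 2
      have "card (N {c1} \<inter> U) + 2 \<le> card (N {c1})"
      proof (rule card_sub2[of _ _ b1 w])
        show "N {c1} \<inter> U \<subseteq> N {c1} - {b1, w}" using wU u(5) by blast
        show "b1 \<in> N {c1}" "w \<in> N {c1}" using ab s by blast+
        show "b1 \<noteq> w" using s by blast
      qed simp
      then show ?thesis using da_le[OF cA(1)] 2 by simp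
    next
      case 3 then show ?thesis using u(10) by (intro card_le_one[of _ _ w2]) blast
    qed
  qed
  then have "U = {a'}" using u(2) by (rule singleton_eq)
  then show ?thesis using z by blast
qed

text \<open>An end of \<open>e1\<close> has only two neighbours in \<open>B\<close>; one is
  \<open>b1\<close>, so at most one lies in \<open>U\<close>, and the counting argument
  applies.\<close>

lemma rung_end:
  assumes c1: "c1 = a1 \<or> c1 = a2" and W: "tight W c2 w2" "w2 \<noteq> b2"
  shows "(c1, a') \<in> E"
proof -
  interpret sw: cubic_tri A B E a1 a2 b2 b1 a a' c2 c1 by (rule swap_cubic)
  define U where "U = B - (N W - {w2}) - {b1}"
  note u = sw.tight_cut[OF W, folded U_def]
  have z: "{a, c1, c2} \<subseteq> E\<inverse> `` U" unfolding u(6) using u(8,9) by blast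
  have "card U = 1"
  proof (rule single_from_count[OF u(3,5,4) _ u(7) z])
    show "U \<noteq> {}" using u(2) by blast
    fix z assume "z \<in> {a, c1, c2}"
    then consider "z = a" | "z = c1" | "z = c2" by blast
    then show "card (N {z} \<inter> U) \<le> 1"
    proof cases
      case 1 then show ?thesis using a_single u(2,4,5) by blast
    next
      case 2
      have "card (N {c1} \<inter> U) + 1 \<le> card (N {c1})"
        using u(5) ab by (intro card_sub1[of _ _ b1]) (simp, blast, blast)
      then show ?thesis using c1 da 2 by auto
    next
      case 3 then show ?thesis using u(10) by (intro card_le_one[of _ _ w2]) blast
    qed
  qed
  then have "U = {a'}" using u(2) by (rule singleton_eq)
  then show ?thesis using z by blast
qed

text \<open>The edge \<open>c1 b1\<close> is nonremovable in any case and says nothing about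
  \<open>a'\<close>, so a second one is needed.\<close>

lemma second_nonrmv:
  assumes "2 \<le> card (nonrem c1)"
  obtains w where "w \<noteq> b1" "(c1, w) \<in> E" "(\<exists>S. cutI S c1 w) \<or> (\<exists>S. tight S c1 w)"
proof -
  have "\<not> nonrem c1 \<subseteq> {b1}"
  proof
    assume "nonrem c1 \<subseteq> {b1}"
    then have "card (nonrem c1) \<le> card {b1}" by (intro card_mono) simp_all
    then show False using assms by simp
  qed
  then obtain w where w: "w \<in> nonrem c1" "w \<noteq> b1" by blast
  then have "(c1, w) \<in> E" "\<not> rm c1 w" by (simp_all add: nonrem_def)
  then show thesis using that w nonrmv_cases[of c1 w] unfolding tight_blocked_def by blast
qed

text \<open>If \<open>w = a'\<close>, then \<open>c1 w\<close> is the rung. Otherwise the set can be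
  assumed to contain \<open>a\<close>, and what remains depends on whether it contains
  \<open>c2\<close> and on the kind of obstruction at \<open>c2\<close>.\<close>

lemma rung_if_cutI:
  assumes S: "cutI S c1 w" and c2: "c2 \<noteq> a1" "c2 \<noteq> a2" "2 \<le> card (nonrem c2)"
  shows "(c1, a') \<in> E \<or> (c2, a') \<in> E"
proof (cases "w = a'")
  case True
  then show ?thesis using S unfolding cutI_def by blast
next
  case wa: False
  interpret sw: cubic_tri A B E a1 a2 b2 b1 a a' c2 c1 by (rule swap_cubic)
  obtain S' where S': "cutI S' c1 w" "a \<in> S'" using cutI_with_a[OF S wa] by blast
  obtain w2 where w2: "w2 \<noteq> b2" "(c2, w2) \<in> E" "(\<exists>S. cutI S c2 w2) \<or> (\<exists>S. tight S c2 w2)"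
    using sw.second_nonrmv c2(3) unfolding cutI_swap nonrem_swap by metis
  show ?thesis
  proof (cases "c2 \<in> S'")
    case False
    then show ?thesis using rung_cutI_small[OF S' _ wa] by blast
  next
    case c2S: True
    from w2(3) show ?thesis
    proof
      assume "\<exists>W. tight W c2 w2"
      then show ?thesis using rung_cutI_tight[OF S' c2S _ w2(1)] by blast
    next
      assume "\<exists>W. cutI W c2 w2"
      then obtain W where W: "cutI W c2 w2" by blast
      show ?thesis
      proof (cases "w2 = a'")
        case True then show ?thesis using w2 by blast
      next
        case wb: False
        obtain W' where W': "cutI W' c2 w2" "a \<in> W'" using sw.cutI_with_a[unfolded cutI_swap, OF W wb] by blast
        show ?thesis
        proof (cases "c1 \<in> W'")
          case False
          then show ?thesis using sw.rung_cutI_small[unfolded cutI_swap, OF W' _ wb] by blast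
        next
          case True
          have "{a, c1, c2} \<subseteq> S' \<inter> W'" using S' W' True c2S by (auto simp: cutI_def)
          then show ?thesis using rung_cutI_cutI[OF S'(1) W'(1) _ wa wb] by blast
        qed
      qed
    qed
  qed
qed

lemma rung_if_end:
  assumes c1: "c1 = a1 \<or> c1 = a2" and c2: "c2 \<noteq> a1" "c2 \<noteq> a2" "2 \<le> card (nonrem c2)"
  shows "(c1, a') \<in> E \<or> (c2, a') \<in> E"
proof -
  interpret sw: cubic_tri A B E a1 a2 b2 b1 a a' c2 c1 by (rule swap_cubic)
  obtain w2 where w2: "w2 \<noteq> b2" "(c2, w2) \<in> E" "(\<exists>S. cutI S c2 w2) \<or> (\<exists>S. tight S c2 w2)"
    using sw.second_nonrmv c2(3) unfolding cutI_swap nonrem_swap by metis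
  from w2(3) show ?thesis
  proof
    assume "\<exists>W. tight W c2 w2"
    then show ?thesis using rung_end[OF c1 _ w2(1)] by blast
  next
    assume "\<exists>W. cutI W c2 w2"
    then obtain W where W: "cutI W c2 w2" by blast
    show ?thesis
    proof (cases "w2 = a'")
      case True then show ?thesis using w2 by blast
    next
      case wb: False
      obtain W' where W': "cutI W' c2 w2" "a \<in> W'" using sw.cutI_with_a[unfolded cutI_swap, OF W wb] by blast
      have "c1 \<notin> W'" using W' c1 unfolding cutI_def by blast
      then show ?thesis using sw.rung_cutI_small[unfolded cutI_swap, OF W' _ wb] by blast
    qed
  qed
qed

text \<open>If \<open>c1\<close>, \<open>c2\<close> were the ends of \<open>e1\<close>, then
  \<open>{b1, b2}\<close> would have only \<open>a\<close> as a neighbour other than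
  \<open>a1\<close>, \<open>a2\<close>, contrary to \<open>hall3\<close>. In the prism this does
  happen, hence the size condition.\<close>

lemma not_both_ends: assumes "4 \<le> card A" shows "\<not> {c1, c2} = {a1, a2}"
proof
  assume e: "{c1, c2} = {a1, a2}"
  have "card {b1, b2} = 2" using bB(3) by simp
  then have "card {b1, b2} \<le> card (E\<inverse> `` {b1, b2} - {a1, a2})"
    using assms cardAB bB by (intro hall3) simp_all
  moreover have "E\<inverse> `` {b1, b2} - {a1, a2} \<subseteq> {a}" using b1_only b2_only e by blast
  then have "card (E\<inverse> `` {b1, b2} - {a1, a2}) \<le> card {a}" by (intro card_mono) simp_all
  ultimately show False using bB(3) by simp
qed

lemma rung:
  assumes big4: "4 \<le> card A"
    and nr2: "\<And>p. p \<in> A \<Longrightarrow> p \<noteq> a1 \<Longrightarrow> p \<noteq> a2 \<Longrightarrow> p \<noteq> a \<Longrightarrow> 2 \<le> card (nonrem p)"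
  shows "(c1, a') \<in> E \<or> (c2, a') \<in> E"
proof -
  interpret sw: cubic_tri A B E a1 a2 b2 b1 a a' c2 c1 by (rule swap_cubic)
  show ?thesis
  proof (cases "c1 = a1 \<or> c1 = a2")
    case True
    then have "c2 \<noteq> a1" "c2 \<noteq> a2" using not_both_ends[OF big4] ne(5) by auto
    then show ?thesis using rung_if_end[OF True] nr2 cA ne by blast
  next
    case c1n: False
    then have n1: "2 \<le> card (nonrem c1)" using nr2 cA ne by blast
    show ?thesis
    proof (cases "c2 = a1 \<or> c2 = a2")
      case True
      then show ?thesis using sw.rung_if_end[unfolded nonrem_swap, OF True _ _ n1] c1n by blast
    next
      case c2n: False
      then have n2: "2 \<le> card (nonrem c2)" using nr2 cA ne by blast
      obtain w where w: "w \<noteq> b1" "(c1, w) \<in> E" "(\<exists>S. cutI S c1 w) \<or> (\<exists>S. tight S c1 w)" using second_nonrmv[OF n1] by blast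
      obtain w2 where w2: "w2 \<noteq> b2" "(c2, w2) \<in> E" "(\<exists>S. cutI S c2 w2) \<or> (\<exists>S. tight S c2 w2)"
        using sw.second_nonrmv n2 unfolding cutI_swap nonrem_swap by metis
      consider S where "cutI S c1 w" | S where "cutI S c2 w2" | S W where "tight S c1 w" "tight W c2 w2" using w(3) w2(3) by blast
      then show ?thesis
      proof cases
        case 1 then show ?thesis using rung_if_cutI n2 c2n by blast
      next
        case 2 then show ?thesis using sw.rung_if_cutI[unfolded cutI_swap nonrem_swap] n1 c1n by blast
      next
        case 3 then show ?thesis using rung_tight_tight w(1) w2(1) by blast
      qed
    qed
  qed
qed

end

section \<open>Contracting the triangle\<close>

lemma restrict_matches: assumes "matches F P Q m" "u \<in> P" shows "matches F (P - {u}) (Q - {m u}) m"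
proof -
  have m: "inj_on m P" "m ` P = Q" "\<And>p. p \<in> P \<Longrightarrow> (p, m p) \<in> F" using assms by (auto simp: matches_def bij_betw_def)
  have "m ` (P - {u}) = Q - {m u}" using m(1,2) assms(2) by (auto simp: inj_on_def)
  moreover have "inj_on m (P - {u})" using m(1) by (rule inj_on_subset) blast
  ultimately show ?thesis using m(3) by (simp add: matches_def bij_betw_def)
qed

lemma matches_mono: "matches F P Q m \<Longrightarrow> (\<And>p. p \<in> P \<Longrightarrow> (p, m p) \<in> F \<Longrightarrow> m p \<in> Q \<Longrightarrow> (p, m p) \<in> F') \<Longrightarrow> matches F' P Q m"
  by (auto simp: matches_def bij_betw_def)

lemma matches_edge: "matches F P Q m \<Longrightarrow> p \<in> P \<Longrightarrow> (p, m p) \<in> F \<and> m p \<in> Q"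
  by (auto simp: matches_def bij_betw_def)

lemma matches_pre: assumes "matches F P Q m" "q \<in> Q" obtains p where "p \<in> P" "m p = q" "(p, q) \<in> F"
  using assms by (auto simp: matches_def bij_betw_def)

lemma matches_inj: "matches F P Q m \<Longrightarrow> x \<in> P \<Longrightarrow> y \<in> P \<Longrightarrow> m x = m y \<Longrightarrow> x = y"
  by (auto simp: matches_def bij_betw_def inj_on_def)

context tri begin

text \<open>Contraction of the triangle \<open>a b1 b2\<close>; the new vertex is called \<open>b1\<close>, and the edge from it to \<open>a'\<close>
  takes over the role of \<open>e2\<close>.\<close>

definition A' :: "'a set" where "A' = A - {a}"
definition B' :: "'b set" where "B' = B - {b2}"
definition E' :: "('a \<times> 'b) set" where
  "E' = {(p, q). (p, q) \<in> E \<and> p \<noteq> a \<and> q \<noteq> b1 \<and> q \<noteq> b2} \<union> {(c1, b1), (c2, b1)}"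

abbreviation rm' :: "'a \<Rightarrow> 'b \<Rightarrow> bool" where "rm' \<equiv> removable_pair A' B' a1 a2 b1 a' E'"

lemma E'_iff: "(p, q) \<in> E' \<longleftrightarrow> (if q = b1 then p = c1 \<or> p = c2 else (p, q) \<in> E \<and> p \<noteq> a \<and> q \<noteq> b2)"
  by (auto simp: E'_def)

lemma E'_sub: "E' \<subseteq> A' \<times> B'"
  using EAB cA ne bB unfolding E'_def A'_def B'_def by blast

lemma a12A': "a1 \<in> A'" "a2 \<in> A'" "b1 \<in> B'" "a' \<in> B'" "c1 \<in> A'" "c2 \<in> A'"
  using aA a bB cA ne by (auto simp: A'_def B'_def)

lemma ne': "b2 \<noteq> b1" "b1 \<noteq> a'" "b2 \<noteq> a'" "a \<noteq> c1" "a \<noteq> c2" "a1 \<noteq> a" "a2 \<noteq> a" using bB ne a by auto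

lemma A_eq: "A' - {a1, a2} = A - {a1, a2} - {a}" "B' - {b1, a'} = B - {b1, b2} - {a'}"
  using a ne' by (auto simp: A'_def B'_def)

section \<open>Transfer of matchings and removability across the contraction\<close>

lemma not_rm_a_a': "\<not> rm a a'"
proof
  assume "rm a a'"
  then obtain m where m: "matches (E - {(a, a')}) (A - {a1, a2}) (B - {b1, b2}) m" by (auto simp: removable_pair_def)
  then show False using matches_edge[OF m, of a] a a_only by blast
qed

text \<open>Without \<open>c1 b1\<close>, a perfect matching avoiding the special edges has to match
  \<open>b1\<close> with \<open>a\<close>, so \<open>a b2\<close> becomes inadmissible.\<close>

lemma not_rm_c1: "\<not> rm c1 b1"
proof
  assume r: "rm c1 b1"
  have "(a, b2) \<noteq> (c1, b1)" using ne by simp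
  then have "admissible_pair A B a1 a2 b1 b2 (E - {(c1, b1)}) a b2" using r ab unfolding removable_pair_def by blast
  then show False unfolding admissible_pair_def
  proof (elim disjE exE conjE)
    fix m assume m: "matches (E - {(c1, b1)}) A B m" "m a = b2"
    obtain z where z: "z \<in> A" "m z = b1" "(z, b1) \<in> E - {(c1, b1)}" using matches_pre[OF m(1) bB(1)] .
    then have "z = a" using b1_only by blast
    then show False using z(2) m(2) bB by simp
  next
    fix m assume m: "matches (E - {(c1, b1)}) (A - {a1, a2}) (B - {b1, b2}) m" "m a = b2"
    then show False using matches_edge[OF m(1), of a] a by simp
  qed
qed

lemma not_rm_c2: "\<not> rm c2 b2"
  using tri.not_rm_c1[OF swap] by (simp add: removable_pair_swap)

text \<open>Without \<open>a b1\<close> the rung \<open>c1 a'\<close> becomes inadmissible: a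
  matching avoiding the special edges needs \<open>c1\<close> for \<open>b1\<close>, and one through
  them needs \<open>a'\<close> for \<open>a\<close>.\<close>

lemma not_rm_a_b1: assumes "(c1, a') \<in> E" shows "\<not> rm a b1"
proof
  assume r: "rm a b1"
  have "(c1, a') \<noteq> (a, b1)" using ne by simp
  then have "admissible_pair A B a1 a2 b1 b2 (E - {(a, b1)}) c1 a'" using r assms unfolding removable_pair_def by blast
  then show False unfolding admissible_pair_def
  proof (elim disjE exE conjE)
    fix m assume m: "matches (E - {(a, b1)}) A B m" "m c1 = a'"
    obtain z where z: "z \<in> A" "m z = b1" "(z, b1) \<in> E - {(a, b1)}" using matches_pre[OF m(1) bB(1)] .
    then have "z = c1" using b1_only by blast
    then show False using z(2) m(2) ne by simp
  next
    fix m assume m: "matches (E - {(a, b1)}) (A - {a1, a2}) (B - {b1, b2}) m" "c1 \<notin> {a1, a2}" "m c1 = a'"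
    have aa: "a \<in> A - {a1, a2}" "c1 \<in> A - {a1, a2}" using a cA m(2) by blast+
    have "m a = a'" using matches_edge[OF m(1) aa(1)] a_only by blast
    then have "a = c1" using matches_inj[OF m(1) aa] m(3) by simp
    then show False using ne by simp
  qed
qed

text \<open>The partner of the contracted vertex decides how the triangle is matched:
  \<open>c1\<close> leads to \<open>c1 b1\<close> and \<open>a b2\<close>, and \<open>c2\<close>
  leads to \<open>c2 b2\<close> and \<open>a b1\<close>.\<close>

lemma lift0:
  assumes m: "matches F' A' B' m" and F: "\<And>u v. (u, v) \<in> F' \<Longrightarrow> v \<noteq> b1 \<Longrightarrow> (u, v) \<in> F"
    and F2: "{(a, b1), (a, b2), (c1, b1), (c2, b2)} \<subseteq> F" and F': "F' \<subseteq> E'"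
  obtains m' where "matches F A B m'" "\<And>u. u \<in> A' \<Longrightarrow> m u \<noteq> b1 \<Longrightarrow> m' u = m u"
    "m c1 = b1 \<Longrightarrow> m' a = b2 \<and> m' c1 = b1" "m c2 = b1 \<Longrightarrow> m' a = b1 \<and> m' c2 = b2"
proof -
  obtain z where z: "z \<in> A'" "m z = b1" "(z, b1) \<in> F'" using matches_pre[OF m a12A'(3)] .
  then have zc: "z = c1 \<or> z = c2" using F' E'_iff by auto
  have r: "matches F (A' - {z}) (B' - {b1}) m"
    using restrict_matches[OF m z(1)] z(2) F by (auto intro: matches_mono)
  have BB: "B' - {b1} = B - {b1} - {b2}" "B' - {b1} = B - {b2} - {b1}" by (auto simp: B'_def)
  have uniq: "m u = b1 \<Longrightarrow> u \<in> A' \<Longrightarrow> u = z" for u using matches_inj[OF m _ z(1)] z(2) by simp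
  from zc show thesis
  proof
    assume zz: "z = c1"
    have r': "matches F (A' - {c1}) (B - {b2} - {b1}) m" using r unfolding zz BB(2) .
    have s1: "matches F (A - {a}) (B - {b2}) (m(c1 := b1))"
      unfolding A'_def[symmetric] by (rule extend_matches[OF r']) (use F2 a12A' bB in auto)
    have s2: "matches F A B ((m(c1 := b1))(a := b2))"
      by (rule extend_matches[OF s1]) (use F2 a bB in auto)
    show thesis
    proof (rule that[OF s2])
      show "(m(c1 := b1, a := b2)) u = m u" if "u \<in> A'" "m u \<noteq> b1" for u using that z(2) zz by (auto simp: A'_def)
      show "(m(c1 := b1, a := b2)) a = b2 \<and> (m(c1 := b1, a := b2)) c1 = b1" if "m c1 = b1" using ne by simp
      show "(m(c1 := b1, a := b2)) a = b1 \<and> (m(c1 := b1, a := b2)) c2 = b2" if "m c2 = b1" using uniq[OF that a12A'(6)] zz ne by simp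
    qed
  next
    assume zz: "z = c2"
    have r': "matches F (A' - {c2}) (B - {b1} - {b2}) m" using r unfolding zz BB(1) .
    have s1: "matches F (A - {a}) (B - {b1}) (m(c2 := b2))"
      unfolding A'_def[symmetric] by (rule extend_matches[OF r']) (use F2 a12A' bB in auto)
    have s2: "matches F A B ((m(c2 := b2))(a := b1))"
      by (rule extend_matches[OF s1]) (use F2 a bB in auto)
    show thesis
    proof (rule that[OF s2])
      show "(m(c2 := b2, a := b1)) u = m u" if "u \<in> A'" "m u \<noteq> b1" for u using that z(2) zz by (auto simp: A'_def)
      show "(m(c2 := b2, a := b1)) a = b2 \<and> (m(c2 := b2, a := b1)) c1 = b1" if "m c1 = b1" using uniq[OF that a12A'(5)] zz ne by simp
      show "(m(c2 := b2, a := b1)) a = b1 \<and> (m(c2 := b2, a := b1)) c2 = b2" if "m c2 = b1" using ne by simp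
    qed
  qed
qed

text \<open>The new special edge \<open>b1 a'\<close> expands to the edge \<open>a a'\<close>
  together with \<open>e2\<close>.\<close>

lemma lift1:
  assumes m: "matches F' (A' - {a1, a2}) (B' - {b1, a'}) m" and F: "\<And>u v. (u, v) \<in> F' \<Longrightarrow> v \<noteq> b1 \<Longrightarrow> (u, v) \<in> F"
    and F2: "(a, a') \<in> F"
  shows "matches F (A - {a1, a2}) (B - {b1, b2}) (m(a := a'))"
proof (rule extend_matches)
  show "matches F (A - {a1, a2} - {a}) (B - {b1, b2} - {a'}) m"
    unfolding A_eq(1)[symmetric] A_eq(2)[symmetric]
  proof (rule matches_mono[OF m])
    fix p assume "(p, m p) \<in> F'" "m p \<in> B' - {b1, a'}"
    then show "(p, m p) \<in> F" using F by blast
  qed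
qed (use F2 a cA ne in auto)

text \<open>Every pair of \<open>E\<close> that the contraction does not keep becomes admissible by
  lifting a suitable matching: \<open>a a'\<close> through \<open>lift1\<close>, and the pairs at
  \<open>b1\<close> or \<open>b2\<close> through \<open>lift0\<close>, with the partner of the
  contracted vertex chosen accordingly.\<close>

lemma rm'_imp_rm:
  assumes r: "rm' p q" and q: "q \<noteq> b1" shows "rm p q"
proof -
  let ?F' = "E' - {(p, q)}" and ?F = "E - {(p, q)}"
  have pq: "(p, q) \<in> E'" using r by (simp add: removable_pair_def)
  then have pq': "(p, q) \<in> E" "p \<noteq> a" "q \<noteq> b2" using q by (auto simp: E'_iff)
  have F: "(u, v) \<in> ?F" if "(u, v) \<in> ?F'" "v \<noteq> b1" for u v using that by (auto simp: E'_iff)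
  have F2: "{(a, b1), (a, b2), (c1, b1), (c2, b2)} \<subseteq> ?F" "(a, a') \<in> ?F" using ab pq' q by auto
  have sub: "?F' \<subseteq> E'" by blast
  obtain m where m: "matches ?F' (A' - {a1, a2}) (B' - {b1, a'}) m" using r by (auto simp: removable_pair_def)
  note m1 = lift1[OF m F F2(2)]
  have ad: "admissible_pair A' B' a1 a2 b1 a' ?F' u v" if "(u, v) \<in> E'" "(u, v) \<noteq> (p, q)" for u v
    using r that by (auto simp: removable_pair_def)
  \<comment> \<open>The pairs at \<open>b1\<close> meet the new special edge, so only a matching
    avoiding the special edges can contain them.\<close>
  have ad_b1: "\<exists>m. matches ?F' A' B' m \<and> m c = b1" if "c = c1 \<or> c = c2" for c
  proof -
    have "admissible_pair A' B' a1 a2 b1 a' ?F' c b1" using that q by (intro ad) (auto simp: E'_iff)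
    then show ?thesis unfolding admissible_pair_def
    proof (elim disjE exE conjE)
      fix m assume m: "matches ?F' (A' - {a1, a2}) (B' - {b1, a'}) m" "c \<notin> {a1, a2}" "m c = b1"
      have "c \<in> A' - {a1, a2}" using m(2) that a12A' by blast
      then show ?thesis using matches_edge[OF m(1), of c] m(3) by blast
    qed blast
  qed
  have "admissible_pair A B a1 a2 b1 b2 ?F u v" if uv: "(u, v) \<in> E" "(u, v) \<noteq> (p, q)" for u v
  proof -
    consider "u = a" "v = a'" | "v = b2" "u = a \<or> u = c2" | "v = b1" "u = a \<or> u = c1" | "u \<noteq> a" "v \<noteq> b1" "v \<noteq> b2"
      using uv a_only b1_only b2_only by blast
    then show ?thesis
    proof cases
      case 1
      have "(m(a := a')) u = v" "u \<notin> {a1, a2}" using 1 a by simp_all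
      then show ?thesis unfolding admissible_pair_def using m1 by blast
    next
      case 2
      from 2(2) show ?thesis
      proof
        assume u: "u = a"
        obtain m where m: "matches ?F' A' B' m" "m c1 = b1" using ad_b1[of c1] by blast
        obtain m' where "matches ?F A B m'" "m' a = b2" using lift0[OF m(1) F F2(1) sub] m(2) by metis
        then show ?thesis unfolding admissible_pair_def using u 2 by blast
      next
        assume u: "u = c2"
        obtain m where m: "matches ?F' A' B' m" "m c2 = b1" using ad_b1[of c2] by blast
        obtain m' where "matches ?F A B m'" "m' c2 = b2" using lift0[OF m(1) F F2(1) sub] m(2) by metis
        then show ?thesis unfolding admissible_pair_def using u 2 by blast
      qed
    next
      case 3
      from 3(2) show ?thesis
      proof
        assume u: "u = a"
        obtain m where m: "matches ?F' A' B' m" "m c2 = b1" using ad_b1[of c2] by blast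
        obtain m' where "matches ?F A B m'" "m' a = b1" using lift0[OF m(1) F F2(1) sub] m(2) by metis
        then show ?thesis unfolding admissible_pair_def using u 3 by blast
      next
        assume u: "u = c1"
        obtain m where m: "matches ?F' A' B' m" "m c1 = b1" using ad_b1[of c1] by blast
        obtain m' where "matches ?F A B m'" "m' c1 = b1" using lift0[OF m(1) F F2(1) sub] m(2) by metis
        then show ?thesis unfolding admissible_pair_def using u 3 by blast
      qed
    next
      case 4
      then have uE: "(u, v) \<in> E'" using uv by (simp add: E'_iff)
      then have uA: "u \<in> A'" using E'_sub by blast
      from ad[OF uE uv(2)] show ?thesis unfolding admissible_pair_def
      proof (elim disjE exE conjE)
        fix m assume m: "matches ?F' A' B' m" "m u = v"
        have "m u \<noteq> b1" using m 4 by simp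
        then obtain m' where "matches ?F A B m'" "m' u = m u" using lift0[OF m(1) F F2(1) sub] uA by metis
        then show "(\<exists>m. matches ?F A B m \<and> m u = v) \<or> (\<exists>m. matches ?F (A - {a1, a2}) (B - {b1, b2}) m \<and> u \<notin> {a1, a2} \<and> m u = v)"
          using m(2) by blast
      next
        fix m assume m: "matches ?F' (A' - {a1, a2}) (B' - {b1, a'}) m" "u \<notin> {a1, a2}" "m u = v"
        have "(m(a := a')) u = v" using m(3) 4 by simp
        then show "(\<exists>m. matches ?F A B m \<and> m u = v) \<or> (\<exists>m. matches ?F (A - {a1, a2}) (B - {b1, b2}) m \<and> u \<notin> {a1, a2} \<and> m u = v)"
          using lift1[OF m(1) F F2(2)] m(2) by blast
      qed
    qed
  qed
  then show ?thesis unfolding removable_pair_def using pq'(1) m1 by blast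
qed

text \<open>If \<open>a\<close> is matched inside the triangle, a single edge leaves the triangle
  and the matching contracts directly. If \<open>a\<close> is matched to \<open>a'\<close>, three
  edges leave it; here the rung repairs the contraction, with \<open>c1\<close> taking over
  \<open>a'\<close> and \<open>c2\<close> the contracted vertex.\<close>

lemma descend0:
  assumes m: "matches F A B m" and FE: "F \<subseteq> E"
    and F': "\<And>u v. (u, v) \<in> F \<Longrightarrow> u \<noteq> a \<Longrightarrow> v \<noteq> b1 \<Longrightarrow> v \<noteq> b2 \<Longrightarrow> (u, v) \<in> F'"
    and c: "(c2, b1) \<in> F'" "(c1, a') \<in> F'" "m a = b2 \<Longrightarrow> (c1, b1) \<in> F'"
  obtains m' where "matches F' A' B' m'" "\<And>u. u \<in> A' \<Longrightarrow> m u \<noteq> b1 \<Longrightarrow> m u \<noteq> b2 \<Longrightarrow> m' u = m u"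
    "m a = b2 \<Longrightarrow> m' c1 = b1" "m a = b1 \<Longrightarrow> m' c2 = b1"
proof -
  have ma: "m a = b1 \<or> m a = b2 \<or> m a = a'" using matches_edge[OF m a(1)] FE a_only by blast
  obtain z1 where z1: "z1 \<in> A" "m z1 = b1" "(z1, b1) \<in> F" using matches_pre[OF m bB(1)] .
  obtain z2 where z2: "z2 \<in> A" "m z2 = b2" "(z2, b2) \<in> F" using matches_pre[OF m bB(2)] .
  have z: "z1 = a \<or> z1 = c1" "z2 = a \<or> z2 = c2" using z1 z2 FE b1_only b2_only by blast+
  have inj: "m x = m y \<Longrightarrow> x \<in> A \<Longrightarrow> y \<in> A \<Longrightarrow> x = y" for x y using matches_inj[OF m] by blast
  have r: "matches F A' (B - {m a}) m" using restrict_matches[OF m a(1)] by (simp add: A'_def)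
  from ma show thesis
  proof (elim disjE)
    assume h: "m a = b1"
    have mc: "m c2 = b2" using z(2) z2 h bB by auto
    have "matches F (A' - {c2}) (B - {b1} - {b2}) m" using restrict_matches[OF r a12A'(6)] h mc by simp
    then have "matches F' (A' - {c2}) (B - {b1} - {b2}) m" by (rule matches_mono) (use F' in \<open>auto simp: A'_def\<close>)
    moreover have "B - {b1} - {b2} = B' - {b1}" by (auto simp: B'_def)
    ultimately have "matches F' (A' - {c2}) (B' - {b1}) m" by simp
    from extend_matches[OF this c(1)] have s: "matches F' A' B' (m(c2 := b1))" using a12A' by blast
    show thesis by (rule that[OF s]) (use mc h bB in auto)
  next
    assume h: "m a = b2"
    have mc: "m c1 = b1" using z(1) z1 h bB by auto
    have "matches F A' B' m" using r h by (simp add: B'_def)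
    then have s: "matches F' A' B' m"
    proof (rule matches_mono)
      fix p assume p: "p \<in> A'" "(p, m p) \<in> F" "m p \<in> B'"
      show "(p, m p) \<in> F'"
      proof (cases "m p = b1")
        case True
        then have "p = c1" using inj[of p c1] mc p cA by (auto simp: A'_def)
        then show ?thesis using c(3)[OF h] mc by simp
      next
        case False
        then show ?thesis using F' p by (auto simp: A'_def B'_def)
      qed
    qed
    show thesis by (rule that[OF s]) (use mc h bB in auto)
  next
    assume h: "m a = a'"
    have mc: "m c1 = b1" "m c2 = b2" using z z1 z2 h ne by auto
    have "matches F (A' - {c1}) (B - {a'} - {b1}) m" using restrict_matches[OF r a12A'(5)] h mc by simp
    from restrict_matches[OF this, of c2] have "matches F (A' - {c1} - {c2}) (B - {a'} - {b1} - {b2}) m"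
      using a12A' ne mc by simp
    then have "matches F' (A' - {c1} - {c2}) (B - {a'} - {b1} - {b2}) m" by (rule matches_mono) (use F' in \<open>auto simp: A'_def\<close>)
    moreover have "B - {a'} - {b1} - {b2} = B' - {a'} - {b1}" by (auto simp: B'_def)
    ultimately have "matches F' (A' - {c1} - {c2}) (B' - {a'} - {b1}) m" by simp
    from extend_matches[OF this c(1)] have "matches F' (A' - {c1}) (B' - {a'}) (m(c2 := b1))"
      using a12A' ne by blast
    from extend_matches[OF this c(2)] have s: "matches F' A' B' ((m(c2 := b1))(c1 := a'))" using a12A' by blast
    show thesis by (rule that[OF s]) (use mc h ne in auto)
  qed
qed

lemma descend1:
  assumes m: "matches F (A - {a1, a2}) (B - {b1, b2}) m" and FE: "F \<subseteq> E"
    and F': "\<And>u v. (u, v) \<in> F \<Longrightarrow> u \<noteq> a \<Longrightarrow> v \<noteq> b1 \<Longrightarrow> v \<noteq> b2 \<Longrightarrow> (u, v) \<in> F'"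
  shows "matches F' (A' - {a1, a2}) (B' - {b1, a'}) m"
proof -
  have aa: "a \<in> A - {a1, a2}" using a by blast
  have "m a = a'" using matches_edge[OF m aa] a_only FE by blast
  then have "matches F (A - {a1, a2} - {a}) (B - {b1, b2} - {a'}) m" using restrict_matches[OF m aa] by simp
  then show ?thesis unfolding A_eq by (rule matches_mono) (use F' in auto)
qed

text \<open>The deleted pair may have another name in the contraction. Besides pairs that are kept,
  this covers \<open>a b2\<close>, whose counterpart is \<open>c1 b1\<close>: a matching avoiding
  the special edges that uses \<open>a b2\<close> contracts to one that matches the new vertex with
  \<open>c1\<close>.\<close>

lemma rm_descend:
  assumes r: "rm p q" and rung: "(c1, a') \<in> E" and pq': "(p', q') \<in> E'"
    and F': "\<And>u v. (u, v) \<in> E \<Longrightarrow> (u, v) \<noteq> (p, q) \<Longrightarrow> u \<noteq> a \<Longrightarrow> v \<noteq> b1 \<Longrightarrow> v \<noteq> b2 \<Longrightarrow> (u, v) \<noteq> (p', q')"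
    and F'': "\<And>u v. (u, v) \<in> E' \<Longrightarrow> (u, v) \<noteq> (p', q') \<Longrightarrow> v \<noteq> b1 \<Longrightarrow> (u, v) \<noteq> (p, q)"
    and r1: "(p', q') \<noteq> (c2, b1)" "(p', q') \<noteq> (c1, a')" "(p, q) \<noteq> (a, b1)"
    and r2: "(p', q') = (c1, b1) \<longleftrightarrow> (p, q) = (a, b2)"
  shows "rm' p' q'"
proof -
  let ?F' = "E' - {(p', q')}" and ?F = "E - {(p, q)}"
  have FE: "?F \<subseteq> E" by blast
  have F: "(u, v) \<in> ?F'" if "(u, v) \<in> ?F" "u \<noteq> a" "v \<noteq> b1" "v \<noteq> b2" for u v
    using that F'[of u v] by (auto simp: E'_iff)
  have c: "(c2, b1) \<in> ?F'" "(c1, a') \<in> ?F'" using r1 rung ne bB by (auto simp: E'_iff)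
  have c3: "(c1, b1) \<in> ?F'" if "matches ?F A B m" "m a = b2" for m
  proof -
    have "(a, b2) \<in> ?F" using matches_edge[OF that(1) a(1)] that(2) by simp
    then show ?thesis using r2 by (auto simp: E'_iff)
  qed
  have desc: "\<exists>m'. matches ?F' A' B' m' \<and> (\<forall>u\<in>A'. m u \<noteq> b1 \<longrightarrow> m u \<noteq> b2 \<longrightarrow> m' u = m u) \<and>
      (m a = b2 \<longrightarrow> m' c1 = b1) \<and> (m a = b1 \<longrightarrow> m' c2 = b1)" if m: "matches ?F A B m" for m
  proof (rule descend0[OF m FE])
    show "(u, v) \<in> ?F'" if "(u, v) \<in> ?F" "u \<noteq> a" "v \<noteq> b1" "v \<noteq> b2" for u v using F that .
    show "(c2, b1) \<in> ?F'" "(c1, a') \<in> ?F'" using c .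
    show "(c1, b1) \<in> ?F'" if "m a = b2" using c3[OF m that] .
  qed blast
  obtain m where m: "matches ?F (A - {a1, a2}) (B - {b1, b2}) m" using r by (auto simp: removable_pair_def)
  have m1: "matches ?F' (A' - {a1, a2}) (B' - {b1, a'}) m" by (rule descend1[OF m FE]) (fact F)
  have ad: "admissible_pair A B a1 a2 b1 b2 ?F u v" if "(u, v) \<in> E" "(u, v) \<noteq> (p, q)" for u v
    using r that by (auto simp: removable_pair_def)
  have ad_a: "\<exists>m. matches ?F A B m \<and> m a = \<beta>" if be: "\<beta> = b1 \<or> \<beta> = b2" "(a, \<beta>) \<noteq> (p, q)" for \<beta>
  proof -
    have "admissible_pair A B a1 a2 b1 b2 ?F a \<beta>" using be ab by (intro ad) auto
    then show ?thesis unfolding admissible_pair_def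
    proof (elim disjE exE conjE)
      fix m assume m: "matches ?F (A - {a1, a2}) (B - {b1, b2}) m" "m a = \<beta>"
      then show ?thesis using matches_edge[OF m(1), of a] a be by blast
    qed blast
  qed
  have "admissible_pair A' B' a1 a2 b1 a' ?F' u v" if uv: "(u, v) \<in> E'" "(u, v) \<noteq> (p', q')" for u v
  proof -
    consider "v = b1" "u = c1" | "v = b1" "u = c2" | "v \<noteq> b1" "u \<noteq> a" "v \<noteq> b2" "(u, v) \<in> E"
      using uv(1) by (auto simp: E'_iff split: if_splits)
    then show ?thesis
    proof cases
      case 1
      then have "(a, b2) \<noteq> (p, q)" using uv(2) r2 by auto
      then obtain m where m: "matches ?F A B m" "m a = b2" using ad_a by blast
      obtain m' where "matches ?F' A' B' m'" "m' c1 = b1"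
        using desc[OF m(1)] m(2) by blast
      then show ?thesis unfolding admissible_pair_def using 1 by blast
    next
      case 2
      obtain m where m: "matches ?F A B m" "m a = b1" using ad_a[of b1] r1(3) by metis
      obtain m' where "matches ?F' A' B' m'" "m' c2 = b1"
        using desc[OF m(1)] m(2) by blast
      then show ?thesis unfolding admissible_pair_def using 2 by blast
    next
      case 3
      have uA: "u \<in> A'" using uv(1) E'_sub by blast
      from ad[OF 3(4) F''[OF uv 3(1)]] show ?thesis unfolding admissible_pair_def
      proof (elim disjE exE conjE)
        fix m assume m: "matches ?F A B m" "m u = v"
        have "m u \<noteq> b1" "m u \<noteq> b2" using m 3 by simp_all
        then obtain m' where "matches ?F' A' B' m'" "m' u = m u"
          using desc[OF m(1)] uA by blast
        then show "(\<exists>m. matches ?F' A' B' m \<and> m u = v) \<or> (\<exists>m. matches ?F' (A' - {a1, a2}) (B' - {b1, a'}) m \<and> u \<notin> {a1, a2} \<and> m u = v)"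
          using m(2) by blast
      next
        fix m assume m: "matches ?F (A - {a1, a2}) (B - {b1, b2}) m" "u \<notin> {a1, a2}" "m u = v"
        have "matches ?F' (A' - {a1, a2}) (B' - {b1, a'}) m" by (rule descend1[OF m(1) FE]) (fact F)
        then show "(\<exists>m. matches ?F' A' B' m \<and> m u = v) \<or> (\<exists>m. matches ?F' (A' - {a1, a2}) (B' - {b1, a'}) m \<and> u \<notin> {a1, a2} \<and> m u = v)"
          using m(2,3) by blast
      qed
    qed
  qed
  then show ?thesis unfolding removable_pair_def using pq' m1 by blast
qed

lemma rm_imp_rm':
  assumes "rm p q" "(c1, a') \<in> E" "p \<noteq> a" "q \<noteq> b1" "q \<noteq> b2" "(p, q) \<noteq> (c1, a')"
  shows "rm' p q"
proof -
  have "(p, q) \<in> E" using assms(1) by (simp add: removable_pair_def)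
  then show ?thesis using assms by (intro rm_descend) (auto simp: E'_iff)
qed

lemma rm_a_b2_imp:
  assumes "rm a b2" "(c1, a') \<in> E" shows "rm' c1 b1"
  by (rule rm_descend[OF assms]) (use ne bB in \<open>auto simp: E'_iff\<close>)


section \<open>Hall bounds and degrees of the contraction\<close>

lemma card_A': "card A' + 1 = card A" "card B' + 1 = card B"
  unfolding A'_def B'_def using card_Suc_Diff1[OF finA a(1)] card_Suc_Diff1[OF finB bB(2)] by simp_all

lemma N_insert_a: "N (insert a S) = N S \<union> {b1, b2, a'}"
proof -
  have "N (insert a S) = N S \<union> N {a}" by blast
  then show ?thesis unfolding Na .
qed

text \<open>If \<open>c1 \<in> S\<close>, compare with the bound for \<open>insert a S\<close>: the
  neighbour \<open>a'\<close> is still seen, through the rung, and only \<open>b2\<close> is lost.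
  If \<open>c1 \<notin> S\<close>, then \<open>S\<close> does not see \<open>b1\<close>, and at most
  the name of \<open>b2\<close> changes.\<close>

lemma hall1':
  assumes rung: "(c1, a') \<in> E" and S: "S \<subseteq> A'" "S \<noteq> {}" "S \<noteq> A'"
  shows "card S + 1 \<le> card (E' `` S)"
proof -
  have SA: "S \<subseteq> A" "a \<notin> S" "finite S" using S finA finite_subset[of S A] by (auto simp: A'_def)
  have c: "card (insert a S) = card S + 1" using SA by simp
  have nA: "insert a S \<noteq> A" using S SA by (auto simp: A'_def)
  have h: "card S + 2 \<le> card (N (insert a S))" using hall1[of "insert a S"] SA a nA c by simp
  show ?thesis
  proof (cases "c1 \<in> S")
    case True
    have "N (insert a S) - {b2} \<subseteq> E' `` S"
    proof
      fix q assume q: "q \<in> N (insert a S) - {b2}"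
      show "q \<in> E' `` S"
      proof (cases "q = b1")
        case b: True
        have "(c1, b1) \<in> E'" by (simp add: E'_iff)
        then show ?thesis using b True by blast
      next
        case b: False
        have "(c1, a') \<in> E'" using rung ne by (simp add: E'_iff)
        moreover have "(s, q) \<in> E'" if "s \<in> S" "(s, q) \<in> E" for s using that q b SA by (auto simp: E'_iff)
        ultimately show ?thesis using q b True unfolding N_insert_a by blast
      qed
    qed
    moreover have "finite (E' `` S)" using E'_sub finB finite_subset[of "E' `` S" B] by (auto simp: B'_def)
    ultimately have "card (N (insert a S) - {b2}) \<le> card (E' `` S)" by (intro card_mono)
    then show ?thesis using h card_le_Diff1[of "N (insert a S)" b2] by linarith
  next
    case c1S: False
    have b1S: "b1 \<notin> N S" using b1_only c1S SA by blast
    have SnA: "S \<noteq> A" using SA a by blast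
    have h2: "card S + 1 \<le> card (N S)" using hall1[OF SA(1) S(2) SnA] .
    show ?thesis
    proof (cases "c2 \<in> S")
      case True
      have e: "E' `` S = insert b1 (N S - {b2})"
      proof (rule set_eqI)
        fix q show "q \<in> E' `` S \<longleftrightarrow> q \<in> insert b1 (N S - {b2})"
          using SA c1S True by (auto simp: Image_iff E'_iff split: if_splits)
      qed
      have "b2 \<in> N S" using True ab by blast
      then have "card (N S - {b2}) + 1 = card (N S)" using card_Suc_Diff1[OF finN] by simp
      then have "card (E' `` S) = card (N S)" unfolding e using b1S by simp
      then show ?thesis using h2 by simp
    next
      case False
      have b2S: "b2 \<notin> N S" using b2_only False SA by blast
      have "N S \<subseteq> E' `` S"
      proof
        fix q assume q: "q \<in> N S"
        then obtain s where "s \<in> S" "(s, q) \<in> E" by blast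
        moreover have "q \<noteq> b1" "q \<noteq> b2" using q b1S b2S by blast+
        ultimately have "(s, q) \<in> E'" using SA by (auto simp: E'_iff)
        then show "q \<in> E' `` S" using \<open>s \<in> S\<close> by blast
      qed
      moreover have "finite (E' `` S)" using E'_sub finB finite_subset[of "E' `` S" B] by (auto simp: B'_def)
      ultimately have "card (N S) \<le> card (E' `` S)" by (intro card_mono)
      then show ?thesis using h2 by simp
    qed
  qed
qed

text \<open>Adding \<open>a\<close> to \<open>S\<close> raises the bound of \<open>hall2\<close> by
  one, and the only further neighbour that is not counted is \<open>a'\<close>.\<close>

lemma hall2':
  assumes S: "S \<subseteq> A'" "card S + 2 \<le> card A'"
  shows "card S \<le> card (E' `` S - {b1, a'})"
proof -
  have SA: "S \<subseteq> A" "a \<notin> S" "finite S" using S finA finite_subset[of S A] by (auto simp: A'_def)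
  have c: "card (insert a S) = card S + 1" using SA by simp
  have sub: "insert a S \<subseteq> A" using SA a by blast
  have "card S + 1 \<le> card (N (insert a S) - {b1, b2})"
    using hall2[OF sub] c S card_A' by simp
  also have "\<dots> \<le> card (N (insert a S) - {b1, b2} - {a'}) + 1" by (rule card_le_Diff1)
  also have "N (insert a S) - {b1, b2} - {a'} \<subseteq> E' `` S - {b1, a'}"
  proof
    fix q assume q: "q \<in> N (insert a S) - {b1, b2} - {a'}"
    then obtain s where "s \<in> S" "(s, q) \<in> E" unfolding N_insert_a by blast
    moreover then have "(s, q) \<in> E'" using q SA by (auto simp: E'_iff)
    ultimately show "q \<in> E' `` S - {b1, a'}" using q by blast
  qed
  then have "card (N (insert a S) - {b1, b2} - {a'}) \<le> card (E' `` S - {b1, a'})"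
    using E'_sub finB finite_subset[of "E' `` S" B] by (intro card_mono) (auto simp: B'_def)
  finally show ?thesis by simp
qed

text \<open>A vertex is added to \<open>T\<close> to pay for the possible loss of the neighbour
  \<open>a\<close>: \<open>b2\<close> if \<open>b1 \<in> T\<close>, and \<open>b1\<close> if
  \<open>a' \<in> T\<close>, whose other neighbour \<open>c1\<close> is seen from \<open>a'\<close>
  through the rung. If neither is in \<open>T\<close>, then \<open>a\<close> is not a neighbour of
  \<open>T\<close> and nothing is lost.\<close>

lemma hall3':
  assumes rung: "(c1, a') \<in> E" and T: "T \<subseteq> B'" "card T + 2 \<le> card B'"
  shows "card T \<le> card (E'\<inverse> `` T - {a1, a2})"
proof -
  have TB: "T \<subseteq> B" "b2 \<notin> T" "finite T" using T finB finite_subset[of T B] by (auto simp: B'_def)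
  have fin: "finite (E'\<inverse> `` T - {a1, a2})" using E'_sub finA finite_subset[of "E'\<inverse> `` T" A] by (auto simp: A'_def)
  have g: "card T \<le> card (E'\<inverse> `` T - {a1, a2})"
    if \<beta>: "\<beta> \<in> B" "\<beta> \<notin> T" and sub: "E\<inverse> `` insert \<beta> T - {a} \<subseteq> E'\<inverse> `` T" for \<beta>
  proof -
    have "insert \<beta> T \<subseteq> B" using \<beta> TB by blast
    moreover have "card (insert \<beta> T) = card T + 1" using \<beta> TB by simp
    ultimately have "card T + 1 \<le> card (E\<inverse> `` insert \<beta> T - {a1, a2})"
      using hall3[of "insert \<beta> T"] T card_A' by simp
    also have "\<dots> \<le> card (E\<inverse> `` insert \<beta> T - {a1, a2} - {a}) + 1" by (rule card_le_Diff1)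
    also have "card (E\<inverse> `` insert \<beta> T - {a1, a2} - {a}) \<le> card (E'\<inverse> `` T - {a1, a2})"
      using sub by (intro card_mono[OF fin]) blast
    finally show ?thesis by simp
  qed
  show ?thesis
  proof (cases "b1 \<in> T")
    case True
    show ?thesis
    proof (rule g[OF bB(2) TB(2)])
      show "E\<inverse> `` insert b2 T - {a} \<subseteq> E'\<inverse> `` T"
      proof
        fix p assume p: "p \<in> E\<inverse> `` insert b2 T - {a}"
        then obtain q where q: "q = b2 \<or> q \<in> T" "(p, q) \<in> E" by blast
        show "p \<in> E'\<inverse> `` T"
        proof (cases "q = b2 \<or> q = b1")
          case b: True
          then have "p = c1 \<or> p = c2" using q p b1_only b2_only by blast
          then have "(p, b1) \<in> E'" by (simp add: E'_iff)
          then show ?thesis using True by blast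
        next
          case False
          then have "(p, q) \<in> E'" using q p by (simp add: E'_iff)
          then show ?thesis using False q by blast
        qed
      qed
    qed
  next
    case b1T: False
    have E': "(p, q) \<in> E'" if "q \<in> T" "(p, q) \<in> E" "p \<noteq> a" for p q
    proof -
      have "q \<noteq> b1" "q \<noteq> b2" using that(1) b1T TB by blast+
      then show ?thesis using that by (simp add: E'_iff)
    qed
    show ?thesis
    proof (cases "a' \<in> T")
      case True
      show ?thesis
      proof (rule g[OF bB(1) b1T])
        show "E\<inverse> `` insert b1 T - {a} \<subseteq> E'\<inverse> `` T"
        proof
          fix p assume p: "p \<in> E\<inverse> `` insert b1 T - {a}"
          then obtain q where q: "q = b1 \<or> q \<in> T" "(p, q) \<in> E" by blast
          show "p \<in> E'\<inverse> `` T"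
          proof (cases "q = b1")
            case b: True
            then have "p = c1" using q p b1_only by blast
            then have "(p, a') \<in> E'" using rung True p by (intro E') blast+
            then show ?thesis using True by blast
          next
            case False
            then have "(p, q) \<in> E'" using q p by (intro E') blast+
            then show ?thesis using False q by blast
          qed
        qed
      qed
    next
      case False
      have "E\<inverse> `` T \<subseteq> E'\<inverse> `` T"
      proof
        fix p assume "p \<in> E\<inverse> `` T"
        then obtain q where q: "q \<in> T" "(p, q) \<in> E" by blast
        have "q \<noteq> b1" "q \<noteq> b2" "q \<noteq> a'" using q(1) b1T TB False by blast+
        then have "p \<noteq> a" using q(2) a_only by blast
        then show "p \<in> E'\<inverse> `` T" using E' q by blast
      qed
      then have "card (E\<inverse> `` T - {a1, a2}) \<le> card (E'\<inverse> `` T - {a1, a2})" by (intro card_mono[OF fin]) blast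
      then show ?thesis using hall3[OF TB(1)] T card_A' by simp
    qed
  qed
qed

lemma core':
  assumes rung: "(c1, a') \<in> E" and big4: "4 \<le> card A"
  shows "core A' B' E' a1 a2 b1 a'"
proof unfold_locales
  show "finite A'" "finite B'" using finA finB by (simp_all add: A'_def B'_def)
  show "card A' = card B'" "3 \<le> card A'" using card_A' cardAB big4 by simp_all
qed (use E'_sub aA a12A' ne hall1'[OF rung] hall2' hall3'[OF rung] in simp_all)

text \<open>With degree two, \<open>c1\<close> would see only \<open>b1\<close> and
  \<open>a'\<close>, so \<open>{a, c1}\<close> would have the single neighbour \<open>a'\<close>
  outside \<open>{b1, b2}\<close>, contrary to \<open>hall2\<close>.\<close>

lemma c1_not_end:
  assumes rung: "(c1, a') \<in> E" and big4: "4 \<le> card A" and two: "card (N {c1}) = 2"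
  shows False
proof -
  have "N {c1} = {b1, a'}"
    using two ab rung ne by (intro card_seteq[symmetric]) auto
  then have "N (insert a {c1}) - {b1, b2} \<subseteq> {a'}" unfolding N_insert_a by blast
  then have "card (N (insert a {c1}) - {b1, b2}) \<le> card {a'}" by (intro card_mono) simp_all
  moreover have "card (insert a {c1}) \<le> card (N (insert a {c1}) - {b1, b2})"
    using a cA ne big4 by (intro hall2) simp_all
  ultimately show False using ne by simp
qed

lemma N'_image:
  assumes p: "p \<in> A'" shows "E' `` {p} = (\<lambda>q. if q = b2 then b1 else q) ` N {p}"
proof (rule set_eqI)
  fix q
  have pa: "p \<noteq> a" using p by (simp add: A'_def)
  show "q \<in> E' `` {p} \<longleftrightarrow> q \<in> (\<lambda>q. if q = b2 then b1 else q) ` N {p}"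
  proof (cases "q = b1")
    case True
    have "q \<in> (\<lambda>q. if q = b2 then b1 else q) ` N {p} \<longleftrightarrow> (p, b1) \<in> E \<or> (p, b2) \<in> E"
      using True by (auto simp: image_iff)
    also have "\<dots> \<longleftrightarrow> p = c1 \<or> p = c2" using b1_only[of p] b2_only[of p] pa ab by blast
    finally show ?thesis using True by (simp add: E'_iff)
  next
    case False
    then show ?thesis using pa by (auto simp: E'_iff image_iff)
  qed
qed

lemma inj_relabel: assumes p: "p \<in> A'" shows "inj_on (\<lambda>q. if q = b2 then b1 else q) (N {p})"
proof -
  have "\<not> ((p, b1) \<in> E \<and> (p, b2) \<in> E)" using p b1_only[of p] b2_only[of p] ne by (auto simp: A'_def)
  then show ?thesis by (auto simp: inj_on_def)
qed

lemma card_N': assumes "p \<in> A'" shows "card (E' `` {p}) = card (N {p})"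
  unfolding N'_image[OF assms] by (rule card_image[OF inj_relabel[OF assms]])

lemma N'_conv: "q \<in> B' \<Longrightarrow> q \<noteq> b1 \<Longrightarrow> E'\<inverse> `` {q} = E\<inverse> `` {q} - {a}"
  by (auto simp: E'_iff B'_def)

lemma N'_conv_b1: "E'\<inverse> `` {b1} = {c1, c2}" by (auto simp: E'_iff)

end

context cubic_tri begin

text \<open>The rung makes \<open>c1\<close>, \<open>b1\<close>, \<open>a'\<close> a triangle on the
  new special edge, with apex \<open>c1\<close>. So the contraction is again of the same kind and
  the induction can continue.\<close>

lemma cubic_tri':
  assumes rung: "(c1, a') \<in> E" and big4: "4 \<le> card A"
  shows "\<exists>w y. cubic_tri A' B' E' a1 a2 b1 a' c1 w c2 y"
proof -
  interpret k: core A' B' E' a1 a2 b1 a' by (rule core'[OF rung big4])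
  have c1n: "c1 \<noteq> a1" "c1 \<noteq> a2" using c1_not_end[OF rung big4] da by blast+
  have c1E: "{b1, a'} \<subseteq> E' `` {c1}" using rung ne by (auto simp: E'_iff)
  have c3: "card (E' `` {c1}) = 3" using dA[OF cA(1) c1n] card_N' a12A' by simp
  then have "card (E' `` {c1} - {b1, a'}) = 1" using c1E ne by (simp add: card_Diff_subset)
  then obtain w where "E' `` {c1} - {b1, a'} = {w}" by (meson card_1_singletonE)
  then have w: "E' `` {c1} = {b1, a', w}" using c1E by blast
  have e: "E'\<inverse> `` {a'} = E\<inverse> `` {a'} - {a}" using N'_conv a12A' ne by blast
  have c1E': "c1 \<in> E'\<inverse> `` {a'}" using c1E by blast
  have f: "finite (E\<inverse> `` {a'})" using core.finN[OF dual] .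
  have "a \<in> E\<inverse> `` {a'}" using ab by blast
  then have "card (E'\<inverse> `` {a'}) + 1 = card (E\<inverse> `` {a'})" unfolding e using card_Suc_Diff1[OF f] by simp
  then have "card (E'\<inverse> `` {a'}) = 2" using dB[OF cA(3) ne(1,2)] by simp
  moreover have "finite (E'\<inverse> `` {a'})" unfolding e using f by simp
  ultimately have "card (E'\<inverse> `` {a'} - {c1}) = 1" using c1E' card_Suc_Diff1[of "E'\<inverse> `` {a'}" c1] by simp
  then obtain y where "E'\<inverse> `` {a'} - {c1} = {y}" by (meson card_1_singletonE)
  then have y: "E'\<inverse> `` {a'} = {c1, y}" using c1E' by blast
  have "tri A' B' E' a1 a2 b1 a' c1 w c2 y"
    by unfold_locales (fact a12A' c1n w N'_conv_b1 y)+
  moreover have "card (E'\<inverse> `` {q}) = 3" if q: "q \<in> B'" "q \<noteq> b1" "q \<noteq> a'" for q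
  proof -
    have "q \<noteq> b2" "q \<in> B" using q by (simp_all add: B'_def)
    then have "a \<notin> E\<inverse> `` {q}" using a_only q by blast
    then have "E'\<inverse> `` {q} = E\<inverse> `` {q}" using N'_conv q by blast
    then show ?thesis using dB \<open>q \<in> B\<close> \<open>q \<noteq> b2\<close> q by simp
  qed
  moreover have "card (E' `` {p}) = 3" if "p \<in> A'" "p \<noteq> a1" "p \<noteq> a2" for p
    using that dA card_N' by (simp add: A'_def)
  moreover have "card (E' `` {a1}) = 2" "card (E' `` {a2}) = 2" using da card_N' a12A' by simp_all
  ultimately have "cubic_tri A' B' E' a1 a2 b1 a' c1 w c2 y"
    unfolding cubic_tri_def cubic_tri_axioms_def by blast
  then show ?thesis by blast
qed

text \<open>Renaming \<open>b2\<close> to \<open>b1\<close> carries nonremovable pairs at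
  \<open>p\<close> to nonremovable pairs: kept pairs by \<open>rm'_imp_rm\<close>, while
  \<open>c2 b2\<close> becomes the edge that leaves the new triangle at \<open>b1\<close>. The
  vertex \<open>c1\<close> is left out, as it becomes the new apex.\<close>

lemma nonrem'_card:
  assumes rung: "(c1, a') \<in> E" and big4: "4 \<le> card A" and p: "p \<in> A'" "p \<noteq> c1"
  shows "card (nonrem p) \<le> card (core.nonrem A' B' E' a1 a2 b1 a' p)"
proof -
  let ?f = "\<lambda>q. if q = b2 then b1 else q"
  interpret k: core A' B' E' a1 a2 b1 a' by (rule core'[OF rung big4])
  obtain w y where "cubic_tri A' B' E' a1 a2 b1 a' c1 w c2 y" using cubic_tri'[OF rung big4] by blast
  then interpret t: cubic_tri A' B' E' a1 a2 b1 a' c1 w c2 y .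
  have pa: "p \<noteq> a" "p \<in> A" using p by (simp_all add: A'_def)
  have sub: "?f ` nonrem p \<subseteq> k.nonrem p"
  proof
    fix x assume "x \<in> ?f ` nonrem p"
    then obtain q where q: "(p, q) \<in> E" "\<not> rm p q" "x = ?f q" by (auto simp: nonrem_def)
    have qb1: "q \<noteq> b1" using q(1) pa p b1_only by blast
    show "x \<in> k.nonrem p"
    proof (cases "q = b2")
      case True
      then have pc: "p = c2" using q(1) pa b2_only by blast
      have "\<not> rm' c2 b1" using t.not_rm_c1 .
      then show ?thesis using True q(3) pc by (simp add: k.nonrem_def E'_iff)
    next
      case False
      then have "\<not> rm' p q" using rm'_imp_rm qb1 q(2) by blast
      then show ?thesis using False q pa qb1 by (simp add: k.nonrem_def E'_iff)
    qed
  qed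
  have fin: "finite (k.nonrem p)" by (rule finite_subset[of _ "E' `` {p}"]) (auto simp: k.nonrem_def)
  have inj: "inj_on ?f (nonrem p)" by (rule inj_on_subset[OF inj_relabel[OF p(1)]]) (auto simp: nonrem_def)
  show ?thesis using card_mono[OF fin sub] unfolding card_image[OF inj] .
qed

end

section \<open>Near-bipartite graphs\<close>

locale bip_pair =
  fixes G :: "('v, 'e) mgraph" and A B :: "'v set" and a1 a2 b1 b2 :: 'v and e1 e2 :: 'e
  assumes wf: "wf_graph G" and dj: "A \<inter> B = {}" and V: "verts G = A \<union> B"
    and e12: "e1 \<in> edges G" "e2 \<in> edges G"
    and en: "ends G e1 = {a1, a2}" "ends G e2 = {b1, b2}"
    and inA: "a1 \<in> A" "a2 \<in> A" and inB: "b1 \<in> B" "b2 \<in> B"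
    and cross: "\<And>e. e \<in> edges G \<Longrightarrow> e \<noteq> e1 \<Longrightarrow> e \<noteq> e2 \<Longrightarrow> \<exists>p\<in>A. \<exists>q\<in>B. ends G e = {p, q}"
begin

definition cross_pairs :: "'e set \<Rightarrow> ('v \<times> 'v) set" where
  "cross_pairs F = {(p, q). p \<in> A \<and> q \<in> B \<and> (\<exists>e\<in>F. ends G e = {p, q})}"

lemma fin: "finite A" "finite B" "finite (edges G)"
  using wf V unfolding wf_graph_def by (metis finite_Un)+

lemma card_ends: "e \<in> edges G \<Longrightarrow> card (ends G e) = 2"
  using wf unfolding wf_graph_def by blast

lemma distinct_ends: "a1 \<noteq> a2" "b1 \<noteq> b2"
  using card_ends[OF e12(1)] card_ends[OF e12(2)] unfolding en by auto

lemma e1_ne_e2: "e1 \<noteq> e2"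
  using en inA inB dj by auto

lemma cross_pairs_sub: "cross_pairs F \<subseteq> A \<times> B" by (auto simp: cross_pairs_def)

lemma doubleton_cross_eq:
  assumes "p \<in> A" "q \<in> B" "p' \<in> A" "q' \<in> B" "{p, q} = {p', q'}" shows "p = p'" "q = q'"
  using assms dj by (auto simp: doubleton_eq_iff)

text \<open>The classes \<open>P\<close>, \<open>Q\<close> may be smaller than \<open>A\<close>,
  \<open>B\<close>, so that graphs with deleted vertices are included. Ends of a special edge in
  \<open>M\<close> are matched to each other and drop out of their class.\<close>

lemma pm_matches:
  assumes M: "perfect_matching K M"
    and K: "edges K \<subseteq> edges G" "ends K = ends G" "verts K = P \<union> Q" "P \<subseteq> A" "Q \<subseteq> B"
      "\<And>e. e \<in> edges K \<Longrightarrow> ends G e \<subseteq> P \<union> Q"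
  obtains m where
    "matches (cross_pairs M) (P - (if e1 \<in> M then {a1, a2} else {})) (Q - (if e2 \<in> M then {b1, b2} else {})) m"
    "\<And>p q e. p \<in> A \<Longrightarrow> q \<in> B \<Longrightarrow> e \<in> M \<Longrightarrow> ends G e = {p, q} \<Longrightarrow> m p = q"
proof -
  let ?P = "P - (if e1 \<in> M then {a1, a2} else {})" and ?Q = "Q - (if e2 \<in> M then {b1, b2} else {})"
  have ME: "M \<subseteq> edges K" using M by (simp add: perfect_matching_def)
  have ex1: "\<exists>!e. e \<in> M \<and> v \<in> ends G e" if "v \<in> P \<union> Q" for v
    using M K(2,3) that by (simp add: perfect_matching_def)
  have same: "e = f" if "e \<in> M" "f \<in> M" "v \<in> ends G e" "v \<in> ends G f" for e f v
  proof -
    have "v \<in> P \<union> Q" using K(6) ME that by blast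
    then show ?thesis using ex1 that by blast
  qed
  define m where "m p = (THE q. q \<in> B \<and> (\<exists>e\<in>M. ends G e = {p, q}))" for p
  have mq: "m p = q" if h: "p \<in> A" "q \<in> B" "e \<in> M" "ends G e = {p, q}" for p q e
    unfolding m_def
  proof (rule the_equality)
    show "q \<in> B \<and> (\<exists>e\<in>M. ends G e = {p, q})" using h by blast
  next
    fix q' assume "q' \<in> B \<and> (\<exists>e\<in>M. ends G e = {p, q'})"
    then obtain e' where e': "q' \<in> B" "e' \<in> M" "ends G e' = {p, q'}" by blast
    then have "e' = e" using same[of e' e p] h by simp
    then show "q' = q" using e' h doubleton_cross_eq(2)[of p q' p q] by simp
  qed
  have P: "\<exists>q\<in>?Q. \<exists>e\<in>M. ends G e = {p, q}" if p: "p \<in> ?P" for p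
  proof -
    have pA: "p \<in> A" "p \<in> P" using p K by (auto split: if_splits)
    obtain e where e: "e \<in> M" "p \<in> ends G e" using ex1[of p] pA by blast
    have "e \<noteq> e1" using p e en by auto
    moreover have "e \<noteq> e2" using e en inB pA dj by auto
    ultimately obtain p' q where pq: "p' \<in> A" "q \<in> B" "ends G e = {p', q}" using cross e ME K(1) by blast
    then have pp: "p' = p" using e(2) pA dj by auto
    have "q \<in> P \<union> Q" using K(6)[of e] ME e pq by blast
    then have "q \<in> Q" using K(4) pq dj by blast
    moreover have "q \<notin> {b1, b2}" if "e2 \<in> M"
    proof
      assume "q \<in> {b1, b2}"
      then have "e = e2" using same[of e e2 q] e(1) that pq en by simp
      then show False using \<open>e \<noteq> e2\<close> by simp
    qed
    ultimately have "q \<in> ?Q" by (cases "e2 \<in> M") simp_all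
    then show ?thesis using e(1) pq pp by blast
  qed
  have Q: "\<exists>p\<in>?P. \<exists>e\<in>M. ends G e = {p, q}" if q: "q \<in> ?Q" for q
  proof -
    have qB: "q \<in> B" "q \<in> Q" using q K by (auto split: if_splits)
    obtain e where e: "e \<in> M" "q \<in> ends G e" using ex1[of q] qB by blast
    have "e \<noteq> e2" using q e en by auto
    moreover have e1': "e \<noteq> e1" using e en inA qB dj by auto
    ultimately obtain p q' where pq: "p \<in> A" "q' \<in> B" "ends G e = {p, q'}" using cross e ME K(1) by blast
    then have qq: "q' = q" using e(2) qB dj by auto
    have "p \<in> P \<union> Q" using K(6)[of e] ME e pq by blast
    then have "p \<in> P" using K(5) pq dj by blast
    moreover have "p \<notin> {a1, a2}" if "e1 \<in> M"
    proof
      assume "p \<in> {a1, a2}"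
      then have "e = e1" using same[of e e1 p] e(1) that pq en by simp
      then show False using e1' by simp
    qed
    ultimately have "p \<in> ?P" by (cases "e1 \<in> M") simp_all
    then show ?thesis using e(1) pq qq by blast
  qed
  have PA: "?P \<subseteq> A" and QB: "?Q \<subseteq> B" using K by auto
  have mP: "m p \<in> ?Q \<and> (\<exists>e\<in>M. ends G e = {p, m p})" if pp: "p \<in> ?P" for p
  proof -
    obtain q e where h: "q \<in> ?Q" "e \<in> M" "ends G e = {p, q}" using P[OF pp] by blast
    then have "m p = q" using mq[of p q e] PA QB pp by blast
    then show ?thesis using h by blast
  qed
  have "inj_on m ?P"
  proof (rule inj_onI)
    fix x y assume xy: "x \<in> ?P" "y \<in> ?P" "m x = m y"
    obtain e where e: "e \<in> M" "ends G e = {x, m x}" using mP[OF xy(1)] by blast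
    obtain f where f: "f \<in> M" "ends G f = {y, m y}" using mP[OF xy(2)] by blast
    have "e = f" using same[of e f "m x"] e f xy(3) by simp
    then show "x = y" using e f doubleton_cross_eq(1)[of x "m x" y "m y"] PA QB xy mP by (metis subsetD)
  qed
  moreover have "m ` ?P = ?Q"
  proof
    show "m ` ?P \<subseteq> ?Q" using mP by blast
    show "?Q \<subseteq> m ` ?P"
    proof
      fix q assume q: "q \<in> ?Q"
      obtain p e where h: "p \<in> ?P" "e \<in> M" "ends G e = {p, q}" using Q[OF q] by blast
      then have "m p = q" using mq[of p q e] PA QB q by blast
      then show "q \<in> m ` ?P" using h(1) by blast
    qed
  qed
  moreover have "\<forall>p\<in>?P. (p, m p) \<in> cross_pairs M" using mP PA QB unfolding cross_pairs_def by blast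
  ultimately have "matches (cross_pairs M) ?P ?Q m" by (simp add: matches_def bij_betw_def)
  then show thesis using that mq by blast
qed

text \<open>Each matched pair has to choose one of its parallel edges; prescribing the choice
  \<open>f\<close> at \<open>u\<close> allows any given edge to be placed in the perfect
  matching.\<close>

lemma matches_pm:
  assumes K: "edges K \<subseteq> edges G" "ends K = ends G" "verts K = A \<union> B"
    and m: "matches (cross_pairs (edges K)) P Q m"
    and PQ: "P = A \<and> Q = B \<and> X = {} \<or> P = A - {a1, a2} \<and> Q = B - {b1, b2} \<and> X = {e1, e2} \<and> X \<subseteq> edges K"
  shows "\<exists>M. perfect_matching K M \<and> X \<subseteq> M \<and> (u \<in> P \<and> f \<in> edges K \<and> ends G f = {u, m u} \<longrightarrow> f \<in> M)"
proof -
  let ?c = "u \<in> P \<and> f \<in> edges K \<and> ends G f = {u, m u}"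
  have mP: "m p \<in> Q" "\<exists>e. e \<in> edges K \<and> ends G e = {p, m p}" if "p \<in> P" for p
    using m that by (auto simp: matches_def bij_betw_def cross_pairs_def)
  have PA: "P \<subseteq> A" "Q \<subseteq> B" using PQ by auto
  define g where "g p = (if p = u \<and> ?c then f else SOME e. e \<in> edges K \<and> ends G e = {p, m p})" for p
  have g: "g p \<in> edges K" "ends G (g p) = {p, m p}" if "p \<in> P" for p
    using someI_ex[OF mP(2)[OF that]] by (auto simp: g_def)
  define M where "M = g ` P \<union> X"
  have gp: "v = p \<or> v = m p" if "v \<in> ends G (g p)" "p \<in> P" for v p using g(2) that by simp
  have inj: "x = y" if "x \<in> P" "y \<in> P" "m x = m y" for x y using matches_inj[OF m] that by blast
  have un: "\<exists>!e. e \<in> M \<and> v \<in> ends G e" if v: "v \<in> A \<union> B" for v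
  proof (cases "v \<in> P \<union> Q")
    case True
    have XN: "v \<notin> ends G e" if "e \<in> X" for e
      using that True PQ en dj inA inB by auto
    show ?thesis
    proof (cases "v \<in> P")
      case vP: True
      show ?thesis
      proof (rule ex1I[of _ "g v"])
        show "g v \<in> M \<and> v \<in> ends G (g v)" using vP g by (simp add: M_def)
        fix e assume e: "e \<in> M \<and> v \<in> ends G e"
        then obtain p where p: "p \<in> P" "e = g p" using XN by (auto simp: M_def)
        then have "v = p \<or> v = m p" using gp e by blast
        moreover have "v \<noteq> m p" using mP(1)[OF p(1)] vP PA dj by blast
        ultimately show "e = g v" using p by simp
      qed
    next
      case False
      then have vQ: "v \<in> Q" using True by blast
      obtain z where z: "z \<in> P" "m z = v" using matches_pre[OF m vQ] .
      show ?thesis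
      proof (rule ex1I[of _ "g z"])
        show "g z \<in> M \<and> v \<in> ends G (g z)" using z g by (simp add: M_def)
        fix e assume e: "e \<in> M \<and> v \<in> ends G e"
        then obtain p where p: "p \<in> P" "e = g p" using XN by (auto simp: M_def)
        then have "v = m p" using gp e False by blast
        then show "e = g z" using inj[of p z] z p by simp
      qed
    qed
  next
    case False
    then have X: "P = A - {a1, a2}" "Q = B - {b1, b2}" "X = {e1, e2}" using PQ v by auto
    have gN: "v \<notin> ends G (g p)" if "p \<in> P" for p using gp[of v p] that mP(1)[OF that] False by blast
    have "v \<in> {a1, a2} \<or> v \<in> {b1, b2}" using False X v by blast
    then show ?thesis
    proof
      assume va: "v \<in> {a1, a2}"
      have "v \<notin> ends G e2" using va en inA inB dj by auto
      moreover have "v \<in> ends G e1" using va en by simp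
      ultimately show ?thesis using gN X(3) by (intro ex1I[of _ e1]) (auto simp: M_def)
    next
      assume vb: "v \<in> {b1, b2}"
      have "v \<notin> ends G e1" using vb en inA inB dj by auto
      moreover have "v \<in> ends G e2" using vb en by simp
      ultimately show ?thesis using gN X(3) by (intro ex1I[of _ e2]) (auto simp: M_def)
    qed
  qed
  have "M \<subseteq> edges K" using g PQ by (auto simp: M_def)
  then have "perfect_matching K M" using un K by (simp add: perfect_matching_def)
  moreover have "?c \<longrightarrow> f \<in> M"
  proof
    assume c: ?c
    then have "g u = f" by (simp add: g_def)
    then show "f \<in> M" using c by (auto simp: M_def)
  qed
  ultimately show ?thesis by (auto simp: M_def)
qed

text \<open>The first conjunct stands for the admissibility of the special edges, which are not part
  of the relation.\<close>

definition all_admissible :: "('v \<times> 'v) set \<Rightarrow> bool" where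
  "all_admissible F \<longleftrightarrow> (\<exists>m. matches F (A - {a1, a2}) (B - {b1, b2}) m) \<and> (\<forall>u v. (u, v) \<in> F \<longrightarrow> admissible_pair A B a1 a2 b1 b2 F u v)"

lemma matches_card: "matches F P Q m \<Longrightarrow> card P = card Q"
  using bij_betw_same_card by (auto simp: matches_def)

lemma card_removed: "card (A - {a1, a2}) + 2 = card A" "card (B - {b1, b2}) + 2 = card B"
proof -
  have "card {a1, a2} \<le> card A" "card {b1, b2} \<le> card B" using inA inB fin by (auto intro: card_mono)
  then show "card (A - {a1, a2}) + 2 = card A" "card (B - {b1, b2}) + 2 = card B"
    using inA inB fin distinct_ends by (simp_all add: card_Diff_subset)
qed

lemma cross_pairs_mono: "F \<subseteq> F' \<Longrightarrow> cross_pairs F \<subseteq> cross_pairs F'" by (auto simp: cross_pairs_def)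

lemma matches_sub: "matches F P Q m \<Longrightarrow> F \<subseteq> F' \<Longrightarrow> matches F' P Q m" by (auto simp: matches_def)

text \<open>Using exactly one special edge would leave classes of different sizes to be matched with
  each other.\<close>

lemma pm_cases:
  assumes cAB: "card A = card B" and K: "edges K \<subseteq> edges G" "ends K = ends G" "verts K = A \<union> B"
    and M: "perfect_matching K M"
  obtains (none) m where "e1 \<notin> M" "e2 \<notin> M" "matches (cross_pairs (edges K)) A B m"
      "\<And>p q e. p \<in> A \<Longrightarrow> q \<in> B \<Longrightarrow> e \<in> M \<Longrightarrow> ends G e = {p, q} \<Longrightarrow> m p = q"
  | (both) m where "e1 \<in> M" "e2 \<in> M" "matches (cross_pairs (edges K)) (A - {a1, a2}) (B - {b1, b2}) m"
      "\<And>p q e. p \<in> A \<Longrightarrow> q \<in> B \<Longrightarrow> e \<in> M \<Longrightarrow> ends G e = {p, q} \<Longrightarrow> m p = q"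
proof -
  have ends: "ends G e \<subseteq> A \<union> B" if "e \<in> edges K" for e using that K(1) wf V unfolding wf_graph_def by blast
  obtain m where m: "matches (cross_pairs M) (A - (if e1 \<in> M then {a1, a2} else {})) (B - (if e2 \<in> M then {b1, b2} else {})) m"
    and me: "\<And>p q e. p \<in> A \<Longrightarrow> q \<in> B \<Longrightarrow> e \<in> M \<Longrightarrow> ends G e = {p, q} \<Longrightarrow> m p = q"
    using pm_matches[OF M K order_refl order_refl ends] by blast
  have "M \<subseteq> edges K" using M by (simp add: perfect_matching_def)
  then have m': "matches (cross_pairs (edges K)) (A - (if e1 \<in> M then {a1, a2} else {})) (B - (if e2 \<in> M then {b1, b2} else {})) m"
    using matches_sub[OF m cross_pairs_mono] by blast
  have c: "card (A - (if e1 \<in> M then {a1, a2} else {})) = card (B - (if e2 \<in> M then {b1, b2} else {}))"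
    using matches_card[OF m] .
  show thesis
  proof (cases "e1 \<in> M"; cases "e2 \<in> M")
    assume "e1 \<in> M" "e2 \<in> M" then show thesis using both m' me by simp
  next
    assume "e1 \<notin> M" "e2 \<notin> M" then show thesis using none m' me by simp
  next
    assume "e1 \<in> M" "e2 \<notin> M" then show thesis using c card_removed cAB by simp
  next
    assume "e1 \<notin> M" "e2 \<in> M" then show thesis using c card_removed cAB by simp
  qed
qed

lemma admissible_iff_all_admissible:
  assumes cAB: "card A = card B" and K: "edges K \<subseteq> edges G" "ends K = ends G" "verts K = A \<union> B"
    and e: "e1 \<in> edges K" "e2 \<in> edges K"
  shows "(\<forall>e\<in>edges K. admissible K e) \<longleftrightarrow> all_admissible (cross_pairs (edges K))"
proof
  assume ad: "\<forall>e\<in>edges K. admissible K e"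
  have "\<exists>m. matches (cross_pairs (edges K)) (A - {a1, a2}) (B - {b1, b2}) m"
  proof -
    obtain M where M: "perfect_matching K M" "e1 \<in> M" using ad e unfolding admissible_def by blast
    show ?thesis by (rule pm_cases[OF cAB K M(1)]) (use M(2) in blast)+
  qed
  moreover have "admissible_pair A B a1 a2 b1 b2 (cross_pairs (edges K)) u v" if uv: "(u, v) \<in> cross_pairs (edges K)" for u v
  proof -
    obtain f where f: "f \<in> edges K" "ends G f = {u, v}" "u \<in> A" "v \<in> B" using uv by (auto simp: cross_pairs_def)
    obtain M where M: "perfect_matching K M" "f \<in> M" using ad f unfolding admissible_def by blast
    show ?thesis
    proof (rule pm_cases[OF cAB K M(1)])
      fix m assume m: "matches (cross_pairs (edges K)) A B m"
        "\<And>p q e. p \<in> A \<Longrightarrow> q \<in> B \<Longrightarrow> e \<in> M \<Longrightarrow> ends G e = {p, q} \<Longrightarrow> m p = q"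
      have "m u = v" using m(2) f M by blast
      then show ?thesis unfolding admissible_pair_def using m(1) by blast
    next
      fix m assume m: "e1 \<in> M" "matches (cross_pairs (edges K)) (A - {a1, a2}) (B - {b1, b2}) m"
        "\<And>p q e. p \<in> A \<Longrightarrow> q \<in> B \<Longrightarrow> e \<in> M \<Longrightarrow> ends G e = {p, q} \<Longrightarrow> m p = q"
      have mu: "m u = v" using m(3) f M by blast
      have "u \<notin> {a1, a2}"
      proof
        assume u: "u \<in> {a1, a2}"
        have "\<exists>!e. e \<in> M \<and> u \<in> ends G e" using M(1) K f(3) by (simp add: perfect_matching_def)
        then have "f = e1" using u m(1) M(2) f(2) en by auto
        then show False using f en inA dj by auto
      qed
      then show ?thesis unfolding admissible_pair_def using m(2) mu by blast
    qed
  qed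
  ultimately show "all_admissible (cross_pairs (edges K))" by (simp add: all_admissible_def)
next
  assume g: "all_admissible (cross_pairs (edges K))"
  show "\<forall>e\<in>edges K. admissible K e"
  proof
    fix f assume f: "f \<in> edges K"
    show "admissible K f"
    proof (cases "f = e1 \<or> f = e2")
      case True
      obtain m where m: "matches (cross_pairs (edges K)) (A - {a1, a2}) (B - {b1, b2}) m" using g by (auto simp: all_admissible_def)
      obtain M where "perfect_matching K M" "{e1, e2} \<subseteq> M" using matches_pm[OF K m, of "{e1, e2}"] e by blast
      then show ?thesis using True unfolding admissible_def by blast
    next
      case False
      then obtain u v where uv: "u \<in> A" "v \<in> B" "ends G f = {u, v}" using cross f K by blast
      then have "(u, v) \<in> cross_pairs (edges K)" using f by (auto simp: cross_pairs_def)
      then have "admissible_pair A B a1 a2 b1 b2 (cross_pairs (edges K)) u v" using g by (auto simp: all_admissible_def)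
      then show ?thesis unfolding admissible_pair_def
      proof (elim disjE exE conjE)
        fix m assume m: "matches (cross_pairs (edges K)) A B m" "m u = v"
        obtain M where "perfect_matching K M" "u \<in> A \<and> f \<in> edges K \<and> ends G f = {u, m u} \<longrightarrow> f \<in> M"
          using matches_pm[OF K m(1), of "{}" u f] by blast
        then show ?thesis using uv f m(2) unfolding admissible_def by blast
      next
        fix m assume m: "matches (cross_pairs (edges K)) (A - {a1, a2}) (B - {b1, b2}) m" "u \<notin> {a1, a2}" "m u = v"
        obtain M where "perfect_matching K M" "u \<in> A - {a1, a2} \<and> f \<in> edges K \<and> ends G f = {u, m u} \<longrightarrow> f \<in> M"
          using matches_pm[OF K m(1), of "{e1, e2}" u f] e by blast
        then show ?thesis using uv f m(2,3) unfolding admissible_def by blast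
      qed
    qed
  qed
qed

end

section \<open>From near-bipartite bricks to the Hall bounds\<close>

lemma connected_crossing:
  assumes "connected_graph K" "x \<in> Z" "y \<notin> Z" "x \<in> verts K" "y \<in> verts K"
  obtains u v e where "u \<in> Z" "v \<notin> Z" "e \<in> edges K" "ends K e = {u, v}"
proof -
  have "(x, y) \<in> {(x, y). adjacent K x y}\<^sup>*" using assms by (simp add: connected_graph_def)
  then have "y \<notin> Z \<longrightarrow> (\<exists>u v. u \<in> Z \<and> v \<notin> Z \<and> adjacent K u v)"
    by (induction rule: rtrancl_induct) (use assms(2) in auto)
  then show thesis using that assms(3) unfolding adjacent_def by blast
qed

lemma adjacent_sym: "adjacent G u v \<longleftrightarrow> adjacent G v u"
  by (simp add: adjacent_def insert_commute)

text \<open>If \<open>e\<close> joins \<open>p\<close> and \<open>q\<close>, then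
  \<open>G - p\<close> is connected and does not contain \<open>e\<close>. Connectivity of
  \<open>G - q\<close> provides an edge from \<open>p\<close> to a vertex other than
  \<open>q\<close>, which attaches \<open>p\<close> to the rest.\<close>

lemma three_connected_delete_edge:
  assumes wf: "wf_graph G" and tc: "three_connected G" and e: "e \<in> edges G"
  shows "connected_graph (delete_edges G {e})"
proof -
  let ?K = "delete_edges G {e}"
  let ?R = "{(x, y). adjacent ?K x y}"
  have "card (ends G e) = 2" "ends G e \<subseteq> verts G" using wf e unfolding wf_graph_def by blast+
  then obtain p q where pq: "ends G e = {p, q}" "p \<noteq> q" "p \<in> verts G" "q \<in> verts G" by (auto simp: card_2_iff)
  have c: "connected_graph (delete_verts G S)" if "S \<subseteq> verts G" "card S \<le> 2" for S
    using tc that by (simp add: three_connected_def)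
  have c4: "4 \<le> card (verts G)" using tc by (simp add: three_connected_def)
  have cp: "connected_graph (delete_verts G {p})" "connected_graph (delete_verts G {q})" using c pq by simp_all
  have adj: "adjacent ?K x y" if "adjacent (delete_verts G {p}) x y" for x y
    using that pq unfolding adjacent_def delete_verts_def delete_edges_def by auto
  then have sub: "{(x, y). adjacent (delete_verts G {p}) x y} \<subseteq> ?R" by blast
  have rest: "(x, y) \<in> ?R\<^sup>*" if "x \<in> verts G" "y \<in> verts G" "x \<noteq> p" "y \<noteq> p" for x y
  proof -
    have "(x, y) \<in> {(x, y). adjacent (delete_verts G {p}) x y}\<^sup>*"
      using cp(1) that by (simp add: connected_graph_def delete_verts_def)
    then show ?thesis using rtrancl_mono[OF sub] by blast
  qed
  have "\<not> verts G \<subseteq> {p, q}"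
  proof
    assume "verts G \<subseteq> {p, q}"
    then have "card (verts G) \<le> card {p, q}" by (intro card_mono) simp_all
    then show False using c4 pq(2) by simp
  qed
  then obtain r where r: "r \<in> verts G" "r \<noteq> p" "r \<noteq> q" by blast
  obtain u y f where f: "u \<in> {p}" "y \<notin> {p}" "f \<in> edges (delete_verts G {q})" "ends (delete_verts G {q}) f = {u, y}"
    using connected_crossing[OF cp(2), of p "{p}" r] r pq by (auto simp: delete_verts_def)
  have f': "f \<in> edges G" "ends G f = {p, y}" "y \<noteq> q" using f by (auto simp: delete_verts_def)
  then have fe: "f \<noteq> e" using pq by (auto simp: doubleton_eq_iff)
  have yG: "y \<in> verts G" using f' wf unfolding wf_graph_def by blast
  have "adjacent ?K p y" unfolding adjacent_def delete_edges_def using f' fe by auto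
  then have py: "(p, y) \<in> ?R" "(y, p) \<in> ?R" using adjacent_sym[of ?K p y] by simp_all
  have yp: "y \<noteq> p" using f by simp
  have top: "(x, p) \<in> ?R\<^sup>*" if "x \<in> verts G" for x
  proof (cases "x = p")
    case False
    then have "(x, y) \<in> ?R\<^sup>*" using rest that yG yp by blast
    then show ?thesis using py(2) by (rule rtrancl_into_rtrancl)
  qed simp
  have fromp: "(p, x) \<in> ?R\<^sup>*" if "x \<in> verts G" for x
  proof (cases "x = p")
    case False
    then have "(y, x) \<in> ?R\<^sup>*" using rest that yG yp by blast
    then show ?thesis by (rule converse_rtrancl_into_rtrancl[OF py(1)])
  qed simp
  show ?thesis unfolding connected_graph_def
  proof (intro ballI)
    fix x y assume "x \<in> verts ?K" "y \<in> verts ?K"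
    then have "x \<in> verts G" "y \<in> verts G" by (simp_all add: delete_edges_def)
    then show "(x, y) \<in> ?R\<^sup>*" using top fromp rtrancl_trans by metis
  qed
qed

context bip_pair begin

lemma dual_pair: "bip_pair G B A b1 b2 a1 a2 e2 e1"
proof unfold_locales
  show "\<exists>p\<in>B. \<exists>q\<in>A. ends G e = {p, q}" if "e \<in> edges G" "e \<noteq> e2" "e \<noteq> e1" for e
    using cross[OF that(1,3,2)] by (metis insert_commute)
qed (use wf dj V e12 en inA inB in auto)

lemma cross_pairs_dual: "bip_pair.cross_pairs G B A F = (cross_pairs F)\<inverse>"
  unfolding cross_pairs_def bip_pair.cross_pairs_def[OF dual_pair] by (auto simp: insert_commute)

text \<open>Take \<open>x\<close>, \<open>y\<close> in \<open>A - S\<close>. In a perfect matching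
  of \<open>G - x - y\<close> the class \<open>A\<close> is short of two vertices, so counting
  forces \<open>e2\<close> to be used and \<open>e1\<close> not. The matching then sends
  \<open>S\<close> into \<open>B - {b1, b2}\<close>.\<close>

lemma bicritical_hall:
  assumes cAB: "card A = card B" and br: "brick G" and S: "S \<subseteq> A" "card S + 2 \<le> card A"
  shows "card S \<le> card (cross_pairs (edges G) `` S - {b1, b2})"
proof -
  have "card (A - S) = card A - card S" using card_Diff_subset[OF finite_subset[OF S(1) fin(1)] S(1)] .
  then have "2 \<le> card (A - S)" using S by simp
  then obtain Y where "Y \<subseteq> A - S" "card Y = 2" by (meson obtain_subset_with_card_n)
  then obtain x y where xy: "x \<in> A - S" "y \<in> A - S" "x \<noteq> y" by (auto simp: card_2_iff)
  let ?K = "delete_verts G {x, y}"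
  have "x \<in> verts G" "y \<in> verts G" using xy V by blast+
  then obtain M where M: "perfect_matching ?K M" using br xy(3) by (auto simp: brick_def)
  let ?P = "A - {x, y}"
  have K: "edges ?K \<subseteq> edges G" "ends ?K = ends G" "verts ?K = ?P \<union> B" "?P \<subseteq> A" "B \<subseteq> B"
    using V xy dj by (auto simp: delete_verts_def)
  have en': "ends G e \<subseteq> ?P \<union> B" if "e \<in> edges ?K" for e
  proof -
    have "e \<in> edges G" "ends G e \<inter> {x, y} = {}" using that by (simp_all add: delete_verts_def)
    moreover from this(1) have "ends G e \<subseteq> A \<union> B" using wf V unfolding wf_graph_def by blast
    ultimately show ?thesis by blast
  qed
  obtain m where m: "matches (cross_pairs M) (?P - (if e1 \<in> M then {a1, a2} else {})) (B - (if e2 \<in> M then {b1, b2} else {})) m"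
    by (rule pm_matches[OF M K en'], assumption, rule that, assumption)
  have cP: "card ?P + 2 = card A"
  proof -
    have "{x, y} \<subseteq> A" using xy by blast
    then have "card {x, y} \<le> card A" "card ?P = card A - card {x, y}" using fin by (simp_all add: card_mono card_Diff_subset)
    then show ?thesis using xy(3) by simp
  qed
  have e1P: "{a1, a2} \<subseteq> ?P" if "e1 \<in> M"
  proof -
    have "e1 \<in> edges ?K" using that M by (auto simp: perfect_matching_def)
    then show ?thesis using en inA by (auto simp: delete_verts_def)
  qed
  have c1: "card (?P - {a1, a2}) + 2 = card ?P" if "e1 \<in> M"
  proof -
    have "card {a1, a2} \<le> card ?P" using e1P[OF that] fin by (intro card_mono) simp_all
    then show ?thesis using e1P[OF that] fin distinct_ends by (simp add: card_Diff_subset)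
  qed
  have cm: "card (?P - (if e1 \<in> M then {a1, a2} else {})) = card (B - (if e2 \<in> M then {b1, b2} else {}))"
    using matches_card[OF m] .
  have fl: "e1 \<notin> M" "e2 \<in> M"
    using cm cP c1 card_removed cAB by (auto split: if_splits)
  then have m': "matches (cross_pairs M) ?P (B - {b1, b2}) m" using m by simp
  have SP: "S \<subseteq> ?P" using S xy by blast
  have "card S \<le> card (cross_pairs M `` S \<inter> (B - {b1, b2}))" by (rule matches_imp_hall[OF m' _ SP]) (simp add: fin)
  also have "\<dots> \<le> card (cross_pairs (edges G) `` S - {b1, b2})"
  proof (rule card_mono)
    show "finite (cross_pairs (edges G) `` S - {b1, b2})"
      using cross_pairs_sub[of "edges G"] fin finite_subset[of "cross_pairs (edges G) `` S" B] by blast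
    have "M \<subseteq> edges G" using M K by (auto simp: perfect_matching_def)
    then show "cross_pairs M `` S \<inter> (B - {b1, b2}) \<subseteq> cross_pairs (edges G) `` S - {b1, b2}" using cross_pairs_mono by blast
  qed
  finally show ?thesis .
qed

lemma cross_pairs_delete12: "cross_pairs (edges G - {e1, e2}) = cross_pairs (edges G)"
proof -
  have "e \<noteq> e1 \<and> e \<noteq> e2" if "p \<in> A" "q \<in> B" "ends G e = {p, q}" for p q e
    using that en inA inB dj by auto
  then show ?thesis unfolding cross_pairs_def by blast
qed

text \<open>By connectedness some edge leaves the set formed by \<open>S\<close> and its neighbours,
  and it can only run from a neighbour \<open>q\<close> of \<open>S\<close> to a vertex of
  \<open>A - S\<close>. A perfect matching through this edge sends \<open>S\<close> into the
  neighbours other than \<open>q\<close>.\<close>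

lemma covered_hall:
  assumes cAB: "card A = card B" and mc: "matching_covered (delete_edges G {e1, e2})"
    and S: "S \<subseteq> A" "S \<noteq> {}" "S \<noteq> A"
  shows "card S + 1 \<le> card (cross_pairs (edges G) `` S)"
proof -
  let ?K = "delete_edges G {e1, e2}" and ?N = "cross_pairs (edges G) `` S"
  have K: "edges ?K \<subseteq> edges G" "ends ?K = ends G" "verts ?K = A \<union> B" using V by (auto simp: delete_edges_def)
  obtain s t where st: "s \<in> S" "t \<in> A - S" using S by blast
  have NB: "?N \<subseteq> B" using cross_pairs_sub by blast
  have finN: "finite ?N" using NB fin finite_subset by blast
  have "connected_graph ?K" using mc by (simp add: matching_covered_def)
  then obtain u v f where f: "u \<in> S \<union> ?N" "v \<notin> S \<union> ?N" "f \<in> edges ?K" "ends ?K f = {u, v}"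
    by (rule connected_crossing[of ?K s "S \<union> ?N" t]) (use st S K NB dj in blast)+
  have f': "f \<in> edges G" "f \<noteq> e1" "f \<noteq> e2" "ends G f = {u, v}" using f by (auto simp: delete_edges_def)
  obtain p q where pq: "p \<in> A" "q \<in> B" "ends G f = {p, q}" using cross f' by blast
  have pS: "p \<notin> S"
  proof
    assume "p \<in> S"
    then have "q \<in> ?N" using pq f' by (auto simp: cross_pairs_def)
    then show False using f(1,2) f'(4) pq \<open>p \<in> S\<close> by (auto simp: doubleton_eq_iff)
  qed
  have qN: "q \<in> ?N" using f(1,2) f'(4) pq pS NB S dj by (auto simp: doubleton_eq_iff)
  obtain M where M: "perfect_matching ?K M" "f \<in> M" using mc f(3) by (auto simp: matching_covered_def admissible_def)
  have "\<exists>m. matches (cross_pairs (edges ?K)) A B m \<and> m p = q"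
  proof (rule pm_cases[OF cAB K M(1)])
    fix m assume "matches (cross_pairs (edges ?K)) A B m"
      "\<And>p q e. p \<in> A \<Longrightarrow> q \<in> B \<Longrightarrow> e \<in> M \<Longrightarrow> ends G e = {p, q} \<Longrightarrow> m p = q"
    then show ?thesis using pq M(2) by blast
  next
    assume "e1 \<in> M"
    then show ?thesis using M(1) by (auto simp: perfect_matching_def delete_edges_def)
  qed
  moreover have "edges ?K = edges G - {e1, e2}" by (simp add: delete_edges_def)
  ultimately obtain m where m: "matches (cross_pairs (edges G)) A B m" "m p = q" using cross_pairs_delete12 by auto
  have "m ` S \<subseteq> ?N - {q}"
  proof
    fix x assume "x \<in> m ` S"
    then obtain z where z: "z \<in> S" "x = m z" by blast
    then have "z \<in> A" using S by blast
    then have "x \<in> ?N" using z matches_edge[OF m(1)] by blast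
    moreover have "x \<noteq> q" using matches_inj[OF m(1) \<open>z \<in> A\<close> pq(1)] m(2) z pS by auto
    ultimately show "x \<in> ?N - {q}" by blast
  qed
  then have "card (m ` S) + 1 \<le> card ?N" using card_sub1[OF finN _ qN] by blast
  moreover have "card (m ` S) = card S"
    using m(1) S by (intro card_image) (auto simp: matches_def bij_betw_def intro: inj_on_subset)
  ultimately show ?thesis by simp
qed

lemma core_of_brick:
  assumes cAB: "card A = card B" and br: "brick G" and mc: "matching_covered (delete_edges G {e1, e2})" and big: "3 \<le> card A"
  shows "core A B (cross_pairs (edges G)) a1 a2 b1 b2"
proof unfold_locales
  show "card T \<le> card ((cross_pairs (edges G))\<inverse> `` T - {a1, a2})" if "T \<subseteq> B" "card T + 2 \<le> card B" for T
    using bip_pair.bicritical_hall[OF dual_pair cAB[symmetric] br that] unfolding cross_pairs_dual .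
qed (fact fin cAB big cross_pairs_sub inA inB distinct_ends covered_hall[OF cAB mc] bicritical_hall[OF cAB br])+

end

lemma cross_from_card:
  assumes "card (X \<inter> A) = 1" "card (X \<inter> B) = 1" "X \<subseteq> A \<union> B"
  shows "\<exists>p\<in>A. \<exists>q\<in>B. X = {p, q}"
proof -
  obtain p where "X \<inter> A = {p}" using assms(1) card_1_singletonE by blast
  moreover obtain q where "X \<inter> B = {q}" using assms(2) card_1_singletonE by blast
  ultimately have "p \<in> A" "q \<in> B" "X = {p, q}" using assms(3) by blast+
  then show ?thesis by blast
qed

lemma pm_card_sum:
  assumes M: "perfect_matching K M" and fin: "finite M" and S: "S \<subseteq> verts K" "finite S"
  shows "card S = (\<Sum>e\<in>M. card (ends K e \<inter> S))"
proof -
  have ex: "\<exists>!e. e \<in> M \<and> v \<in> ends K e" if "v \<in> S" for v using M S(1) that unfolding perfect_matching_def by blast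
  have "S = (\<Union>e\<in>M. ends K e \<inter> S)" using ex by blast
  then have "card S = card (\<Union>e\<in>M. ends K e \<inter> S)" by simp
  also have "\<dots> = (\<Sum>e\<in>M. card (ends K e \<inter> S))"
    by (rule card_UN_disjoint) (use fin S ex in blast)+
  finally show ?thesis .
qed

text \<open>One of the two deleted edges must lie inside \<open>A\<close> and the other inside
  \<open>B\<close>. They do not both cross, as \<open>G\<close> is not bipartite; and an edge inside
  one class lies in a perfect matching, where equal class sizes force the other deleted edge to make
  up for it.\<close>

lemma near_bipartite_pair:
  assumes nb: "near_bipartite G"
  obtains A B a1 a2 b1 b2 e1 e2 where "bip_pair G A B a1 a2 b1 b2 e1 e2" "card A = card B"
    "matching_covered (delete_edges G {e1, e2})"
proof -
  note conclude = that
  obtain f1 f2 where f: "f1 \<in> edges G" "f2 \<in> edges G" "f1 \<noteq> f2" "bipartite (delete_edges G {f1, f2})"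
    "matching_covered (delete_edges G {f1, f2})" using nb by (auto simp: near_bipartite_def)
  let ?H = "delete_edges G {f1, f2}"
  have mc: "matching_covered G" and nbip: "\<not> bipartite G" using nb by (auto simp: near_bipartite_def)
  have wf: "wf_graph G" using mc by (simp add: matching_covered_def)
  have finE: "finite (edges G)" and finV: "finite (verts G)" using wf by (auto simp: wf_graph_def)
  obtain A B where AB: "A \<inter> B = {}" "A \<union> B = verts G"
    and cr: "\<And>e. e \<in> edges G \<Longrightarrow> e \<noteq> f1 \<Longrightarrow> e \<noteq> f2 \<Longrightarrow> card (ends G e \<inter> A) = 1 \<and> card (ends G e \<inter> B) = 1"
    using f(4) by (auto simp: bipartite_def delete_edges_def)
  have finAB: "finite A" "finite B" using AB finV by (metis finite_Un)+
  have sum2: "card (ends G e \<inter> A) + card (ends G e \<inter> B) = 2" if "e \<in> edges G" for e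
  proof -
    have "ends G e \<subseteq> A \<union> B" "card (ends G e) = 2" using wf that AB by (auto simp: wf_graph_def)
    moreover then have "ends G e = (ends G e \<inter> A) \<union> (ends G e \<inter> B)" by blast
    moreover have "card ((ends G e \<inter> A) \<union> (ends G e \<inter> B)) = card (ends G e \<inter> A) + card (ends G e \<inter> B)"
      using finAB AB by (intro card_Un_disjoint) auto
    ultimately show ?thesis by simp
  qed
  have sums: "card A = (\<Sum>e\<in>M. card (ends G e \<inter> A)) \<and> card B = (\<Sum>e\<in>M. card (ends G e \<inter> B))"
    if "perfect_matching K M" "verts K = verts G" "ends K = ends G" "edges K \<subseteq> edges G" for K M
  proof -
    have "M \<subseteq> edges G" using that by (auto simp: perfect_matching_def)
    then have "finite M" by (rule finite_subset[OF _ finE])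
    then show ?thesis using pm_card_sum[OF that(1), of A] pm_card_sum[OF that(1), of B] that AB finAB by auto
  qed
  have K: "verts ?H = verts G" "ends ?H = ends G" "edges ?H = edges G - {f1, f2}" by (simp_all add: delete_edges_def)
  have cAB: "card A = card B"
  proof -
    have "2 \<le> card (verts ?H)" using f(5) by (simp add: matching_covered_def)
    then obtain Y where "Y \<subseteq> verts ?H" "card Y = 2" by (meson obtain_subset_with_card_n)
    then obtain x y where xy: "x \<in> verts ?H" "y \<in> verts ?H" "x \<noteq> y" by (auto simp: card_2_iff)
    have "connected_graph ?H" using f(5) by (simp add: matching_covered_def)
    then obtain u v e where e: "e \<in> edges ?H" by (rule connected_crossing[of ?H x "{x}" y]) (use xy in simp_all)
    then obtain M where M: "perfect_matching ?H M" using f(5) by (auto simp: matching_covered_def admissible_def)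
    have "M \<subseteq> edges G - {f1, f2}" using M K by (auto simp: perfect_matching_def)
    have "(\<Sum>e\<in>M. card (ends G e \<inter> A)) = (\<Sum>e\<in>M. card (ends G e \<inter> B))"
    proof (rule sum.cong[OF refl])
      fix e assume "e \<in> M"
      then have "e \<in> edges G" "e \<noteq> f1" "e \<noteq> f2" using \<open>M \<subseteq> edges G - {f1, f2}\<close> by blast+
      then show "card (ends G e \<inter> A) = card (ends G e \<inter> B)" using cr[of e] by simp
    qed
    then show ?thesis using sums[OF M K(1,2)] K(3) by auto
  qed
  \<comment> \<open>All other edges meet both classes exactly once, so the two deleted edges must
    balance among themselves.\<close>
  have bal: "(\<Sum>e\<in>M \<inter> {f1, f2}. card (ends G e \<inter> A)) = (\<Sum>e\<in>M \<inter> {f1, f2}. card (ends G e \<inter> B))"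
    if M: "perfect_matching G M" for M
  proof -
    have ME: "M \<subseteq> edges G" using M by (simp add: perfect_matching_def)
    then have fM: "finite M" using finE finite_subset by blast
    have "(\<Sum>e\<in>M - {f1, f2}. card (ends G e \<inter> A)) = (\<Sum>e\<in>M - {f1, f2}. card (ends G e \<inter> B))"
    proof (rule sum.cong[OF refl])
      fix e assume "e \<in> M - {f1, f2}"
      then have "e \<in> edges G" "e \<noteq> f1" "e \<noteq> f2" using ME by blast+
      then show "card (ends G e \<inter> A) = card (ends G e \<inter> B)" using cr[of e] by simp
    qed
    moreover have "(\<Sum>e\<in>M. card (ends G e \<inter> X)) = (\<Sum>e\<in>M \<inter> {f1, f2}. card (ends G e \<inter> X)) + (\<Sum>e\<in>M - {f1, f2}. card (ends G e \<inter> X))" for X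
      by (rule sum.Int_Diff[OF fM])
    ultimately show ?thesis using sums[OF M] cAB by auto
  qed
  have pmex: "\<exists>M. perfect_matching G M \<and> e \<in> M" if "e \<in> edges G" for e
    using mc that by (auto simp: matching_covered_def admissible_def)
  obtain M1 where M1: "perfect_matching G M1" "f1 \<in> M1" using pmex f by blast
  obtain M2 where M2: "perfect_matching G M2" "f2 \<in> M2" using pmex f by blast
  have i1: "M1 \<inter> {f1, f2} = (if f2 \<in> M1 then {f1, f2} else {f1})" using M1 by auto
  have i2: "M2 \<inter> {f1, f2} = (if f1 \<in> M2 then {f1, f2} else {f2})" using M2 by auto
  have s1: "card (ends G f1 \<inter> A) + card (ends G f1 \<inter> B) = 2" "card (ends G f2 \<inter> A) + card (ends G f2 \<inter> B) = 2"
    using sum2 f by blast+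
  have n0: "\<not> (card (ends G f1 \<inter> A) = 1 \<and> card (ends G f2 \<inter> A) = 1)"
  proof
    assume h: "card (ends G f1 \<inter> A) = 1 \<and> card (ends G f2 \<inter> A) = 1"
    have "card (ends G e \<inter> A) = 1 \<and> card (ends G e \<inter> B) = 1" if "e \<in> edges G" for e
      using cr[OF that] h s1 by (cases "e = f1"; cases "e = f2") auto
    then have "bipartite G" unfolding bipartite_def using AB by blast
    then show False using nbip by blast
  qed
  have b1: "card (ends G f1 \<inter> A) + (if f2 \<in> M1 then card (ends G f2 \<inter> A) else 0) =
      card (ends G f1 \<inter> B) + (if f2 \<in> M1 then card (ends G f2 \<inter> B) else 0)"
    using bal[OF M1(1)] f(3) unfolding i1 by (simp split: if_splits)
  have b2: "card (ends G f2 \<inter> A) + (if f1 \<in> M2 then card (ends G f1 \<inter> A) else 0) =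
      card (ends G f2 \<inter> B) + (if f1 \<in> M2 then card (ends G f1 \<inter> B) else 0)"
    using bal[OF M2(1)] f(3) unfolding i2 by (simp split: if_splits)
  have alt: "card (ends G f1 \<inter> A) = 2 \<and> card (ends G f2 \<inter> B) = 2 \<or> card (ends G f1 \<inter> B) = 2 \<and> card (ends G f2 \<inter> A) = 2"
    using s1 n0 b1 b2 by (auto split: if_splits)
  have mk: thesis if h: "e1 \<in> edges G" "e2 \<in> edges G" "{e1, e2} = {f1, f2}" "card (ends G e1 \<inter> A) = 2" "card (ends G e2 \<inter> B) = 2"
    for e1 e2
  proof -
    have sub: "ends G e1 \<subseteq> A" "ends G e2 \<subseteq> B" and c2: "card (ends G e1) = 2" "card (ends G e2) = 2"
    proof -
      have w: "ends G e \<subseteq> A \<union> B" "card (ends G e) = 2" "finite (ends G e)" if "e \<in> edges G" for e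
        using wf that AB finV unfolding wf_graph_def by (auto intro: finite_subset[of _ "verts G"])
      show "card (ends G e1) = 2" "card (ends G e2) = 2" using w h by blast+
      have "ends G e1 \<inter> A = ends G e1" using w[OF h(1)] h(4) by (intro card_subset_eq) auto
      then show "ends G e1 \<subseteq> A" by blast
      have "ends G e2 \<inter> B = ends G e2" using w[OF h(2)] h(5) by (intro card_subset_eq) auto
      then show "ends G e2 \<subseteq> B" by blast
    qed
    obtain a1 a2 where a: "ends G e1 = {a1, a2}" using c2(1) by (auto simp: card_2_iff)
    obtain b1 b2 where b: "ends G e2 = {b1, b2}" using c2(2) by (auto simp: card_2_iff)
    have "bip_pair G A B a1 a2 b1 b2 e1 e2"
    proof unfold_locales
      fix e assume e: "e \<in> edges G" "e \<noteq> e1" "e \<noteq> e2"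
      then have "e \<noteq> f1" "e \<noteq> f2" using h(3) by blast+
      then show "\<exists>p\<in>A. \<exists>q\<in>B. ends G e = {p, q}"
        using cr[OF e(1)] wf e(1) AB by (intro cross_from_card) (auto simp: wf_graph_def)
    qed (use wf AB h a b sub in auto)
    moreover have "matching_covered (delete_edges G {e1, e2})" unfolding h(3) by (rule f(5))
    ultimately show thesis using conclude cAB by blast
  qed
  from alt show thesis
  proof
    assume "card (ends G f1 \<inter> A) = 2 \<and> card (ends G f2 \<inter> B) = 2"
    then show thesis using mk[of f1 f2] f by simp
  next
    assume "card (ends G f1 \<inter> B) = 2 \<and> card (ends G f2 \<inter> A) = 2"
    then show thesis using mk[of f2 f1] f by (simp add: insert_commute)
  qed
qed

section \<open>Removable edges in terms of the relation\<close>

locale bip_core = bip_pair G A B a1 a2 b1 b2 e1 e2 + core A B "bip_pair.cross_pairs G A B (edges G)" a1 a2 b1 b2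
  for G :: "('v, 'e) mgraph" and A B a1 a2 b1 b2 e1 e2
begin

abbreviation E :: "('v \<times> 'v) set" where "E \<equiv> cross_pairs (edges G)"

lemma removable_iff_all_admissible:
  assumes br: "brick G" and e: "e \<in> edges G" "e \<noteq> e1" "e \<noteq> e2"
  shows "removable G e \<longleftrightarrow> all_admissible (cross_pairs (edges G - {e}))"
proof -
  let ?K = "delete_edges G {e}"
  have K: "edges ?K \<subseteq> edges G" "ends ?K = ends G" "verts ?K = A \<union> B" "e1 \<in> edges ?K" "e2 \<in> edges ?K"
    using V e e12 by (auto simp: delete_edges_def)
  have "connected_graph ?K" using three_connected_delete_edge[OF wf _ e(1)] br by (simp add: brick_def)
  moreover have "wf_graph ?K" using wf by (auto simp: wf_graph_def delete_edges_def)
  moreover have "2 \<le> card (verts ?K)"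
    using card_mono[of "A \<union> B" A] fin big K(3) by simp
  ultimately have "removable G e \<longleftrightarrow> (\<forall>f\<in>edges ?K. admissible ?K f)"
    using e by (simp add: removable_def matching_covered_def)
  then show ?thesis using admissible_iff_all_admissible[OF cardAB K] by (simp add: delete_edges_def)
qed

lemma rm_iff_all_admissible: "rm p q \<longleftrightarrow> (p, q) \<in> E \<and> all_admissible (E - {(p, q)})"
  unfolding removable_pair_def all_admissible_def by auto

text \<open>Deleting an edge with a parallel copy leaves the relation unchanged, and
  \<open>G\<close> is matching covered. Deleting an edge without one removes exactly its
  pair.\<close>

lemma removable_cross:
  assumes br: "brick G" and mc: "matching_covered G" and e: "e \<in> edges G" "ends G e = {p, q}" "p \<in> A" "q \<in> B"
  shows "removable G e \<longleftrightarrow> (\<exists>e'\<in>edges G. e' \<noteq> e \<and> ends G e' = {p, q}) \<or> rm p q"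
proof -
  have ne: "e \<noteq> e1" "e \<noteq> e2" using e en inA inB dj by auto
  show ?thesis
  proof (cases "\<exists>e'\<in>edges G. e' \<noteq> e \<and> ends G e' = {p, q}")
    case True
    obtain e' where e': "e' \<in> edges G" "e' \<noteq> e" "ends G e' = ends G e" using True e by auto
    have "cross_pairs (edges G - {e}) = E"
    proof
      show "cross_pairs (edges G - {e}) \<subseteq> E" by (rule cross_pairs_mono) blast
      show "E \<subseteq> cross_pairs (edges G - {e})"
      proof
        fix x assume "x \<in> E"
        then obtain u v f where x: "x = (u, v)" "u \<in> A" "v \<in> B" "f \<in> edges G" "ends G f = {u, v}" by (auto simp: cross_pairs_def)
        have "\<exists>g\<in>edges G - {e}. ends G g = {u, v}"
        proof (cases "f = e")
          case True then show ?thesis using e' x by (intro bexI[of _ e']) auto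
        next
          case False then show ?thesis using x by blast
        qed
        then show "x \<in> cross_pairs (edges G - {e})" using x by (simp add: cross_pairs_def)
      qed
    qed
    moreover have "all_admissible E"
      using admissible_iff_all_admissible[OF cardAB, of G] V e12 mc by (simp add: matching_covered_def)
    ultimately show ?thesis using removable_iff_all_admissible[OF br e(1) ne] True by simp
  next
    case False
    have "cross_pairs (edges G - {e}) = E - {(p, q)}"
    proof (rule set_eqI)
      fix x :: "'v \<times> 'v"
      obtain u v where x: "x = (u, v)" by (cases x)
      show "x \<in> cross_pairs (edges G - {e}) \<longleftrightarrow> x \<in> E - {(p, q)}"
      proof (cases "(u, v) = (p, q)")
        case True
        then show ?thesis using False x by (auto simp: cross_pairs_def)
      next
        case ne: False
        have "ends G e \<noteq> {u, v}" if "u \<in> A" "v \<in> B" using doubleton_cross_eq[OF e(3,4) that] e ne by auto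
        then show ?thesis using x ne by (auto simp: cross_pairs_def)
      qed
    qed
    moreover have "(p, q) \<in> E" using e by (auto simp: cross_pairs_def)
    ultimately have "removable G e \<longleftrightarrow> rm p q" using removable_iff_all_admissible[OF br e(1) ne] rm_iff_all_admissible[of p q] by simp
    then show ?thesis using False by blast
  qed
qed

text \<open>A perfect matching contains both special edges or neither, so after one is deleted the
  other is inadmissible.\<close>

lemma not_removable_12: "\<not> removable G e1" "\<not> removable G e2"
proof -
  have x: False if h: "removable G e" "e \<in> {e1, e2}" "f \<in> {e1, e2}" "f \<noteq> e" for e f
  proof -
    let ?K = "delete_edges G {e}"
    have "f \<in> edges ?K" using h e12 by (auto simp: delete_edges_def)
    moreover have "\<forall>f\<in>edges ?K. admissible ?K f" using h(1) by (simp add: removable_def matching_covered_def)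
    ultimately obtain M where M: "perfect_matching ?K M" "f \<in> M" unfolding admissible_def by blast
    have K: "edges ?K \<subseteq> edges G" "ends ?K = ends G" "verts ?K = A \<union> B" using V by (auto simp: delete_edges_def)
    have eM: "e \<notin> M" using M(1) by (auto simp: perfect_matching_def delete_edges_def)
    show False
      by (rule pm_cases[OF cardAB K M(1)]) (use h M(2) eM in blast)+
  qed
  show "\<not> removable G e1" "\<not> removable G e2" using x[of e1 e2] x[of e2 e1] e1_ne_e2 by blast+
qed

end

section \<open>Isomorphism and tri-ladders\<close>

definition iso_by :: "('v \<Rightarrow> 'w) \<Rightarrow> ('e \<Rightarrow> 'f) \<Rightarrow> ('v, 'e) mgraph \<Rightarrow> ('w, 'f) mgraph \<Rightarrow> bool" where
  "iso_by f g G H \<longleftrightarrow> bij_betw f (verts G) (verts H) \<and> bij_betw g (edges G) (edges H) \<and>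
     (\<forall>e\<in>edges G. ends H (g e) = f ` ends G e)"

lemma graph_iso_by: "graph_iso G H \<longleftrightarrow> (\<exists>f g. iso_by f g G H)"
  by (simp add: graph_iso_def iso_by_def)

lemma iso_pt_by: "iso_pt G a H b \<longleftrightarrow> (\<exists>f g. iso_by f g G H \<and> f a = b)"
  by (auto simp: iso_pt_def iso_by_def)

lemma iso_by_trans: "iso_by f g G H \<Longrightarrow> iso_by f' g' H K \<Longrightarrow> iso_by (f' \<circ> f) (g' \<circ> g) G K"
  by (auto simp: iso_by_def bij_betw_trans image_comp bij_betw_apply)

lemma bij_betw_preimage: assumes "bij_betw g S T" "y \<in> T" obtains x where "x \<in> S" "y = g x"
  using assms by (auto simp: bij_betw_def)

lemma wf_ends: "wf_graph G \<Longrightarrow> e \<in> edges G \<Longrightarrow> ends G e \<subseteq> verts G"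
  by (simp add: wf_graph_def)

lemma iso_by_sym:
  assumes i: "iso_by f g G H" and wf: "wf_graph G"
  shows "iso_by (inv_into (verts G) f) (inv_into (edges G) g) H G"
proof -
  have b: "bij_betw f (verts G) (verts H)" "bij_betw g (edges G) (edges H)"
    and en: "\<And>e. e \<in> edges G \<Longrightarrow> ends H (g e) = f ` ends G e" using i by (auto simp: iso_by_def)
  have "ends G (inv_into (edges G) g e) = inv_into (verts G) f ` ends H e" if e: "e \<in> edges H" for e
  proof -
    let ?e = "inv_into (edges G) g e"
    have e': "?e \<in> edges G" "g ?e = e" using b(2) e by (auto simp: bij_betw_def inv_into_into f_inv_into_f)
    have "ends H e = f ` ends G ?e" using en[OF e'(1)] e'(2) by simp
    moreover have "inv_into (verts G) f ` f ` ends G ?e = ends G ?e"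
      using b(1) wf_ends[OF wf e'(1)] by (simp add: bij_betw_def inv_into_image_cancel)
    ultimately show ?thesis by simp
  qed
  then show ?thesis using bij_betw_inv_into[OF b(1)] bij_betw_inv_into[OF b(2)] by (simp add: iso_by_def)
qed

lemma iso_by_inv: "iso_by f g G H \<Longrightarrow> v \<in> verts G \<Longrightarrow> inv_into (verts G) f (f v) = v"
  by (simp add: iso_by_def bij_betw_def)

lemma iso_by_wf:
  assumes i: "iso_by f g G H" and wf: "wf_graph G" shows "wf_graph H"
proof -
  have b: "bij_betw f (verts G) (verts H)" "bij_betw g (edges G) (edges H)"
    and en: "\<And>e. e \<in> edges G \<Longrightarrow> ends H (g e) = f ` ends G e" using i by (auto simp: iso_by_def)
  have "finite (verts H)" "finite (edges H)" using b wf bij_betw_finite unfolding wf_graph_def by blast+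
  moreover have "ends H e \<subseteq> verts H \<and> card (ends H e) = 2" if e: "e \<in> edges H" for e
  proof -
    obtain e' where e': "e' \<in> edges G" "e = g e'" using bij_betw_preimage[OF b(2) e] .
    have s: "ends G e' \<subseteq> verts G" "card (ends G e') = 2" using wf e' by (auto simp: wf_graph_def)
    have "inj_on f (ends G e')" using b(1) s(1) by (auto simp: bij_betw_def intro: inj_on_subset)
    then have "card (f ` ends G e') = 2" using s(2) by (simp add: card_image)
    moreover have "f ` ends G e' \<subseteq> verts H" using b(1) s(1) by (auto simp: bij_betw_def)
    ultimately show ?thesis using en[OF e'(1)] e'(2) by simp
  qed
  ultimately show ?thesis by (simp add: wf_graph_def)
qed

lemma iso_by_adjacent: "iso_by f g G H \<Longrightarrow> adjacent G u v \<Longrightarrow> adjacent H (f u) (f v)"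
  unfolding adjacent_def iso_by_def by (metis (no_types, lifting) bij_betw_apply image_empty image_insert)

lemma iso_by_in_triangle:
  assumes i: "iso_by f g G H" and t: "in_triangle G u" shows "in_triangle H (f u)"
proof -
  obtain a b where ab: "u \<in> verts G" "a \<in> verts G" "b \<in> verts G" "u \<noteq> a" "u \<noteq> b" "a \<noteq> b"
    "adjacent G u a" "adjacent G u b" "adjacent G a b" using t by (auto simp: in_triangle_def)
  have b: "bij_betw f (verts G) (verts H)" using i by (simp add: iso_by_def)
  have "f u \<noteq> f a" "f u \<noteq> f b" "f a \<noteq> f b" using ab b by (auto simp: bij_betw_def inj_on_def)
  moreover have "f u \<in> verts H" "f a \<in> verts H" "f b \<in> verts H" using ab b by (auto simp: bij_betw_def)
  ultimately show ?thesis unfolding in_triangle_def using ab(7-9) iso_by_adjacent[OF i] by blast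
qed

lemma contract_wf:
  assumes wf: "wf_graph G" and x: "x \<in> X" "X \<subseteq> verts G" shows "wf_graph (contract G X x)"
proof -
  have "ends (contract G X x) e \<subseteq> verts (contract G X x) \<and> card (ends (contract G X x) e) = 2"
    if e: "e \<in> edges (contract G X x)" for e
  proof -
    have e': "e \<in> edges G" "\<not> ends G e \<subseteq> X" using e by (auto simp: contract_def)
    then have s: "ends G e \<subseteq> verts G" "card (ends G e) = 2" using wf by (auto simp: wf_graph_def)
    obtain q where q: "q \<in> ends G e" "q \<notin> X" using e'(2) by blast
    obtain u v where uv: "ends G e = {u, v}" "u \<noteq> v" using s(2) by (auto simp: card_2_iff)
    obtain p where pq: "ends G e = {p, q}" "p \<noteq> q" "q \<notin> X"
    proof (cases "q = u")
      case True then show ?thesis using that[of v] uv q by (simp add: insert_commute)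
    next
      case False then show ?thesis using that[of u] uv q by simp
    qed
    have en: "ends (contract G X x) e = {if p \<in> X then x else p, q}" using pq by (auto simp: contract_def)
    have "x \<noteq> q" using pq(3) x by blast
    moreover have "{if p \<in> X then x else p, q} \<subseteq> verts (contract G X x)"
      using pq s(1) by (simp add: contract_def)
    ultimately show ?thesis unfolding en using pq(2) by simp
  qed
  moreover have "finite (verts (contract G X x))" "finite (edges (contract G X x))"
    using wf by (simp_all add: wf_graph_def contract_def)
  ultimately show ?thesis unfolding wf_graph_def by blast
qed

lemma contract_iso:
  assumes i: "iso_by f g G H" and wf: "wf_graph G" and x: "x \<in> X" "X \<subseteq> verts G"
  shows "iso_by f g (contract G X x) (contract H (f ` X) (f x))"
proof -
  have b: "bij_betw f (verts G) (verts H)" "bij_betw g (edges G) (edges H)"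
    and en: "\<And>e. e \<in> edges G \<Longrightarrow> ends H (g e) = f ` ends G e" using i by (auto simp: iso_by_def)
  have inj: "inj_on f (verts G)" and im: "f ` verts G = verts H" using b by (auto simp: bij_betw_def)
  have mem: "f v \<in> f ` X \<longleftrightarrow> v \<in> X" if "v \<in> verts G" for v
    using inj_on_image_mem_iff[OF inj that x(2)] .
  have xV: "x \<in> verts G" using x by blast
  have "f ` ((verts G - X) \<union> {x}) = (verts H - f ` X) \<union> {f x}"
    using im mem by auto
  moreover have "inj_on f ((verts G - X) \<union> {x})" by (rule inj_on_subset[OF inj]) (use xV in blast)
  ultimately have 1: "bij_betw f ((verts G - X) \<union> {x}) ((verts H - f ` X) \<union> {f x})" by (simp add: bij_betw_def)
  have sub: "f ` ends G e \<subseteq> f ` X \<longleftrightarrow> ends G e \<subseteq> X" if "e \<in> edges G" for e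
    using mem wf_ends[OF wf that] by blast
  have "g ` {e \<in> edges G. \<not> ends G e \<subseteq> X} = {e \<in> edges H. \<not> ends H e \<subseteq> f ` X}"
  proof
    show "g ` {e \<in> edges G. \<not> ends G e \<subseteq> X} \<subseteq> {e \<in> edges H. \<not> ends H e \<subseteq> f ` X}"
      using en sub b(2) by (auto simp: bij_betw_def)
    show "{e \<in> edges H. \<not> ends H e \<subseteq> f ` X} \<subseteq> g ` {e \<in> edges G. \<not> ends G e \<subseteq> X}"
    proof
      fix e assume e: "e \<in> {e \<in> edges H. \<not> ends H e \<subseteq> f ` X}"
      then have "e \<in> edges H" by blast
      then obtain e' where e': "e' \<in> edges G" "e = g e'" by (rule bij_betw_preimage[OF b(2)])
      then show "e \<in> g ` {e \<in> edges G. \<not> ends G e \<subseteq> X}" using e en sub by auto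
    qed
  qed
  moreover have "inj_on g {e \<in> edges G. \<not> ends G e \<subseteq> X}"
    using b(2) by (auto simp: bij_betw_def intro: inj_on_subset)
  ultimately have 2: "bij_betw g {e \<in> edges G. \<not> ends G e \<subseteq> X} {e \<in> edges H. \<not> ends H e \<subseteq> f ` X}"
    by (simp add: bij_betw_def)
  have 3: "(\<lambda>v. if v \<in> f ` X then f x else v) ` f ` ends G e = f ` (\<lambda>v. if v \<in> X then x else v) ` ends G e"
    if "e \<in> edges G" for e
    unfolding image_image using mem wf_ends[OF wf that] by (intro image_cong) auto
  show ?thesis unfolding iso_by_def contract_def using 1 2 3 en by simp
qed

text \<open>A ladder may name the contracted vertex by any vertex of \<open>X\<close>, whereas the
  contraction of a triangle is named by \<open>b1\<close>.\<close>

lemma contract_point_iso: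
  assumes "x \<in> X" "y \<in> X" "X \<subseteq> verts G"
  shows "iso_by (\<lambda>v. if v = x then y else v) id (contract G X x) (contract G X y)"
proof -
  have "bij_betw (\<lambda>v. if v = x then y else v) ((verts G - X) \<union> {x}) ((verts G - X) \<union> {y})"
    using assms by (auto simp: bij_betw_def inj_on_def image_iff)
  moreover have "(\<lambda>v. if v \<in> X then y else v) ` S = (\<lambda>v. if v = x then y else v) ` (\<lambda>v. if v \<in> X then x else v) ` S" for S
    unfolding image_image using assms by (intro image_cong) auto
  ultimately show ?thesis by (simp add: iso_by_def contract_def)
qed

text \<open>\<open>tri_ladder_seq\<close> lives on graphs over \<open>nat\<close>; this variant keeps the type under contraction, since
  contractions reuse the vertices and edges of the original graph.\<close>

inductive ladder :: "('v, 'e) mgraph \<Rightarrow> bool" where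
  base: "graph_iso G C6bar \<Longrightarrow> ladder G"
| step: "X \<subseteq> verts G \<Longrightarrow> x \<in> X \<Longrightarrow> xb \<in> verts G - X \<Longrightarrow> ladder (contract G X x) \<Longrightarrow>
    in_triangle (contract G X x) x \<Longrightarrow> w \<in> verts K4 \<Longrightarrow>
    iso_pt (contract G (verts G - X) xb) xb K4 w \<Longrightarrow> ladder G"

lemma iso_pt_contract:
  assumes i: "iso_by f g G H" and wf: "wf_graph G" and x: "x \<in> X" "X \<subseteq> verts G"
    and p: "iso_pt (contract G X x) x K w"
  shows "iso_pt (contract H (f ` X) (f x)) (f x) K w"
proof -
  note c = contract_iso[OF i wf x]
  note s = iso_by_sym[OF c contract_wf[OF wf x]]
  obtain f' g' where f': "iso_by f' g' (contract G X x) K" "f' x = w" using p by (auto simp: iso_pt_by)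
  have "x \<in> verts (contract G X x)" by (simp add: contract_def)
  then have "(f' \<circ> inv_into (verts (contract G X x)) f) (f x) = w" using iso_by_inv[OF c] f'(2) by simp
  then show ?thesis using iso_by_trans[OF s f'(1)] unfolding iso_pt_by by blast
qed

lemma iso_verts_diff: "iso_by f g G H \<Longrightarrow> X \<subseteq> verts G \<Longrightarrow> f ` (verts G - X) = verts H - f ` X"
  using inj_on_image_set_diff[of f "verts G" "verts G" X] by (auto simp: iso_by_def bij_betw_def)

lemma ladder_iso:
  assumes "ladder G" "wf_graph G" "iso_by f g G H" shows "ladder H"
  using assms
proof (induction arbitrary: H f g rule: ladder.induct)
  case (base G)
  have "graph_iso H C6bar"
    using base iso_by_sym[OF base.prems(2,1)] iso_by_trans unfolding graph_iso_by by blast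
  then show ?case by (rule ladder.base)
next
  case (step X G x xb w)
  note wf = step.prems(1) and i = step.prems(2)
  have VX: "f ` (verts G - X) = verts H - f ` X" using iso_verts_diff[OF i step.hyps(1)] .
  have im: "f ` verts G = verts H" using i by (auto simp: iso_by_def bij_betw_def)
  have c: "iso_by f g (contract G X x) (contract H (f ` X) (f x))" using contract_iso[OF i wf step.hyps(2,1)] .
  show ?case
  proof (rule ladder.step)
    show "f ` X \<subseteq> verts H" using im step.hyps(1) by blast
    show "f x \<in> f ` X" using step.hyps by blast
    show "f xb \<in> verts H - f ` X" using step.hyps VX by blast
    show "ladder (contract H (f ` X) (f x))"
      using step.IH[OF contract_wf[OF wf step.hyps(2,1)] c] .
    show "in_triangle (contract H (f ` X) (f x)) (f x)" using iso_by_in_triangle[OF c] step.hyps by blast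
    show "iso_pt (contract H (verts H - f ` X) (f xb)) (f xb) K4 w"
      using iso_pt_contract[OF i wf step.hyps(3) Diff_subset step.hyps(7)] unfolding VX .
  qed (rule step.hyps)
qed

lemma tri_ladder_seq_ladder:
  assumes "tri_ladder_seq G" "wf_graph G" shows "ladder G"
  using assms
proof (induction rule: tri_ladder_seq.induct)
  case (base G)
  then show ?case by (intro ladder.base)
next
  case (step H u w G)
  obtain X x xb where X: "X \<subseteq> verts G" "x \<in> X" "xb \<in> verts G - X" "iso_pt (contract G X x) x H u"
    "iso_pt (contract G (verts G - X) xb) xb K4 w" using step.hyps by (auto simp: splicing_def)
  obtain f g where f: "iso_by f g (contract G X x) H" "f x = u" using X(4) by (auto simp: iso_pt_by)
  have wfc: "wf_graph (contract G X x)" using contract_wf[OF step.prems X(2,1)] .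
  have s: "iso_by (inv_into (verts (contract G X x)) f) (inv_into (edges (contract G X x)) g) H (contract G X x)"
    by (rule iso_by_sym[OF f(1) wfc])
  have wfH: "wf_graph H" by (rule iso_by_wf[OF f(1) wfc])
  have t: "ladder (contract G X x)" by (rule ladder_iso[OF step.IH[OF wfH] wfH s])
  have "x \<in> verts (contract G X x)" by (simp add: contract_def)
  then have "inv_into (verts (contract G X x)) f u = x" using iso_by_inv[OF f(1)] f(2) by blast
  then have "in_triangle (contract G X x) x" using iso_by_in_triangle[OF s step.hyps(3)] by simp
  then show ?case using ladder.step[OF X(1-3) t _ step.hyps(4) X(5)] by blast
qed

lemma tri_ladder_imp_ladder:
  assumes "tri_ladder G" "wf_graph G" shows "ladder G"
proof -
  obtain H f g where H: "tri_ladder_seq H" "iso_by f g G H" using assms(1) by (auto simp: tri_ladder_def graph_iso_by)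
  have wfH: "wf_graph H" by (rule iso_by_wf[OF H(2) assms(2)])
  show ?thesis
    by (rule ladder_iso[OF tri_ladder_seq_ladder[OF H(1) wfH] wfH iso_by_sym[OF H(2) assms(2)]])
qed

lemma nat_copy:
  fixes G :: "('v, 'e) mgraph"
  assumes wf: "wf_graph G"
  obtains f g and H :: "(nat, nat) mgraph" where "iso_by f g G H"
proof -
  have "finite (verts G)" "finite (edges G)" using wf by (auto simp: wf_graph_def)
  then obtain f :: "'v \<Rightarrow> nat" and g :: "'e \<Rightarrow> nat" where "inj_on f (verts G)" "inj_on g (edges G)"
    using finite_imp_inj_to_nat_seg by metis
  then have "iso_by f g G \<lparr>verts = f ` verts G, edges = g ` edges G, ends = (\<lambda>k. f ` ends G (inv_into (edges G) g k))\<rparr>"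
    by (simp add: iso_by_def bij_betw_def)
  then show thesis by (rule that)
qed

lemma ladder_imp_tri_ladder:
  fixes G :: "('v, 'e) mgraph"
  assumes "ladder G" "wf_graph G" shows "tri_ladder G"
  using assms
proof (induction rule: ladder.induct)
  case (base G)
  obtain f g and H :: "(nat, nat) mgraph" where i: "iso_by f g G H" using nat_copy[OF base.prems] .
  have "graph_iso H C6bar"
    using base iso_by_sym[OF i base.prems] iso_by_trans unfolding graph_iso_by by blast
  then have "tri_ladder_seq H" by (rule tri_ladder_seq.base)
  then show ?case using i unfolding tri_ladder_def graph_iso_by by blast
next
  case (step X G x xb w)
  note wf = step.prems
  obtain f g and Gn :: "(nat, nat) mgraph" where i: "iso_by f g G Gn" using nat_copy[OF wf] .
  have wfc: "wf_graph (contract G X x)" using contract_wf[OF wf step.hyps(2,1)] .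
  obtain H f1 g1 where H: "tri_ladder_seq H" "iso_by f1 g1 (contract G X x) H"
    using step.IH[OF wfc] by (auto simp: tri_ladder_def graph_iso_by)
  have xc: "x \<in> verts (contract G X x)" by (simp add: contract_def)
  have VX: "f ` (verts G - X) = verts Gn - f ` X" using iso_verts_diff[OF i step.hyps(1)] .
  have im: "f ` verts G = verts Gn" using i by (auto simp: iso_by_def bij_betw_def)
  have "splicing Gn H (f1 x) K4 w" unfolding splicing_def
  proof (intro exI conjI)
    show "f ` X \<subseteq> verts Gn" using im step.hyps(1) by blast
    show "f x \<in> f ` X" using step.hyps by blast
    show "f xb \<in> verts Gn - f ` X" using step.hyps VX by blast
    have "iso_pt (contract G X x) x H (f1 x)" using H(2) by (auto simp: iso_pt_by)
    then show "iso_pt (contract Gn (f ` X) (f x)) (f x) H (f1 x)"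
      by (rule iso_pt_contract[OF i wf step.hyps(2,1)])
    show "iso_pt (contract Gn (verts Gn - f ` X) (f xb)) (f xb) K4 w"
      using iso_pt_contract[OF i wf step.hyps(3) Diff_subset step.hyps(7)] unfolding VX .
  qed
  moreover have "f1 x \<in> verts H" using H(2) xc by (auto simp: iso_by_def bij_betw_def)
  moreover have "in_triangle H (f1 x)" using iso_by_in_triangle[OF H(2) step.hyps(5)] .
  ultimately have "tri_ladder_seq Gn" using tri_ladder_seq.step[OF H(1)] step.hyps(6) by blast
  then show ?case using i unfolding tri_ladder_def graph_iso_by by blast
qed

section \<open>Degrees, size and last splicing of a ladder\<close>

definition cubic :: "('v, 'e) mgraph \<Rightarrow> bool" where
  "cubic G \<longleftrightarrow> (\<forall>v\<in>verts G. card {e \<in> edges G. v \<in> ends G e} = 3)"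

lemma iso_deg:
  assumes i: "iso_by f g G H" and wf: "wf_graph G" and v: "v \<in> verts G"
  shows "card {e \<in> edges G. v \<in> ends G e} = card {e \<in> edges H. f v \<in> ends H e}"
proof (rule bij_betw_same_card)
  have b: "inj_on f (verts G)" "bij_betw g (edges G) (edges H)"
    and en: "\<And>e. e \<in> edges G \<Longrightarrow> ends H (g e) = f ` ends G e" using i by (auto simp: iso_by_def bij_betw_def)
  have mem: "f v \<in> ends H (g e) \<longleftrightarrow> v \<in> ends G e" if "e \<in> edges G" for e
    using inj_on_image_mem_iff[OF b(1) v wf_ends[OF wf that]] en[OF that] by simp
  have "inj_on g {e \<in> edges G. v \<in> ends G e}" using b(2) by (auto simp: bij_betw_def intro: inj_on_subset)
  moreover have "g ` {e \<in> edges G. v \<in> ends G e} = {e \<in> edges H. f v \<in> ends H e}"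
  proof
    show "g ` {e \<in> edges G. v \<in> ends G e} \<subseteq> {e \<in> edges H. f v \<in> ends H e}"
      using b(2) mem by (auto simp: bij_betw_def)
    show "{e \<in> edges H. f v \<in> ends H e} \<subseteq> g ` {e \<in> edges G. v \<in> ends G e}"
    proof
      fix e assume e: "e \<in> {e \<in> edges H. f v \<in> ends H e}"
      then have "e \<in> edges H" by blast
      then obtain e' where "e' \<in> edges G" "e = g e'" by (rule bij_betw_preimage[OF b(2)])
      then show "e \<in> g ` {e \<in> edges G. v \<in> ends G e}" using e mem by blast
    qed
  qed
  ultimately show "bij_betw g {e \<in> edges G. v \<in> ends G e} {e \<in> edges H. f v \<in> ends H e}" by (simp add: bij_betw_def)
qed

lemma iso_cubic:
  assumes i: "iso_by f g G H" and wf: "wf_graph G" and c: "cubic H" shows "cubic G"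
  unfolding cubic_def
proof
  fix v assume v: "v \<in> verts G"
  then have "f v \<in> verts H" using i by (auto simp: iso_by_def bij_betw_def)
  then show "card {e \<in> edges G. v \<in> ends G e} = 3" using iso_deg[OF i wf v] c by (simp add: cubic_def)
qed

lemma contract_deg:
  assumes "v \<notin> X" "x \<in> X"
  shows "{e \<in> edges (contract G X x). v \<in> ends (contract G X x) e} = {e \<in> edges G. v \<in> ends G e}"
  using assms by (auto simp: contract_def image_iff split: if_splits)

lemma lt6: "(i::nat) < 6 \<longleftrightarrow> i = 0 \<or> i = 1 \<or> i = 2 \<or> i = 3 \<or> i = 4 \<or> i = 5" by auto
lemma lt4: "(i::nat) < 4 \<longleftrightarrow> i = 0 \<or> i = 1 \<or> i = 2 \<or> i = 3" by auto

lemma edges_C6bar: "edges C6bar = {{0, 2}, {0, 3}, {0, 4}, {1, 3}, {1, 4}, {1, 5}, {2, 4}, {2, 5}, {3, 5}}" (is "_ = ?R")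
proof
  show "edges C6bar \<subseteq> ?R"
  proof
    fix e assume "e \<in> edges C6bar"
    then obtain i j where ij: "e = {i, j}" "i < 6" "j < 6" "i \<noteq> j" "\<not> (j = (i + 1) mod 6 \<or> i = (j + 1) mod 6)"
      by (auto simp: C6bar_def)
    show "e \<in> ?R" using ij(2-5) unfolding ij(1) lt6 by (elim disjE) (simp_all add: insert_commute)
  qed
  have m: "{i, j} \<in> edges C6bar" if "i < 6" "j < 6" "i \<noteq> j" "\<not> (j = (i + 1) mod 6 \<or> i = (j + 1) mod 6)" for i j
    using that by (auto simp: C6bar_def)
  show "?R \<subseteq> edges C6bar" by (intro insert_subsetI empty_subsetI m) simp_all
qed

lemma filter_insert: "{e \<in> insert a S. v \<in> e} = (if v \<in> a then insert a {e \<in> S. v \<in> e} else {e \<in> S. v \<in> e})"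
  by auto

lemma cubic_C6bar: "cubic C6bar"
proof -
  have 1: "ends C6bar = id" "verts C6bar = {0, 1, 2, 3, 4, 5}" by (simp_all add: C6bar_def)
  have 2: "{e \<in> {}. v \<in> e} = {}" for v :: nat by simp
  show ?thesis unfolding cubic_def edges_C6bar 1 id_apply filter_insert 2
    by (intro ballI) (elim insertE emptyE; simp add: doubleton_eq_iff)
qed

lemma edges_K4: "edges K4 = {{0, 1}, {0, 2}, {0, 3}, {1, 2}, {1, 3}, {2, 3}}" (is "_ = ?R")
proof
  show "edges K4 \<subseteq> ?R"
  proof
    fix e assume "e \<in> edges K4"
    then obtain i j where ij: "e = {i, j}" "i < 4" "j < 4" "i \<noteq> j" by (auto simp: K4_def)
    show "e \<in> ?R" using ij(2-4) unfolding ij(1) lt4 by (elim disjE) (simp_all add: insert_commute)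
  qed
  have m: "{i, j} \<in> edges K4" if "i < 4" "j < 4" "i \<noteq> j" for i j using that by (auto simp: K4_def)
  show "?R \<subseteq> edges K4" by (intro insert_subsetI empty_subsetI m) simp_all
qed

lemma cubic_K4: "cubic K4"
proof -
  have 1: "ends K4 = id" "verts K4 = {0, 1, 2, 3}" by (simp_all add: K4_def)
  have 2: "{e \<in> {}. v \<in> e} = {}" for v :: nat by simp
  show ?thesis unfolding cubic_def edges_K4 1 id_apply filter_insert 2
    by (intro ballI) (elim insertE emptyE; simp add: doubleton_eq_iff)
qed

text \<open>Every vertex survives in one of the two contractions with all its incident edges, and
  both contractions are cubic.\<close>

lemma ladder_cubic:
  assumes "ladder G" "wf_graph G" shows "cubic G"
  using assms
proof (induction rule: ladder.induct)
  case (base G)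
  then show ?case using iso_cubic cubic_C6bar by (auto simp: graph_iso_by)
next
  case (step X G x xb w)
  have 1: "cubic (contract G X x)" using step.IH contract_wf[OF step.prems step.hyps(2,1)] by blast
  have wf2: "wf_graph (contract G (verts G - X) xb)" using contract_wf[OF step.prems step.hyps(3)] by blast
  have 2: "cubic (contract G (verts G - X) xb)" using iso_cubic[OF _ wf2 cubic_K4] step.hyps(7) by (auto simp: iso_pt_by)
  show ?case unfolding cubic_def
  proof
    fix v assume v: "v \<in> verts G"
    show "card {e \<in> edges G. v \<in> ends G e} = 3"
    proof (cases "v \<in> X")
      case False
      have "v \<in> verts (contract G X x)" using v False by (simp add: contract_def)
      then have "card {e \<in> edges (contract G X x). v \<in> ends (contract G X x) e} = 3"
        using 1 unfolding cubic_def by blast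
      then show ?thesis unfolding contract_deg[OF False step.hyps(2)] .
    next
      case True
      have "v \<in> verts (contract G (verts G - X) xb)" using v True by (simp add: contract_def)
      then have "card {e \<in> edges (contract G (verts G - X) xb). v \<in> ends (contract G (verts G - X) xb) e} = 3"
        using 2 unfolding cubic_def by blast
      moreover have "v \<notin> verts G - X" using True by blast
      ultimately show ?thesis using contract_deg[OF _ step.hyps(3), of v G] by simp
    qed
  qed
qed

text \<open>Splicing with \<open>K4\<close> amounts to replacing a vertex by a triangle: without the
  contracted vertex, three mutually adjacent vertices of \<open>K4\<close> remain.\<close>

lemma K4_contract:
  assumes X: "X \<subseteq> verts G" and xb: "xb \<in> verts G - X" and wf: "wf_graph G"
    and i: "iso_pt (contract G (verts G - X) xb) xb K4 w"
  shows "card X = 3" "\<And>x y. x \<in> X \<Longrightarrow> y \<in> X \<Longrightarrow> x \<noteq> y \<Longrightarrow> adjacent G x y"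
proof -
  let ?C = "contract G (verts G - X) xb"
  have V: "verts ?C = insert xb X" using X xb by (auto simp: contract_def)
  obtain f g where f: "iso_by f g ?C K4" using i by (auto simp: iso_pt_by)
  have wfC: "wf_graph ?C" using contract_wf[OF wf xb] by blast
  have b: "bij_betw f (insert xb X) (verts K4)" using f V by (simp add: iso_by_def)
  have fX: "finite X" using X wf by (auto simp: wf_graph_def intro: finite_subset)
  have "card (insert xb X) = 4" using bij_betw_same_card[OF b] by (simp add: K4_def)
  then show "card X = 3" using fX xb by simp
  fix x y assume xy: "x \<in> X" "y \<in> X" "x \<noteq> y"
  have fxy: "f x \<in> verts K4" "f y \<in> verts K4" "f x \<noteq> f y" using xy b by (auto simp: bij_betw_def inj_on_def)
  have "f x < 4" "f y < 4" using fxy by (auto simp: K4_def)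
  then have "{f x, f y} \<in> edges K4" using fxy(3) unfolding K4_def by auto
  then have "adjacent K4 (f x) (f y)" unfolding adjacent_def by (auto simp: K4_def)
  then have "adjacent ?C (inv_into (verts ?C) f (f x)) (inv_into (verts ?C) f (f y))"
    by (rule iso_by_adjacent[OF iso_by_sym[OF f wfC]])
  then have "adjacent ?C x y" using iso_by_inv[OF f, of x] iso_by_inv[OF f, of y] xy V by simp
  then obtain e where e: "e \<in> edges G" "(\<lambda>v. if v \<in> verts G - X then xb else v) ` ends G e = {x, y}"
    by (auto simp: adjacent_def contract_def)
  have "ends G e \<inter> (verts G - X) = {}"
  proof (rule ccontr)
    assume "\<not> ?thesis"
    then have "xb \<in> {x, y}" unfolding e(2)[symmetric] by auto
    then show False using xy xb by blast
  qed
  then have "ends G e = {x, y}" using e(2) by (auto simp: image_iff split: if_splits)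
  then show "adjacent G x y" using e(1) by (auto simp: adjacent_def)
qed

lemma ladder_card:
  assumes "ladder G" "wf_graph G" shows "6 \<le> card (verts G)"
  using assms
proof (induction rule: ladder.induct)
  case (base G)
  then have "card (verts G) = card (verts C6bar)" using bij_betw_same_card by (auto simp: graph_iso_def)
  then show ?case by (simp add: C6bar_def)
next
  case (step X G x xb w)
  have "6 \<le> card (verts (contract G X x))" using step.IH contract_wf[OF step.prems step.hyps(2,1)] by blast
  also have "\<dots> \<le> card (verts G)" using step.prems step.hyps(1,2) by (intro card_mono) (auto simp: contract_def wf_graph_def)
  finally show ?case .
qed

section \<open>Triangles of a near-bipartite graph\<close>

context bip_pair begin

lemma swap_pair: "bip_pair G A B a1 a2 b2 b1 e1 e2"
proof unfold_locales
  show "\<exists>p\<in>A. \<exists>q\<in>B. ends G e = {p, q}" if "e \<in> edges G" "e \<noteq> e1" "e \<noteq> e2" for e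
    using cross[OF that] .
qed (use wf dj V e12 en inA inB in auto)

lemma adjacent_cases:
  assumes "adjacent G x y"
  shows "(x, y) \<in> cross_pairs (edges G) \<or> (y, x) \<in> cross_pairs (edges G) \<or> {x, y} = {a1, a2} \<or> {x, y} = {b1, b2}"
proof -
  obtain e where e: "e \<in> edges G" "ends G e = {x, y}" using assms by (auto simp: adjacent_def)
  show ?thesis
  proof (cases "e = e1 \<or> e = e2")
    case True
    then have "{x, y} = {a1, a2} \<or> {x, y} = {b1, b2}" using e(2) en by metis
    then show ?thesis by blast
  next
    case False
    then obtain p q where pq: "p \<in> A" "q \<in> B" "ends G e = {p, q}" using cross e by blast
    then have "(p, q) \<in> cross_pairs (edges G)" using e by (auto simp: cross_pairs_def)
    moreover have "x = p \<and> y = q \<or> x = q \<and> y = p" using e pq by (auto simp: doubleton_eq_iff)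
    ultimately show ?thesis by blast
  qed
qed

lemma adjacent_AA: assumes "adjacent G x y" "x \<in> A" "y \<in> A" shows "{x, y} = {a1, a2}"
proof -
  have "(x, y) \<notin> cross_pairs (edges G)" "(y, x) \<notin> cross_pairs (edges G)" using cross_pairs_sub[of "edges G"] assms dj by blast+
  moreover have "{x, y} \<noteq> {b1, b2}" using assms inB dj by (metis disjoint_iff insertI1 insertE singletonD)
  ultimately show ?thesis using adjacent_cases[OF assms(1)] by blast
qed

lemma adjacent_AB: assumes "adjacent G x y" "x \<in> A" "y \<in> B" shows "(x, y) \<in> cross_pairs (edges G)"
proof -
  have "(y, x) \<notin> cross_pairs (edges G)" using cross_pairs_sub[of "edges G"] assms dj by blast
  moreover have "{x, y} \<noteq> {b1, b2}" using assms inB dj by (metis disjoint_iff insertI1 insertE singletonD)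
  moreover have "{x, y} \<noteq> {a1, a2}" using assms inA dj by (metis disjoint_iff insertI1 insertE insert_commute singletonD)
  ultimately show ?thesis using adjacent_cases[OF assms(1)] by blast
qed

lemma cross_pairs_adjacent: "(p, q) \<in> cross_pairs (edges G) \<Longrightarrow> adjacent G p q"
  by (auto simp: cross_pairs_def adjacent_def)

lemma two_in_A:
  assumes "adjacent G x y" "adjacent G x z" "adjacent G y z" "x \<in> A" "y \<in> A" "x \<noteq> y" "z \<noteq> x" "z \<noteq> y" "z \<in> A \<union> B"
  shows "{x, y} = {a1, a2} \<and> z \<in> B \<and> (a1, z) \<in> cross_pairs (edges G) \<and> (a2, z) \<in> cross_pairs (edges G)"
proof -
  have xy: "{x, y} = {a1, a2}" using adjacent_AA assms by blast
  have "z \<notin> A"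
  proof
    assume z: "z \<in> A"
    have "{x, z} = {a1, a2}" using adjacent_AA[OF assms(2,4) z] .
    then show False using xy assms(6-8) by (auto simp: doubleton_eq_iff)
  qed
  then have z: "z \<in> B" using assms by blast
  have "(x, z) \<in> cross_pairs (edges G)" "(y, z) \<in> cross_pairs (edges G)" using adjacent_AB z assms by blast+
  moreover have "x = a1 \<and> y = a2 \<or> x = a2 \<and> y = a1" using xy by (simp add: doubleton_eq_iff)
  ultimately show ?thesis using xy z by blast
qed

lemma two_in_B:
  assumes "adjacent G x y" "adjacent G x z" "adjacent G y z" "x \<in> B" "y \<in> B" "x \<noteq> y" "z \<noteq> x" "z \<noteq> y" "z \<in> A \<union> B"
  shows "{x, y} = {b1, b2} \<and> z \<in> A \<and> (z, b1) \<in> cross_pairs (edges G) \<and> (z, b2) \<in> cross_pairs (edges G)"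
  using bip_pair.two_in_A[OF dual_pair assms(1-8)] assms(9) unfolding cross_pairs_dual by blast

text \<open>Two of the three vertices lie in the same class, and the only edges inside a class join
  the ends of \<open>e1\<close> or those of \<open>e2\<close>.\<close>

lemma triangle_cases:
  assumes "adjacent G x y" "adjacent G x z" "adjacent G y z" "x \<noteq> y" "x \<noteq> z" "y \<noteq> z" "{x, y, z} \<subseteq> A \<union> B"
  shows "(\<exists>a\<in>A. {x, y, z} = {a, b1, b2} \<and> (a, b1) \<in> cross_pairs (edges G) \<and> (a, b2) \<in> cross_pairs (edges G)) \<or>
         (\<exists>b\<in>B. {x, y, z} = {b, a1, a2} \<and> (a1, b) \<in> cross_pairs (edges G) \<and> (a2, b) \<in> cross_pairs (edges G))"
proof -
  have main: "(\<exists>a\<in>A. {x, y, z} = {a, b1, b2} \<and> (a, b1) \<in> cross_pairs (edges G) \<and> (a, b2) \<in> cross_pairs (edges G)) \<or>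
      (\<exists>b\<in>B. {x, y, z} = {b, a1, a2} \<and> (a1, b) \<in> cross_pairs (edges G) \<and> (a2, b) \<in> cross_pairs (edges G))"
    if h: "adjacent G x y" "adjacent G x z" "adjacent G y z" "x \<noteq> y" "z \<noteq> x" "z \<noteq> y" "z \<in> A \<union> B"
      and c: "x \<in> A \<and> y \<in> A \<or> x \<in> B \<and> y \<in> B" for x y z
  proof -
    have e: "{x, y, z} = insert z {x, y}" by blast
    from c show ?thesis
    proof
      assume "x \<in> A \<and> y \<in> A"
      then have "{x, y} = {a1, a2} \<and> z \<in> B \<and> (a1, z) \<in> cross_pairs (edges G) \<and> (a2, z) \<in> cross_pairs (edges G)"
        using two_in_A[OF h(1-3) _ _ h(4-7)] by blast
      then show ?thesis unfolding e by blast
    next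
      assume "x \<in> B \<and> y \<in> B"
      then have "{x, y} = {b1, b2} \<and> z \<in> A \<and> (z, b1) \<in> cross_pairs (edges G) \<and> (z, b2) \<in> cross_pairs (edges G)"
        using two_in_B[OF h(1-3) _ _ h(4-7)] by blast
      then show ?thesis unfolding e by blast
    qed
  qed
  have sy: "adjacent G z y" "adjacent G z x" "adjacent G y x" using assms adjacent_sym by metis+
  consider "x \<in> A \<and> y \<in> A \<or> x \<in> B \<and> y \<in> B" | "x \<in> A \<and> z \<in> A \<or> x \<in> B \<and> z \<in> B" | "y \<in> A \<and> z \<in> A \<or> y \<in> B \<and> z \<in> B"
    using assms(7) by blast
  then show ?thesis
  proof cases
    case 1 then show ?thesis using main[of x y z] assms by blast
  next
    case 2
    have "{x, z, y} = {x, y, z}" by blast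
    then show ?thesis using main[of x z y] 2 assms sy by simp
  next
    case 3
    have "{y, z, x} = {x, y, z}" by blast
    then show ?thesis using main[of y z x] 3 assms sy by simp
  qed
qed

end

context bip_core begin

lemma dual_bip_core: "bip_core G B A b1 b2 a1 a2 e2 e1"
  unfolding bip_core_def cross_pairs_dual using dual_pair dual by blast

lemma swap_bip_core: "bip_core G A B a1 a2 b2 b1 e1 e2"
  unfolding bip_core_def using swap_pair swap_b by blast

end

section \<open>Cubic graphs and their contraction along a triangle\<close>

locale cubic_core = bip_core + assumes cub: "cubic G"
begin

lemma dual_cubic_core: "cubic_core G B A b1 b2 a1 a2 e2 e1"
  unfolding cubic_core_def cubic_core_axioms_def using dual_bip_core cub by blast

lemma swap_cubic_core: "cubic_core G A B a1 a2 b2 b1 e1 e2"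
  unfolding cubic_core_def cubic_core_axioms_def using swap_bip_core cub by blast

lemma card_N_le:
  assumes "finite incident" "\<And>q. (p, q) \<in> E \<Longrightarrow> \<exists>e\<in>incident. ends G e = {p, q}"
  shows "card (E `` {p}) \<le> card incident"
proof -
  obtain h where h: "\<And>q. (p, q) \<in> E \<Longrightarrow> h q \<in> incident \<and> ends G (h q) = {p, q}" using assms(2) by metis
  have "inj_on h (E `` {p})"
  proof (rule inj_onI)
    fix q q' assume "q \<in> E `` {p}" "q' \<in> E `` {p}" "h q = h q'"
    then have "{p, q} = {p, q'}" using h[of q] h[of q'] by simp
    then show "q = q'" by (auto simp: doubleton_eq_iff)
  qed
  moreover have "h ` (E `` {p}) \<subseteq> incident" using h by blast
  ultimately show ?thesis using assms(1) by (rule card_inj_on_le)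
qed

abbreviation incident :: "'a \<Rightarrow> 'b set" where "incident v \<equiv> {e \<in> edges G. v \<in> ends G e}"

lemma card_incident: "v \<in> A \<union> B \<Longrightarrow> card (incident v) = 3" using cub V by (simp add: cubic_def)

lemma E_edge: assumes "(p, q) \<in> E" obtains e where "e \<in> incident p" "e \<noteq> e1" "e \<noteq> e2" "ends G e = {p, q}"
proof -
  obtain e where e: "e \<in> edges G" "ends G e = {p, q}" "p \<in> A" "q \<in> B" using assms by (auto simp: cross_pairs_def)
  have "e \<noteq> e1" "e \<noteq> e2" using e en inA inB dj by auto
  then show thesis using that e by blast
qed

lemma finI: "finite (incident v)" using fin by simp

lemma dA: assumes "p \<in> A" "p \<noteq> a1" "p \<noteq> a2" shows "card (E `` {p}) = 3"
proof -
  have "card (E `` {p}) \<le> card (incident p)" using E_edge by (intro card_N_le[OF finI]) metis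
  then show ?thesis using deg3[OF assms] card_incident[of p] assms by simp
qed

lemma da: assumes "p = a1 \<or> p = a2" shows "card (E `` {p}) = 2"
proof -
  have pA: "p \<in> A" "e1 \<in> incident p" using assms inA e12 en by auto
  have "card (E `` {p}) \<le> card (incident p - {e1})"
  proof (rule card_N_le)
    show "\<exists>e\<in>incident p - {e1}. ends G e = {p, q}" if "(p, q) \<in> E" for q using E_edge[OF that] by blast
  qed (simp add: finI)
  also have "\<dots> = 2" using card_incident[of p] pA finI[of p] by (simp add: card_Diff_singleton)
  finally show ?thesis using N_two[of "{p}"] pA by simp
qed

lemma dB: assumes "q \<in> B" "q \<noteq> b1" "q \<noteq> b2" shows "card (E\<inverse> `` {q}) = 3"
  using cubic_core.dA[OF dual_cubic_core assms] unfolding cross_pairs_dual .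

lemma db: assumes "q = b1 \<or> q = b2" shows "card (E\<inverse> `` {q}) = 2"
  using cubic_core.da[OF dual_cubic_core assms] unfolding cross_pairs_dual .

text \<open>In a cubic graph a pair of parallel edges would leave a vertex with fewer neighbours
  than \<open>deg3\<close> or \<open>N_two\<close> demands.\<close>

lemma simple: assumes ef: "e \<in> edges G" "f \<in> edges G" "ends G e = ends G f" shows "e = f"
proof (rule ccontr)
  assume ne: "e \<noteq> f"
  have two: False if "ends G x \<subseteq> A \<or> ends G x \<subseteq> B" "x \<in> edges G" "y \<in> edges G" "ends G x = ends G y" "x \<noteq> y" for x y
  proof -
    have "z = e1 \<and> ends G z \<subseteq> A \<or> z = e2 \<and> ends G z \<subseteq> B" if z: "z \<in> edges G" "ends G z \<subseteq> A \<or> ends G z \<subseteq> B" for z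
    proof (cases "z = e1 \<or> z = e2")
      case True then show ?thesis using en inA inB by auto
    next
      case False
      then obtain p q where "p \<in> A" "q \<in> B" "ends G z = {p, q}" using cross z by blast
      then show ?thesis using z dj by auto
    qed
    from this[OF that(2)] this[OF that(3)] show False using that en inA inB dj by auto
  qed
  have c: "e \<noteq> e1 \<and> e \<noteq> e2"
  proof (rule ccontr)
    assume "\<not> ?thesis"
    then have "ends G e \<subseteq> A \<or> ends G e \<subseteq> B" using en inA inB by auto
    then show False using two[of e f] ef ne by blast
  qed
  then obtain p q where pq: "p \<in> A" "q \<in> B" "ends G e = {p, q}" using cross ef by blast
  have fI: "f \<in> incident p" "e \<in> incident p" using pq ef by auto
  have step: "\<exists>g\<in>incident p - {f} - {e1}. ends G g = {p, r}" if pr: "(p, r) \<in> E" for r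
  proof -
    obtain g where g: "g \<in> incident p" "g \<noteq> e1" "ends G g = {p, r}" using E_edge[OF pr] by metis
    show ?thesis
    proof (cases "g = f")
      case True
      then have "ends G e = {p, r}" using g ef by simp
      then show ?thesis using fI c ne by blast
    next
      case False then show ?thesis using g by blast
    qed
  qed
  have le: "card (E `` {p}) \<le> card (incident p - {f} - {e1})" by (rule card_N_le[OF _ step]) (simp add: finI)
  have c2: "card (incident p - {f}) = 2" using card_incident[of p] pq fI finI[of p] by (simp add: card_Diff_singleton)
  show False
  proof (cases "p = a1 \<or> p = a2")
    case True
    then have "e1 \<in> incident p" using en e12 by auto
    moreover have "e1 \<noteq> f" using ef pq en inA dj by auto
    ultimately have "card (incident p - {f} - {e1}) = 1" using c2 finI[of p] by (simp add: card_Diff_singleton)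
    then show False using le da[OF True] by simp
  next
    case False
    have "card (incident p - {f} - {e1}) \<le> card (incident p - {f})" by (intro card_mono) (auto simp: finI)
    then show False using le c2 dA[of p] False pq by simp
  qed
qed

text \<open>As an end of \<open>e1\<close>, the vertex \<open>a\<close> would have no neighbours but
  \<open>b1\<close> and \<open>b2\<close>, contrary to \<open>hall2\<close> for \<open>{a}\<close>.
  The degrees then determine \<open>a'\<close>, \<open>c1\<close> and \<open>c2\<close>.\<close>

lemma triangle_imp_cubic_tri:
  assumes a: "a \<in> A" "(a, b1) \<in> E" "(a, b2) \<in> E"
  shows "\<exists>a' c1 c2. cubic_tri A B E a1 a2 b1 b2 a a' c1 c2"
proof -
  have sub: "{b1, b2} \<subseteq> E `` {a}" using a by blast
  have na: "a \<noteq> a1 \<and> a \<noteq> a2"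
  proof (rule ccontr)
    assume "\<not> ?thesis"
    then have "card (E `` {a}) = 2" using da by blast
    then have "{b1, b2} = E `` {a}" using sub distinct_ends by (intro card_seteq) simp_all
    then have "E `` {a} - {b1, b2} = {}" by blast
    then have "card (E `` {a} - {b1, b2}) = 0" by (metis card.empty)
    moreover have "card {a} \<le> card (E `` {a} - {b1, b2})" using a big by (intro hall2) simp_all
    moreover have "card {a} = 1" by simp
    ultimately show False by linarith
  qed
  have "card (E `` {a} - {b1, b2}) = 1" using dA[of a] a na sub distinct_ends by (simp add: card_Diff_subset)
  then obtain a' where "E `` {a} - {b1, b2} = {a'}" by (meson card_1_singletonE)
  then have a': "E `` {a} = {b1, b2, a'}" using sub by blast
  have other: "\<exists>c. E\<inverse> `` {\<beta>} = {a, c}" if "\<beta> = b1 \<or> \<beta> = b2" for \<beta>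
  proof -
    have m: "a \<in> E\<inverse> `` {\<beta>}" using that a by blast
    have "card (E\<inverse> `` {\<beta>} - {a}) = 1" using db[OF that] m by (simp add: card_Diff_singleton)
    then obtain c where "E\<inverse> `` {\<beta>} - {a} = {c}" by (meson card_1_singletonE)
    then have "E\<inverse> `` {\<beta>} = {a, c}" using m by blast
    then show ?thesis by blast
  qed
  obtain c1 where c1: "E\<inverse> `` {b1} = {a, c1}" using other[OF disjI1[OF refl]] by (rule exE)
  obtain c2 where c2: "E\<inverse> `` {b2} = {a, c2}" using other[OF disjI2[OF refl]] by (rule exE)
  have "tri A B E a1 a2 b1 b2 a a' c1 c2"
    using a(1) na a' c1 c2 core_axioms unfolding tri_def tri_axioms_def by metis
  then have "cubic_tri A B E a1 a2 b1 b2 a a' c1 c2"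
    unfolding cubic_tri_def cubic_tri_axioms_def using dA da[OF disjI1[OF refl]] da[OF disjI2[OF refl]] dB by simp
  then show ?thesis by blast
qed

end

locale cubic_core_tri = cubic_core G A B a1 a2 b1 b2 e1 e2 +
    cubic_tri A B "bip_pair.cross_pairs G A B (edges G)" a1 a2 b1 b2 a a' c1 c2
  for G :: "('v, 'e) mgraph" and A B a1 a2 b1 b2 e1 e2 a a' c1 c2
begin

definition X :: "'v set" where "X = {a, b1, b2}"
definition G' :: "('v, 'e) mgraph" where "G' = contract G X b1"
definition e3 :: 'e where "e3 = (THE e. e \<in> edges G \<and> ends G e = {a, a'})"

lemma e3_edge: "e3 \<in> edges G" "ends G e3 = {a, a'}"
proof -
  obtain e where e: "e \<in> edges G" "ends G e = {a, a'}" using E_edge[OF ab(3)] by blast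
  then have "e3 = e" unfolding e3_def using simple by (intro the_equality) auto
  then show "e3 \<in> edges G" "ends G e3 = {a, a'}" using e by simp_all
qed

lemma X_A: "x \<in> A \<Longrightarrow> x \<in> X \<longleftrightarrow> x = a"
  using dj inB by (auto simp: X_def)

lemma X_B: "y \<in> B \<Longrightarrow> y \<in> X \<longleftrightarrow> y = b1 \<or> y = b2"
  using dj a(1) by (auto simp: X_def)

lemma X_sub: "X \<subseteq> verts G" "b1 \<in> X" "b2 \<in> X" using V a(1) inB by (auto simp: X_def)

lemma G'_wf: "wf_graph G'"
  unfolding G'_def by (rule contract_wf[OF wf X_sub(2,1)])

lemma G'_verts: "verts G' = A' \<union> B'"
  using V dj inB a(1) distinct_ends by (auto simp: G'_def contract_def X_def A'_def B'_def)

lemma G'_edges: "e \<in> edges G' \<longleftrightarrow> e \<in> edges G \<and> \<not> ends G e \<subseteq> X"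
  by (simp add: G'_def contract_def)

lemma G'_ends: "ends G' e = (\<lambda>v. if v \<in> X then b1 else v) ` ends G e"
  by (simp add: G'_def contract_def)

lemma e1_ends': "ends G' e1 = {a1, a2}" "e1 \<in> edges G'"
proof -
  have n: "a1 \<notin> X" "a2 \<notin> X" using X_A[OF inA(1)] X_A[OF inA(2)] a by simp_all
  then show "ends G' e1 = {a1, a2}" unfolding G'_ends en by simp
  show "e1 \<in> edges G'" using n e12 en by (simp add: G'_edges)
qed

lemma e3_ends': "ends G' e3 = {b1, a'}" "e3 \<in> edges G'"
proof -
  have n: "a' \<notin> X" "a \<in> X" using X_B[OF cA(3)] ne X_A[OF a(1)] by simp_all
  then show "ends G' e3 = {b1, a'}" unfolding G'_ends e3_edge(2) by auto
  show "e3 \<in> edges G'" using n e3_edge by (simp add: G'_edges)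
qed

lemma G'_cross:
  assumes e: "e \<in> edges G'" "e \<noteq> e1" "e \<noteq> e3"
  obtains p q where "p \<in> A'" "q \<in> B" "ends G e = {p, q}" "(p, q) \<in> E" "ends G' e = {p, if q = b1 \<or> q = b2 then b1 else q}"
proof -
  have eG: "e \<in> edges G" "\<not> ends G e \<subseteq> X" using e by (simp_all add: G'_edges)
  have "ends G e2 \<subseteq> X" using en X_sub by simp
  then have "e \<noteq> e2" using eG by blast
  then obtain p q where pq: "p \<in> A" "q \<in> B" "ends G e = {p, q}" using cross[OF eG(1) e(2)] by blast
  have E: "(p, q) \<in> E" using pq eG by (auto simp: cross_pairs_def)
  have pa: "p \<noteq> a"
  proof
    assume p: "p = a"
    then have "q = b1 \<or> q = b2 \<or> q = a'" using E a_only by blast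
    moreover have "q \<noteq> b1 \<and> q \<noteq> b2" using eG pq p X_A[OF a(1)] X_sub by auto
    ultimately have "q = a'" by blast
    then have "e = e3" using simple[OF eG(1) e3_edge(1)] pq p e3_edge(2) by simp
    then show False using e by blast
  qed
  then have "p \<in> A'" using pq by (simp add: A'_def)
  moreover have "ends G' e = {p, if q = b1 \<or> q = b2 then b1 else q}"
    unfolding G'_ends pq(3) using X_A[OF pq(1)] X_B[OF pq(2)] pa by simp
  ultimately show thesis using that pq E by blast
qed

lemma A'B'_dj: "A' \<inter> B' = {}" using dj by (auto simp: A'_def B'_def)

lemma contract_pair: "bip_pair G' A' B' a1 a2 b1 a' e1 e3"
proof unfold_locales
  show "\<exists>p\<in>A'. \<exists>q\<in>B'. ends G' e = {p, q}" if e: "e \<in> edges G'" "e \<noteq> e1" "e \<noteq> e3" for e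
  proof -
    obtain p q where pq: "p \<in> A'" "q \<in> B" "ends G' e = {p, if q = b1 \<or> q = b2 then b1 else q}"
      using G'_cross[OF e] by metis
    have "(if q = b1 \<or> q = b2 then b1 else q) \<in> B'" using pq(2) inB distinct_ends by (simp add: B'_def)
    then show ?thesis using pq by blast
  qed
qed (fact G'_wf A'B'_dj G'_verts e1_ends' e3_ends' a12A')+

lemma E'_mem_G':
  assumes "(p, q) \<in> E" "p \<noteq> a"
  shows "(p, if q = b1 \<or> q = b2 then b1 else q) \<in> E'"
  using assms b1_only[of p] b2_only[of p] by (auto simp: E'_iff)

text \<open>The link between the graph contraction and the relation \<open>E'\<close>, through which
  the results on relations apply to \<open>G'\<close>.\<close>

lemma cross_pairs_contract: "bip_pair.cross_pairs G' A' B' (edges G') = E'"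
proof -
  interpret c: bip_pair G' A' B' a1 a2 b1 a' e1 e3 by (rule contract_pair)
  show ?thesis
  proof
    show "c.cross_pairs (edges G') \<subseteq> E'"
    proof
      fix x assume "x \<in> c.cross_pairs (edges G')"
      then obtain p q e where x: "x = (p, q)" "p \<in> A'" "q \<in> B'" "e \<in> edges G'" "ends G' e = {p, q}"
        by (auto simp: c.cross_pairs_def)
      have "e \<noteq> e1" "e \<noteq> e3" using x c.en c.inA c.inB c.dj by auto
      then obtain p' q' where pq: "p' \<in> A'" "q' \<in> B" "(p', q') \<in> E" "ends G' e = {p', if q' = b1 \<or> q' = b2 then b1 else q'}"
        using G'_cross[OF x(4)] by metis
      have "(if q' = b1 \<or> q' = b2 then b1 else q') \<in> B'" using pq(2) inB distinct_ends by (simp add: B'_def)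
      then have "p = p'" "q = (if q' = b1 \<or> q' = b2 then b1 else q')" using c.doubleton_cross_eq[OF x(2,3) pq(1)] x(5) pq(4) by auto
      moreover have "p' \<noteq> a" using pq(1) by (simp add: A'_def)
      ultimately show "x \<in> E'" using E'_mem_G' pq(3) x(1) by simp
    qed
    have m: "(p, if q = b1 \<or> q = b2 then b1 else q) \<in> c.cross_pairs (edges G')" if E: "(p, q) \<in> E" "p \<noteq> a" for p q
    proof -
      have pq: "p \<in> A" "q \<in> B" using E EAB by blast+
      obtain e where e: "e \<in> edges G" "ends G e = {p, q}" using E_edge[OF E(1)] by blast
      have pX: "p \<notin> X" using X_A[OF pq(1)] E(2) by simp
      then have "e \<in> edges G'" using e by (simp add: G'_edges)
      moreover have "ends G' e = {p, if q = b1 \<or> q = b2 then b1 else q}"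
        unfolding G'_ends e(2) using pX X_B[OF pq(2)] by simp
      moreover have "p \<in> A'" "(if q = b1 \<or> q = b2 then b1 else q) \<in> B'"
        using pq E(2) inB distinct_ends by (simp_all add: A'_def B'_def)
      ultimately show ?thesis unfolding c.cross_pairs_def by blast
    qed
    show "E' \<subseteq> c.cross_pairs (edges G')"
    proof
      fix x assume x: "x \<in> E'"
      obtain p q where pq: "x = (p, q)" by (cases x)
      show "x \<in> c.cross_pairs (edges G')"
      proof (cases "q = b1")
        case True
        then have "p = c1 \<or> p = c2" using x pq by (simp add: E'_iff)
        then show ?thesis using m[OF ab(4)] m[OF ab(5)] ne True pq by auto
      next
        case False
        then have "(p, q) \<in> E" "p \<noteq> a" "q \<noteq> b2" using x pq by (simp_all add: E'_iff)
        then show ?thesis using m[of p q] False pq by simp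
      qed
    qed
  qed
qed

lemma contract_core:
  assumes "(c1, a') \<in> E" "4 \<le> card A" shows "bip_core G' A' B' a1 a2 b1 a' e1 e3"
  unfolding bip_core_def cross_pairs_contract using contract_pair core'[OF assms] by blast

text \<open>The three edges at the new vertex are those leaving the triangle; at every other vertex
  nothing changes.\<close>

lemma contract_cubic: "cubic G'"
  unfolding cubic_def
proof
  fix v assume v: "v \<in> verts G'"
  show "card {e \<in> edges G'. v \<in> ends G' e} = 3"
  proof (cases "v = b1")
    case False
    then have vX: "v \<notin> X" "v \<in> A \<union> B" using v V X_sub by (auto simp: G'_def contract_def)
    have "{e \<in> edges G'. v \<in> ends G' e} = {e \<in> edges G. v \<in> ends G e}"
      unfolding G'_def by (rule contract_deg[OF vX(1) X_sub(2)])
    then show ?thesis using card_incident[OF vX(2)] by simp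
  next
    case True
    obtain f1 where f1: "f1 \<in> edges G" "f1 \<noteq> e1" "ends G f1 = {c1, b1}" using E_edge[OF ab(4)] by blast
    obtain f2 where f2: "f2 \<in> edges G" "f2 \<noteq> e1" "ends G f2 = {c2, b2}" using E_edge[OF ab(5)] by blast
    have nX: "c1 \<notin> X" "c2 \<notin> X" using X_A[OF cA(1)] X_A[OF cA(2)] ne by simp_all
    have "{e \<in> edges G'. b1 \<in> ends G' e} = {e3, f1, f2}"
    proof
      show "{e3, f1, f2} \<subseteq> {e \<in> edges G'. b1 \<in> ends G' e}"
      proof -
        have "f1 \<in> edges G'" "f2 \<in> edges G'" using f1 f2 nX by (simp_all add: G'_edges)
        moreover have "b1 \<in> ends G' f1" "b1 \<in> ends G' f2" unfolding G'_ends f1(3) f2(3) using X_sub by auto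
        moreover have "b1 \<in> ends G' e3" using e3_ends'(1) by simp
        ultimately show ?thesis using e3_ends'(2) by blast
      qed
      show "{e \<in> edges G'. b1 \<in> ends G' e} \<subseteq> {e3, f1, f2}"
      proof
        fix e assume e: "e \<in> {e \<in> edges G'. b1 \<in> ends G' e}"
        show "e \<in> {e3, f1, f2}"
        proof (cases "e = e3")
          case False
          have "e \<noteq> e1" using e e1_ends' inA inB dj by auto
          then obtain p q where pq: "p \<in> A'" "q \<in> B" "ends G e = {p, q}" "(p, q) \<in> E"
            "ends G' e = {p, if q = b1 \<or> q = b2 then b1 else q}" using G'_cross[of e] e False by blast
          have pa: "p \<noteq> a" "p \<noteq> b1" using pq(1) inB dj by (auto simp: A'_def)
          then have "q = b1 \<or> q = b2" using e pq(5) by (auto split: if_splits)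
          then have "ends G e = ends G f1 \<or> ends G e = ends G f2" using pq pa b1_only[of p] b2_only[of p] f1 f2 by auto
          moreover have "e \<in> edges G" using e by (simp add: G'_edges)
          ultimately show ?thesis using simple f1 f2 by blast
        qed simp
      qed
    qed
    moreover have "f1 \<noteq> f2"
      using f1 f2 ne cA bB dj by (auto simp: doubleton_eq_iff)
    moreover have "e3 \<noteq> f1" "e3 \<noteq> f2"
      using f1 f2 e3_edge ne cA bB a(1) dj by (auto simp: doubleton_eq_iff)
    ultimately show ?thesis using True by simp
  qed
qed

end

text \<open>The second conjunct is needed in the induction: the triangle edges of the contracted graph must stay
  nonremovable for the new triangle to have no removable edge.\<close>

definition ladder_bound :: "('v, 'e) mgraph \<Rightarrow> 'v set \<Rightarrow> 'v set \<Rightarrow> 'v \<Rightarrow> 'v \<Rightarrow> 'v \<Rightarrow> 'v \<Rightarrow> bool" where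
  "ladder_bound G A B a1 a2 b1 b2 \<longleftrightarrow>
     card {(p, q). removable_pair A B a1 a2 b1 b2 (bip_pair.cross_pairs G A B (edges G)) p q} + 3 \<le> card A \<and>
     (\<forall>u p q. in_triangle G u \<longrightarrow> removable_pair A B a1 a2 b1 b2 (bip_pair.cross_pairs G A B (edges G)) p q \<longrightarrow> u \<noteq> p \<and> u \<noteq> q)"

lemma ladder_bound_swap: "ladder_bound G A B a1 a2 b2 b1 \<longleftrightarrow> ladder_bound G A B a1 a2 b1 b2"
  unfolding ladder_bound_def removable_pair_swap(2)[where ?b1.0 = b1 and ?b2.0 = b2] ..

lemma in_triangleI:
  assumes "{x, y, z} \<subseteq> verts G" "distinct [x, y, z]" "adjacent G x y" "adjacent G x z" "adjacent G y z"
  shows "in_triangle G x" "in_triangle G y" "in_triangle G z"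
  unfolding in_triangle_def using assms adjacent_sym[of G] by auto

section \<open>Ladders have few removable edges\<close>

context bip_core begin

lemma ladder_bound_dual: assumes "ladder_bound G B A b1 b2 a1 a2" shows "ladder_bound G A B a1 a2 b1 b2"
proof -
  have r: "removable_pair B A b1 b2 a1 a2 (bip_pair.cross_pairs G B A (edges G)) q p \<longleftrightarrow> rm p q" for p q
    unfolding cross_pairs_dual by (rule removable_pair_converse[OF EAB])
  have e: "{(p, q). removable_pair B A b1 b2 a1 a2 (bip_pair.cross_pairs G B A (edges G)) p q} = {(p, q). rm p q}\<inverse>"
    using r by auto
  have "card {(p, q). removable_pair B A b1 b2 a1 a2 (bip_pair.cross_pairs G B A (edges G)) p q} + 3 \<le> card B"
    using assms by (simp add: ladder_bound_def)
  then have 1: "card {(p, q). rm p q} + 3 \<le> card A" unfolding e card_inverse using cardAB by simp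
  have 2: "u \<noteq> p \<and> u \<noteq> q" if "in_triangle G u" "rm p q" for u p q
    using assms that r[of q p] unfolding ladder_bound_def by blast
  show ?thesis unfolding ladder_bound_def using 1 2 by blast
qed

end

context cubic_core_tri begin

lemma G'_triangle: assumes "(c1, a') \<in> E" shows "in_triangle G' c1"
proof -
  interpret c: bip_pair G' A' B' a1 a2 b1 a' e1 e3 by (rule contract_pair)
  have "(c1, b1) \<in> E'" "(c1, a') \<in> E'" using assms ne by (simp_all add: E'_iff)
  then have "adjacent G' c1 b1" "adjacent G' c1 a'" using c.cross_pairs_adjacent unfolding cross_pairs_contract by blast+
  moreover have "adjacent G' b1 a'" using e3_ends' by (auto simp: adjacent_def)
  moreover have "{c1, b1, a'} \<subseteq> verts G'" "distinct [c1, b1, a']"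
    using a12A' ne A'B'_dj unfolding G'_verts by auto
  ultimately show ?thesis by (rule in_triangleI(1)[rotated 2])
qed

text \<open>A removable pair of \<open>G\<close> is one of the contraction or the rung, and
  \<open>A\<close> is larger than \<open>A'\<close> by one. All pairs at the triangle are
  nonremovable, by the rung or by the induction hypothesis on triangles.\<close>

lemma ladder_bound_step:
  assumes rung: "(c1, a') \<in> E" and big4: "4 \<le> card A" and IH: "ladder_bound G' A' B' a1 a2 b1 a'"
  shows "ladder_bound G A B a1 a2 b1 b2"
proof -
  interpret c: bip_pair G' A' B' a1 a2 b1 a' e1 e3 by (rule contract_pair)
  have IH1: "card {(p, q). rm' p q} + 3 \<le> card A'"
    and IH2: "\<And>u p q. in_triangle G' u \<Longrightarrow> rm' p q \<Longrightarrow> u \<noteq> p \<and> u \<noteq> q"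
    using IH unfolding ladder_bound_def cross_pairs_contract by blast+
  have key: "(rm' p q \<and> p \<noteq> a \<and> q \<noteq> b1 \<and> q \<noteq> b2) \<or> (p, q) = (c1, a')" if r: "rm p q" for p q
  proof -
    have E: "(p, q) \<in> E" using r by (simp add: removable_pair_def)
    \<comment> \<open>Removability of \<open>a b2\<close> would make \<open>c1 b1\<close> removable
      in the contraction, but \<open>c1\<close> lies in a triangle there.\<close>
    have n: "\<not> rm a b2" using rm_a_b2_imp[OF _ rung] IH2[OF G'_triangle[OF rung]] by blast
    have pa: "p \<noteq> a" using E a_only r n not_rm_a_b1[OF rung] not_rm_a_a' by blast
    have q1: "q \<noteq> b1" using E b1_only pa r not_rm_c1 by blast
    have q2: "q \<noteq> b2" using E b2_only pa r not_rm_c2 by blast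
    show ?thesis using rm_imp_rm'[OF r rung pa q1 q2] pa q1 q2 by blast
  qed
  have "finite E'" by (rule finite_subset[OF E'_sub]) (simp add: finA finB A'_def B'_def)
  then have finR: "finite {(p, q). rm' p q}" by (rule finite_subset[rotated]) (auto simp: removable_pair_def)
  have "{(p, q). rm p q} \<subseteq> insert (c1, a') {(p, q). rm' p q}" using key by blast
  then have "card {(p, q). rm p q} \<le> card (insert (c1, a') {(p, q). rm' p q})" using finR by (intro card_mono) simp_all
  also have "\<dots> \<le> card {(p, q). rm' p q} + 1" using finR by (simp add: card_insert_if)
  finally have c1: "card {(p, q). rm p q} + 3 \<le> card A" using IH1 card_A' by linarith
  have c1n: "c1 \<noteq> a1" "c1 \<noteq> a2" using c1_not_end[OF rung big4] da by blast+
  have tri: "u \<noteq> p \<and> u \<noteq> q" if t: "in_triangle G u" and r: "rm p q" for u p q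
  proof -
    have pq: "p \<in> A" "q \<in> B" "(p, q) \<in> E" using r EAB by (auto simp: removable_pair_def)
    obtain x y where xy: "{u, x, y} \<subseteq> A \<union> B" "u \<noteq> x" "u \<noteq> y" "x \<noteq> y" "adjacent G u x" "adjacent G u y" "adjacent G x y"
      using t V unfolding in_triangle_def by blast
    from triangle_cases[OF xy(5-7,2-4,1)] show ?thesis
    proof (elim disjE bexE conjE)
      fix \<alpha> assume al: "\<alpha> \<in> A" "{u, x, y} = {\<alpha>, b1, b2}" "(\<alpha>, b1) \<in> E" "(\<alpha>, b2) \<in> E"
      have "\<alpha> = a" using b1_only[OF al(3)] b2_only[OF al(4)] ne by blast
      then have u: "u \<in> {a, b1, b2}" using al(2) by blast
      have "p \<noteq> a" "q \<noteq> b1" "q \<noteq> b2" using key[OF r] ne by auto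
      moreover have "p \<noteq> b1" "p \<noteq> b2" "q \<noteq> a" using pq inB a(1) dj by auto
      ultimately show ?thesis using u by blast
    next
      fix \<beta> assume be: "\<beta> \<in> B" "{u, x, y} = {\<beta>, a1, a2}" "(a1, \<beta>) \<in> E" "(a2, \<beta>) \<in> E"
      have b: "\<beta> \<noteq> b1" "\<beta> \<noteq> b2"
        using be(3,4) b1_only[of a1] b1_only[of a2] b2_only[of a1] b2_only[of a2] a aA by metis+
      then have E': "(a1, \<beta>) \<in> E'" "(a2, \<beta>) \<in> E'" using be a by (auto simp: E'_iff)
      then have "adjacent G' a1 \<beta>" "adjacent G' a2 \<beta>" using c.cross_pairs_adjacent unfolding cross_pairs_contract by blast+
      moreover have "adjacent G' a1 a2" using e1_ends' by (auto simp: adjacent_def)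
      moreover have "\<beta> \<in> B'" using be(1) b by (simp add: B'_def)
      then have "{a1, a2, \<beta>} \<subseteq> verts G'" "distinct [a1, a2, \<beta>]"
        using a12A' A'B'_dj aA unfolding G'_verts by auto
      ultimately have "in_triangle G' a1" "in_triangle G' a2" "in_triangle G' \<beta>" using in_triangleI by metis+
      moreover have u: "u \<in> {\<beta>, a1, a2}" using be(2) by blast
      ultimately have tu: "in_triangle G' u" by blast
      from key[OF r] show ?thesis
      proof
        assume "rm' p q \<and> p \<noteq> a \<and> q \<noteq> b1 \<and> q \<noteq> b2"
        then show ?thesis using IH2[OF tu] by blast
      next
        \<comment> \<open>The rung stays clear of the triangle on \<open>a1\<close>,
          \<open>a2\<close>: \<open>c1\<close> is not an end of \<open>e1\<close>, and
          \<open>a'\<close> as its third vertex would have four neighbours.\<close>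
        assume e: "(p, q) = (c1, a')"
        have "u \<noteq> c1" using u c1n cA(1) be(1) dj by auto
        moreover have "u \<noteq> a'"
        proof
          assume ua: "u = a'"
          then have "a' = \<beta>" using u cA(3) inA dj by auto
          then have "{a1, a2, a, c1} \<subseteq> E\<inverse> `` {a'}" using be ab rung by blast
          then have "card {a1, a2, a, c1} \<le> card (E\<inverse> `` {a'})"
            using core.finN[OF dual] by (intro card_mono) 
          then show False using dB[OF cA(3) ne(1,2)] aA a c1n ne by (simp add: card_insert_if split: if_splits)
        qed
        ultimately show ?thesis using e by simp
      qed
    qed
  qed
  show ?thesis unfolding ladder_bound_def using c1 tri by blast
qed

lemma ladder_contract_step:
  assumes rung: "(c1, a') \<in> E" and ladder: "ladder (contract G X x)" and x: "x \<in> X"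
    and IH: "\<And>(G2::('v, 'e) mgraph) A2 B2 a1 a2 b1 b2 e1 e2. card (verts G2) < card (verts G) \<Longrightarrow> ladder G2 \<Longrightarrow>
      cubic_core G2 A2 B2 a1 a2 b1 b2 e1 e2 \<Longrightarrow> ladder_bound G2 A2 B2 a1 a2 b1 b2"
  shows "ladder_bound G A B a1 a2 b1 b2"
proof -
  have t: "ladder G'" unfolding G'_def
    by (rule ladder_iso[OF ladder contract_wf[OF wf x X_sub(1)] contract_point_iso[OF x X_sub(2,1)]])
  have "card (verts G') = card A' + card B'" unfolding G'_verts
    using A'B'_dj finA finB by (intro card_Un_disjoint) (simp_all add: A'_def B'_def)
  then have cG': "card (verts G') + 2 = card A + card B" using card_A' by simp
  have big4: "4 \<le> card A" using ladder_card[OF t G'_wf] cG' cardAB by simp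
  have "card (verts G) = card A + card B" unfolding V using dj finA finB by (intro card_Un_disjoint)
  then have lt: "card (verts G') < card (verts G)" using cG' by simp
  have "cubic_core G' A' B' a1 a2 b1 a' e1 e3"
    unfolding cubic_core_def cubic_core_axioms_def using contract_core[OF rung big4] ladder_cubic[OF t G'_wf] by blast
  from ladder_bound_step[OF rung big4 IH[OF lt t this]] show ?thesis .
qed

end

context cubic_core begin

text \<open>The rung comes from the triangle at the contracted vertex \<open>b1\<close>. If that
  triangle contains the new special edge \<open>b1 a'\<close>, its third vertex is \<open>c1\<close>
  or \<open>c2\<close> and is adjacent to \<open>a'\<close>. If it contains \<open>e1\<close>, then
  \<open>a1\<close>, \<open>a2\<close> are \<open>c1\<close>, \<open>c2\<close>, which
  \<open>not_both_ends\<close> excludes.\<close>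

lemma ladder_bound_triangle:
  assumes a: "a \<in> A" "(a, b1) \<in> E" "(a, b2) \<in> E"
    and ladder: "ladder (contract G {a, b1, b2} x)" and x: "x \<in> {a, b1, b2}" and t: "in_triangle (contract G {a, b1, b2} x) x"
    and IH: "\<And>(G2::('a, 'b) mgraph) A2 B2 a1 a2 b1 b2 e1 e2. card (verts G2) < card (verts G) \<Longrightarrow> ladder G2 \<Longrightarrow>
      cubic_core G2 A2 B2 a1 a2 b1 b2 e1 e2 \<Longrightarrow> ladder_bound G2 A2 B2 a1 a2 b1 b2"
  shows "ladder_bound G A B a1 a2 b1 b2"
proof -
  obtain a' c1 c2 where "cubic_tri A B E a1 a2 b1 b2 a a' c1 c2" using triangle_imp_cubic_tri[OF a] by blast
  then interpret t: cubic_core_tri G A B a1 a2 b1 b2 e1 e2 a a' c1 c2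
    unfolding cubic_core_tri_def using cubic_core_axioms by blast
  interpret s: cubic_core_tri G A B a1 a2 b2 b1 e1 e2 a a' c2 c1
    unfolding cubic_core_tri_def using swap_cubic_core t.swap_cubic by blast
  interpret c: bip_pair t.G' t.A' t.B' a1 a2 b1 a' e1 t.e3 by (rule t.contract_pair)
  have X: "t.X = {a, b1, b2}" "s.X = {a, b1, b2}" by (auto simp: t.X_def s.X_def)
  have xX: "x \<in> t.X" using x X by simp
  have ladder': "ladder t.G'" unfolding t.G'_def
    by (rule ladder_iso[OF ladder[folded X(1)] contract_wf[OF wf xX t.X_sub(1)] contract_point_iso[OF xX t.X_sub(2,1)]])
  have "card (verts t.G') = card t.A' + card t.B'" unfolding t.G'_verts
    using t.A'B'_dj finA finB by (intro card_Un_disjoint) (simp_all add: t.A'_def t.B'_def)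
  then have big4: "4 \<le> card A" using ladder_card[OF ladder' t.G'_wf] t.card_A' cardAB by simp
  have tt: "in_triangle t.G' b1"
    using iso_by_in_triangle[OF contract_point_iso[OF xX t.X_sub(2,1)] t[folded X(1)]] unfolding t.G'_def by simp
  then obtain y z where yz: "b1 \<noteq> y" "b1 \<noteq> z" "y \<noteq> z" "{b1, y, z} \<subseteq> t.A' \<union> t.B'"
    "adjacent t.G' b1 y" "adjacent t.G' b1 z" "adjacent t.G' y z"
    unfolding in_triangle_def t.G'_verts by blast
  have "(c1, a') \<in> E \<or> (c2, a') \<in> E"
    using c.triangle_cases[OF yz(5-7,1-3,4)] unfolding t.cross_pairs_contract
  proof (elim disjE bexE conjE)
    fix \<alpha> assume "(\<alpha>, b1) \<in> t.E'" "(\<alpha>, a') \<in> t.E'"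
    then show ?thesis using t.ne by (auto simp: t.E'_iff)
  next
    fix \<beta> assume be: "\<beta> \<in> t.B'" "{b1, y, z} = {\<beta>, a1, a2}" "(a1, \<beta>) \<in> t.E'" "(a2, \<beta>) \<in> t.E'"
    have "b1 \<in> {\<beta>, a1, a2}" using be(2) by blast
    then have "\<beta> = b1" using inA inB dj by auto
    then have "a1 = c1 \<or> a1 = c2" "a2 = c1 \<or> a2 = c2" using be by (auto simp: t.E'_iff)
    then have "{c1, c2} = {a1, a2}" using distinct_ends by auto
    then show ?thesis using t.not_both_ends[OF big4] by blast
  qed
  then show ?thesis
  proof
    assume r: "(c1, a') \<in> E"
    show ?thesis by (rule t.ladder_contract_step[OF r _ xX IH]) (use ladder X in simp_all)
  next
    assume r: "(c2, a') \<in> E"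
    have xs: "x \<in> s.X" using x X by simp
    have "ladder_bound G A B a1 a2 b2 b1" by (rule s.ladder_contract_step[OF r _ xs IH]) (use ladder X in simp_all)
    then show ?thesis by (rule ladder_bound_swap[THEN iffD1])
  qed
qed

text \<open>With three vertices in each class both \<open>c1\<close> and \<open>c2\<close> are
  adjacent to \<open>a'\<close>, so \<open>not_rm_a_b1\<close> applies from either side. This
  settles one of the two triangles; the other one follows by exchanging the classes.\<close>

lemma three_half:
  assumes c3: "card A = 3"
  obtains a where "a \<in> A" "a \<noteq> a1" "a \<noteq> a2" "\<And>q. \<not> rm a q" "\<And>p. \<not> rm p b1" "\<And>p. \<not> rm p b2"
proof -
  have "card (A - {a1, a2}) = 1" using c3 card_removed by simp
  then obtain a where Aa: "A - {a1, a2} = {a}" by (meson card_1_singletonE)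
  then have a: "a \<in> A" "a \<noteq> a1" "a \<noteq> a2" by blast+
  have "E `` {a} = B" using dA[OF a] c3 cardAB NB[of "{a}"] by (intro card_seteq[OF finB]) simp_all
  then obtain a' c1 c2 where tight: "cubic_tri A B E a1 a2 b1 b2 a a' c1 c2"
    using triangle_imp_cubic_tri[OF a(1)] inB by blast
  then interpret t: cubic_tri A B E a1 a2 b1 b2 a a' c1 c2 .
  interpret s: cubic_tri A B E a1 a2 b2 b1 a a' c2 c1 by (rule t.swap_cubic)
  have "E\<inverse> `` {a'} = A"
    using dB[OF t.cA(3) t.ne(1,2)] c3 core.NB[OF dual, of "{a'}"] by (intro card_seteq[OF finA]) simp_all
  then have r: "(c1, a') \<in> E" "(c2, a') \<in> E" using t.cA by blast+
  have n: "\<not> rm a b1" "\<not> rm a b2" "\<not> rm a a'" "\<not> rm c1 b1" "\<not> rm c2 b2"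
    using t.not_rm_a_b1[OF r(1)] s.not_rm_a_b1[OF r(2)] t.not_rm_a_a' t.not_rm_c1 t.not_rm_c2 by (simp_all add: removable_pair_swap)
  have rE: "(p, q) \<in> E" if "rm p q" for p q using that by (simp add: removable_pair_def)
  show thesis
  proof (rule that[OF a])
    show "\<not> rm a q" for q using n t.a_only rE by blast
    show "\<not> rm p b1" for p using n t.b1_only rE by blast
    show "\<not> rm p b2" for p using n t.b2_only rE by blast
  qed
qed

lemma ladder_bound_three: assumes c3: "card A = 3" shows "ladder_bound G A B a1 a2 b1 b2"
proof -
  interpret d: cubic_core G B A b1 b2 a1 a2 e2 e1 by (rule dual_cubic_core)
  have r: "d.rm q p \<longleftrightarrow> rm p q" for p q
    unfolding cross_pairs_dual by (rule removable_pair_converse[OF EAB])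
  obtain a where a: "a \<in> A" "a \<noteq> a1" "a \<noteq> a2" "\<And>q. \<not> rm a q" using three_half[OF c3] by metis
  have "\<not> rm a1 q \<and> \<not> rm a2 q" for q using d.three_half c3 cardAB unfolding r by metis
  moreover have "A \<subseteq> {a1, a2, a}"
  proof -
    have "{a1, a2, a} = A" using a inA distinct_ends c3 by (intro card_seteq[OF finA]) simp_all
    then show ?thesis by simp
  qed
  moreover have "p \<in> A" if "rm p q" for p q
  proof -
    have "(p, q) \<in> E" using that by (simp add: removable_pair_def)
    then show ?thesis using EAB by blast
  qed
  ultimately have none: "\<not> rm p q" for p q using a(4) by blast
  then have e: "{(p, q). rm p q} = {}" by blast
  show ?thesis unfolding ladder_bound_def e using c3 none by simp
qed

end

text \<open>Induction on the number of vertices. The triangle added by the last splicing contains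
  \<open>e1\<close> or \<open>e2\<close>; the first case is the second with the classes
  exchanged.\<close>

theorem ladder_imp_bound:
  assumes "ladder G" "cubic_core G A B a1 a2 b1 b2 e1 e2" shows "ladder_bound G A B a1 a2 b1 b2"
  using assms
proof (induction "card (verts G)" arbitrary: G A B a1 a2 b1 b2 e1 e2 rule: less_induct)
  case less
  interpret cubic_core G A B a1 a2 b1 b2 e1 e2 by (rule less.prems(2))
  have cV: "card (verts G) = card A + card B" unfolding V using dj finA finB by (intro card_Un_disjoint)
  note IH = less.hyps
  from less.prems(1) show ?case
  proof (cases rule: ladder.cases)
    case base
    then have "card (verts G) = card (verts C6bar)" using bij_betw_same_card by (auto simp: graph_iso_def)
    then have "card A = 3" using cV cardAB by (simp add: C6bar_def)
    then show ?thesis by (rule ladder_bound_three)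
  next
    case (step X x xb w)
    note K = K4_contract[OF step(1,3) wf step(7)]
    obtain x0 y0 z0 where X: "X = {x0, y0, z0}" "x0 \<noteq> y0" "x0 \<noteq> z0" "y0 \<noteq> z0"
      using K(1) by (auto simp: card_3_iff)
    have ad: "adjacent G x0 y0" "adjacent G x0 z0" "adjacent G y0 z0" using K(2) X by simp_all
    have sub: "{x0, y0, z0} \<subseteq> A \<union> B" using step(1) X V by simp
    from triangle_cases[OF ad X(2-4) sub] show ?thesis
    proof (elim disjE bexE conjE)
      fix a assume a: "a \<in> A" "{x0, y0, z0} = {a, b1, b2}" "(a, b1) \<in> E" "(a, b2) \<in> E"
      have XX: "X = {a, b1, b2}" using a(2) X(1) by simp
      show ?thesis by (rule ladder_bound_triangle[OF a(1,3,4) step(4,2,5)[unfolded XX] IH])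
    next
      fix b assume b: "b \<in> B" "{x0, y0, z0} = {b, a1, a2}" "(a1, b) \<in> E" "(a2, b) \<in> E"
      have XX: "X = {b, a1, a2}" using b(2) X(1) by simp
      interpret d: cubic_core G B A b1 b2 a1 a2 e2 e1 by (rule dual_cubic_core)
      have "(b, a1) \<in> d.E" "(b, a2) \<in> d.E" using b(3,4) unfolding cross_pairs_dual by blast+
      then have "ladder_bound G B A b1 b2 a1 a2" by (rule d.ladder_bound_triangle[OF b(1) _ _ step(4,2,5)[unfolded XX] IH])
      then show ?thesis by (rule ladder_bound_dual)
    qed
  qed
qed

section \<open>The extremal graphs\<close>

text \<open>When edges are their own end sets, the vertex map determines the edge map; its
  injectivity comes for free from surjectivity and the edge count.\<close>

lemma iso_by_id_ends:
  assumes f: "bij_betw f (verts G) (verts H)" and H: "ends H = id"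
    and g: "(\<lambda>e. f ` ends G e) ` edges G = edges H" and c: "card (edges G) \<le> card (edges H)" and fin: "finite (edges G)"
  shows "iso_by f (\<lambda>e. f ` ends G e) G H"
proof -
  have "inj_on (\<lambda>e. f ` ends G e) (edges G)"
    by (rule eq_card_imp_inj_on[OF fin]) (use g c card_image_le[OF fin, of "\<lambda>e. f ` ends G e"] in simp)
  then show ?thesis using f H g by (simp add: iso_by_def bij_betw_def)
qed

lemma card_edges_C6bar: "card (edges C6bar) = 9"
  unfolding edges_C6bar by (simp add: doubleton_eq_iff)

lemma card_edges_K4: "card (edges K4) = 6"
  unfolding edges_K4 by (simp add: doubleton_eq_iff)

section \<open>Building ladders from cubic graphs with a triangle\<close>

context cubic_core_tri begin

lemma distinct_X: "a \<noteq> b1" "a \<noteq> b2" "b1 \<noteq> b2" "c1 \<notin> X" "c2 \<notin> X" "a' \<notin> X" "c1 \<noteq> b1" "c1 \<noteq> b2" "c2 \<noteq> b1" "c2 \<noteq> b2"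
  "a \<noteq> a'" "c1 \<noteq> a'" "c2 \<noteq> a'"
  using a(1) cA inB dj ne distinct_ends by (auto simp: X_def)

lemma X_edges:
  obtains g1 g2 f1 f2 where
    "ends G g1 = {a, b1}" "ends G g2 = {a, b2}" "ends G f1 = {c1, b1}" "ends G f2 = {c2, b2}"
    "{e \<in> edges G. ends G e \<inter> X \<noteq> {}} = {e2, g1, g2, e3, f1, f2}"
proof -
  obtain g1 where g1: "g1 \<in> edges G" "ends G g1 = {a, b1}" using E_edge[OF ab(1)] by blast
  obtain g2 where g2: "g2 \<in> edges G" "ends G g2 = {a, b2}" using E_edge[OF ab(2)] by blast
  obtain f1 where f1: "f1 \<in> edges G" "ends G f1 = {c1, b1}" using E_edge[OF ab(4)] by blast
  obtain f2 where f2: "f2 \<in> edges G" "ends G f2 = {c2, b2}" using E_edge[OF ab(5)] by blast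
  have "{e \<in> edges G. ends G e \<inter> X \<noteq> {}} = {e2, g1, g2, e3, f1, f2}"
  proof
    show "{e2, g1, g2, e3, f1, f2} \<subseteq> {e \<in> edges G. ends G e \<inter> X \<noteq> {}}"
      using g1 g2 f1 f2 e3_edge e12 en by (simp add: X_def)
    show "{e \<in> edges G. ends G e \<inter> X \<noteq> {}} \<subseteq> {e2, g1, g2, e3, f1, f2}"
    proof
      fix e assume "e \<in> {e \<in> edges G. ends G e \<inter> X \<noteq> {}}"
      then have e: "e \<in> edges G" "ends G e \<inter> X \<noteq> {}" by blast+
      have "e \<noteq> e1"
      proof
        assume "e = e1"
        then have "a1 \<in> X \<or> a2 \<in> X" using e(2) en by auto
        then show False using X_A[OF inA(1)] X_A[OF inA(2)] a by auto
      qed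
      show "e \<in> {e2, g1, g2, e3, f1, f2}"
      proof (cases "e = e2")
        case False
        then obtain p q where pq: "p \<in> A" "q \<in> B" "ends G e = {p, q}" using cross[OF e(1) \<open>e \<noteq> e1\<close>] by blast
        have pqE: "(p, q) \<in> E" using pq e by (auto simp: cross_pairs_def)
        have "p = a \<or> q = b1 \<or> q = b2" using e(2) pq X_A[OF pq(1)] X_B[OF pq(2)] by auto
        then have "(p = a \<and> (q = b1 \<or> q = b2 \<or> q = a')) \<or> (p = c1 \<and> q = b1) \<or> (p = c2 \<and> q = b2)"
          using pqE a_only b1_only b2_only by blast
        then have "ends G e \<in> {ends G g1, ends G g2, ends G e3, ends G f1, ends G f2}"
          unfolding pq(3) g1(2) g2(2) e3_edge(2) f1(2) f2(2) by (elim disjE conjE) simp_all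
        then show ?thesis using simple[OF e(1)] g1 g2 e3_edge f1 f2 by blast
      qed simp
    qed
  qed
  then show thesis using that g1 g2 f1 f2 by blast
qed

lemma iso_K4: "iso_pt (contract G (verts G - X) c1) c1 K4 0"
proof -
  let ?C = "contract G (verts G - X) c1"
  obtain g1 g2 f1 f2 where ed: "ends G g1 = {a, b1}" "ends G g2 = {a, b2}" "ends G f1 = {c1, b1}" "ends G f2 = {c2, b2}"
    and S: "{e \<in> edges G. ends G e \<inter> X \<noteq> {}} = {e2, g1, g2, e3, f1, f2}" by (rule X_edges)
  have "edges ?C = {e \<in> edges G. ends G e \<inter> X \<noteq> {}}"
    using wf_ends[OF wf] by (auto simp: contract_def)
  then have edC: "edges ?C = set [e2, g1, g2, e3, f1, f2]" using S by simp
  have V': "verts ?C = {c1, a, b1, b2}" using X_sub V cA by (auto simp: contract_def X_def)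
  have inX: "a \<in> X" "b1 \<in> X" "b2 \<in> X" by (simp_all add: X_def)
  have inV: "c1 \<in> verts G - X" "c2 \<in> verts G - X" "a' \<in> verts G - X" using V cA distinct_X by blast+
  have enC: "ends ?C e2 = {b1, b2}" "ends ?C g1 = {a, b1}" "ends ?C g2 = {a, b2}" "ends ?C e3 = {a, c1}"
    "ends ?C f1 = {c1, b1}" "ends ?C f2 = {c1, b2}"
    using inX inV by (simp_all add: contract_def ed e3_edge en insert_commute)
  define f where "f v = (if v = c1 then 0 else if v = a then 1 else if v = b1 then 2 else (3::nat))" for v
  have fv: "f c1 = 0" "f a = 1" "f b1 = 2" "f b2 = 3" using distinct_X ne by (simp_all add: f_def)
  have "iso_by f (\<lambda>e. f ` ends ?C e) ?C K4"
  proof (rule iso_by_id_ends)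
    show "bij_betw f (verts ?C) (verts K4)"
      unfolding V' K4_def using fv distinct_X ne by (auto simp: bij_betw_def inj_on_def)
    show "ends K4 = id" by (simp add: K4_def)
    show "(\<lambda>e. f ` ends ?C e) ` edges ?C = edges K4"
      unfolding edC edges_K4 by (simp add: enC fv insert_commute)
    show "card (edges ?C) \<le> card (edges K4)" unfolding edC card_edges_K4 using card_length[of "[e2, g1, g2, e3, f1, f2]"] by simp
    show "finite (edges ?C)" unfolding edC by simp
  qed
  then show ?thesis using fv(1) unfolding iso_pt_by by blast
qed

lemma G'_triangle_b1: assumes "(c1, a') \<in> E" shows "in_triangle G' b1"
proof -
  interpret c: bip_pair G' A' B' a1 a2 b1 a' e1 e3 by (rule contract_pair)
  have "(c1, b1) \<in> E'" "(c1, a') \<in> E'" using assms ne by (simp_all add: E'_iff)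
  then have "adjacent G' c1 b1" "adjacent G' c1 a'" using c.cross_pairs_adjacent unfolding cross_pairs_contract by blast+
  moreover have "adjacent G' b1 a'" using e3_ends' by (auto simp: adjacent_def)
  moreover have "{c1, b1, a'} \<subseteq> verts G'" "distinct [c1, b1, a']"
    using a12A' ne A'B'_dj unfolding G'_verts by auto
  ultimately show ?thesis by (rule in_triangleI(2)[rotated 2])
qed

text \<open>Contracting everything outside the triangle gives \<open>K4\<close>, and the rung puts
  the contracted vertex \<open>b1\<close> into the triangle \<open>c1 b1 a'\<close>, as a splicing
  step demands.\<close>

lemma ladder_expand: assumes "(c1, a') \<in> E" "ladder G'" shows "ladder G"
proof (rule ladder.step[OF X_sub(1,2) _ assms(2)[unfolded G'_def] G'_triangle_b1[OF assms(1), unfolded G'_def] _ iso_K4])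
  show "c1 \<in> verts G - X" using V cA distinct_X by blast
  show "0 \<in> verts K4" by (simp add: K4_def)
qed

lemma ladder_prism: assumes c3: "card A = 3" shows "ladder G"
proof -
  have A: "A = {a, c1, c2}" using a cA ne c3 by (intro card_seteq[OF finA, symmetric]) simp_all
  have B: "B = {a', b1, b2}" using inB cA ne distinct_ends c3 cardAB by (intro card_seteq[OF finB, symmetric]) simp_all
  have "E\<inverse> `` {a'} = A"
    using dB[OF cA(3) ne(1,2)] c3 core.NB[OF dual, of "{a'}"] by (intro card_seteq[OF finA]) simp_all
  then have r: "(c1, a') \<in> E" "(c2, a') \<in> E" using cA by blast+
  have "{a1, a2} = {c1, c2}" using inA A a distinct_ends by auto
  then have en1: "ends G e1 = {c1, c2}" using en by simp
  obtain g1 g2 f1 f2 where ed: "ends G g1 = {a, b1}" "ends G g2 = {a, b2}" "ends G f1 = {c1, b1}" "ends G f2 = {c2, b2}"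
    and S: "{e \<in> edges G. ends G e \<inter> X \<noteq> {}} = {e2, g1, g2, e3, f1, f2}" by (rule X_edges)
  obtain h1 where h1: "h1 \<in> edges G" "ends G h1 = {c1, a'}" using E_edge[OF r(1)] by blast
  obtain h2 where h2: "h2 \<in> edges G" "ends G h2 = {c2, a'}" using E_edge[OF r(2)] by blast
  have edG: "edges G = set [e1, h1, h2, e2, g1, g2, e3, f1, f2]"
  proof
    have "{e2, g1, g2, e3, f1, f2} \<subseteq> edges G" unfolding S[symmetric] by blast
    then show "set [e1, h1, h2, e2, g1, g2, e3, f1, f2] \<subseteq> edges G" using h1 h2 e12 by simp
    show "edges G \<subseteq> set [e1, h1, h2, e2, g1, g2, e3, f1, f2]"
    proof
      fix e assume e: "e \<in> edges G"
      show "e \<in> set [e1, h1, h2, e2, g1, g2, e3, f1, f2]"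
      proof (cases "e = e1 \<or> ends G e \<inter> X \<noteq> {}")
        case True
        then have "e = e1 \<or> e \<in> {e \<in> edges G. ends G e \<inter> X \<noteq> {}}" using e by blast
        then show ?thesis unfolding S by auto
      next
        case False
        have "ends G e2 \<inter> X \<noteq> {}" using en X_sub by simp
        then have "e \<noteq> e2" using False by blast
        then obtain p q where pq: "p \<in> A" "q \<in> B" "ends G e = {p, q}" using cross[OF e] False by blast
        have "p \<noteq> a" "q \<noteq> b1" "q \<noteq> b2" using False pq X_A[OF pq(1)] X_B[OF pq(2)] by auto
        then have "p = c1 \<or> p = c2" "q = a'" using pq A B by auto
        then have "ends G e = ends G h1 \<or> ends G e = ends G h2" using pq h1 h2 by auto
        then show ?thesis using simple[OF e] h1 h2 by auto
      qed
    qed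
  qed
  \<comment> \<open>The triangle \<open>a\<close>, \<open>b1\<close>, \<open>b2\<close> goes to 0,
    2, 4, and the outer neighbours \<open>a'\<close>, \<open>c1\<close>, \<open>c2\<close> go to 3,
    5, 1, the partners of these numbers in the matching of the prism.\<close>
  define f where "f v = (if v = a then 0 else if v = b1 then 2 else if v = b2 then 4 else if v = a' then 3
      else if v = c1 then 5 else (1::nat))" for v
  have fv: "f a = 0" "f b1 = 2" "f b2 = 4" "f a' = 3" "f c1 = 5" "f c2 = 1"
    using distinct_X ne by (simp_all add: f_def)
  have V': "verts G = {a, c2, b1, a', b2, c1}" using V A B by auto
  have "iso_by f (\<lambda>e. f ` ends G e) G C6bar"
  proof (rule iso_by_id_ends)
    have "f ` verts G = verts C6bar" unfolding V' by (simp add: fv C6bar_def)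
    moreover have "inj_on f (verts G)" unfolding V' using fv by (auto simp: inj_on_def)
    ultimately show "bij_betw f (verts G) (verts C6bar)" by (simp add: bij_betw_def)
    show "ends C6bar = id" by (simp add: C6bar_def)
    show "(\<lambda>e. f ` ends G e) ` edges G = edges C6bar"
      unfolding edG edges_C6bar by (simp add: ed e3_edge en1 en(2) h1 h2 fv insert_commute)
    show "card (edges G) \<le> card (edges C6bar)" unfolding edG card_edges_C6bar
      using card_length[of "[e1, h1, h2, e2, g1, g2, e3, f1, f2]"] by simp
    show "finite (edges G)" by (rule fin)
  qed
  then show ?thesis unfolding graph_iso_by[symmetric] by (intro ladder.base) (auto simp: graph_iso_by)
qed

end

text \<open>The hypothesis is weaker than equality in the bound and is chosen to survive
  contraction: by \<open>nonrem'_card\<close> it can fail only at \<open>c1\<close>, which is the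
  apex of the new triangle and thus exempt.\<close>

theorem quasi_extremal_ladder:
  assumes "cubic_core_tri G A B a1 a2 b1 b2 e1 e2 a a' c1 c2"
    and "\<And>p. p \<in> A \<Longrightarrow> p \<noteq> a1 \<Longrightarrow> p \<noteq> a2 \<Longrightarrow> p \<noteq> a \<Longrightarrow>
      2 \<le> card (core.nonrem A B (bip_pair.cross_pairs G A B (edges G)) a1 a2 b1 b2 p)"
  shows "ladder G"
  using assms
proof (induction "card A" arbitrary: G A B a1 a2 b1 b2 e1 e2 a a' c1 c2 rule: less_induct)
  case less
  interpret t: cubic_core_tri G A B a1 a2 b1 b2 e1 e2 a a' c1 c2 by (rule less.prems(1))
  interpret s: cubic_core_tri G A B a1 a2 b2 b1 e1 e2 a a' c2 c1
    unfolding cubic_core_tri_def using t.swap_cubic_core t.swap_cubic by blast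
  \<comment> \<open>Stated for either naming of \<open>b1\<close> and \<open>b2\<close>, since the
    rung may start at \<open>c1\<close> or at \<open>c2\<close>.\<close>
  have step: "ladder G" if t: "cubic_core_tri G A B a1 a2 \<beta>1 \<beta>2 e1 e2 a a' \<gamma>1 \<gamma>2" and r: "(\<gamma>1, a') \<in> t.E" and big4: "4 \<le> card A"
    and nonrem: "\<And>p. p \<in> A \<Longrightarrow> p \<noteq> a1 \<Longrightarrow> p \<noteq> a2 \<Longrightarrow> p \<noteq> a \<Longrightarrow> 2 \<le> card (core.nonrem A B t.E a1 a2 \<beta>1 \<beta>2 p)"
    for \<beta>1 \<beta>2 \<gamma>1 \<gamma>2
  proof -
    interpret u: cubic_core_tri G A B a1 a2 \<beta>1 \<beta>2 e1 e2 a a' \<gamma>1 \<gamma>2 by (rule t)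
    obtain w y where wy: "cubic_tri u.A' u.B' u.E' a1 a2 \<beta>1 a' \<gamma>1 w \<gamma>2 y" using u.cubic_tri'[OF r big4] by blast
    have "cubic_core_tri u.G' u.A' u.B' a1 a2 \<beta>1 a' e1 u.e3 \<gamma>1 w \<gamma>2 y"
      unfolding cubic_core_tri_def cubic_core_def cubic_core_axioms_def u.cross_pairs_contract
      using wy u.contract_core[OF r big4] u.contract_cubic by blast
    moreover have "card u.A' < card A" using u.card_A' by simp
    moreover have "2 \<le> card (core.nonrem u.A' u.B' (bip_pair.cross_pairs u.G' u.A' u.B' (edges u.G')) a1 a2 \<beta>1 a' p)"
      if "p \<in> u.A'" "p \<noteq> a1" "p \<noteq> a2" "p \<noteq> \<gamma>1" for p
    proof -
      have "p \<in> A" "p \<noteq> a" using that by (simp_all add: u.A'_def)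
      then have "2 \<le> card (u.nonrem p)" using nonrem that by blast
      then show ?thesis unfolding u.cross_pairs_contract using u.nonrem'_card[OF r big4 that(1,4)] by linarith
    qed
    ultimately have "ladder u.G'" using less.hyps by blast
    then show ?thesis by (rule u.ladder_expand[OF r])
  qed
  show ?case
  proof (cases "card A = 3")
    case True
    then show ?thesis by (rule t.ladder_prism)
  next
    case False
    then have big4: "4 \<le> card A" using t.big by simp
    have "(c1, a') \<in> t.E \<or> (c2, a') \<in> t.E" using t.rung[OF big4] less.prems(2) by blast
    then show ?thesis
    proof
      assume r: "(c1, a') \<in> t.E"
      show ?thesis by (rule step[OF less.prems(1) r big4 less.prems(2)])
    next
      assume r: "(c2, a') \<in> t.E"
      show ?thesis
        by (rule step[OF s.cubic_core_tri_axioms r big4]) (use less.prems(2) in \<open>simp add: t.nonrem_swap\<close>)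
    qed
  qed
qed

section \<open>Counting removable edges of a brick\<close>

locale brick_core = bip_core + assumes br: "brick G" and mc: "matching_covered G"
begin

definition R :: "'b set" where "R = {e \<in> edges G. removable G e}"

lemma dual_brick_core: "brick_core G B A b1 b2 a1 a2 e2 e1"
  unfolding brick_core_def brick_core_axioms_def using dual_bip_core br mc by blast

lemma finR: "finite R" using fin by (simp add: R_def)

lemma R_cross: assumes "e \<in> R" obtains p q where "p \<in> A" "q \<in> B" "ends G e = {p, q}" "(p, q) \<in> E" "e \<in> edges G"
proof -
  have e: "e \<in> edges G" "removable G e" using assms by (simp_all add: R_def)
  then have "e \<noteq> e1" "e \<noteq> e2" using not_removable_12 by blast+
  then obtain p q where "p \<in> A" "q \<in> B" "ends G e = {p, q}" using cross e by blast
  then show thesis using that e by (auto simp: cross_pairs_def)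
qed

lemma nonremovable_nonrem:
  assumes "e \<in> edges G" "ends G e = {p, q}" "p \<in> A" "q \<in> B" "e \<notin> R"
  shows "q \<in> nonrem p" "\<And>f. f \<in> edges G \<Longrightarrow> ends G f = {p, q} \<Longrightarrow> f = e"
proof -
  have "\<not> removable G e" using assms by (simp add: R_def)
  then have n: "\<not> (\<exists>e'\<in>edges G. e' \<noteq> e \<and> ends G e' = {p, q})" "\<not> rm p q"
    using removable_cross[OF br mc assms(1-4)] by blast+
  have "(p, q) \<in> E" using assms by (auto simp: cross_pairs_def)
  then show "q \<in> nonrem p" using n by (simp add: nonrem_def)
  show "\<And>f. f \<in> edges G \<Longrightarrow> ends G f = {p, q} \<Longrightarrow> f = e" using n by blast
qed

lemma fin_nonrem: "finite (nonrem p)"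
  by (rule finite_subset[of _ "N {p}"]) (auto simp: nonrem_def)

text \<open>A nonremovable edge has no parallel copy, so counting such edges amounts to counting
  nonremovable pairs.\<close>

lemma card_nonremovable_le:
  assumes p: "p \<in> A" shows "card {e \<in> edges G. p \<in> ends G e \<and> e \<notin> R \<and> e \<noteq> e1} \<le> card (nonrem p)"
proof -
  let ?S = "{e \<in> edges G. p \<in> ends G e \<and> e \<notin> R \<and> e \<noteq> e1}"
  have ex: "\<exists>q. q \<in> B \<and> ends G e = {p, q}" if e: "e \<in> ?S" for e
  proof -
    have "e \<noteq> e2" using e en inB p dj by auto
    then obtain p' q where "p' \<in> A" "q \<in> B" "ends G e = {p', q}" using cross e by blast
    then show ?thesis using e p dj by auto
  qed
  define h where "h e = (SOME q. q \<in> B \<and> ends G e = {p, q})" for e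
  have h: "h e \<in> B" "ends G e = {p, h e}" if "e \<in> ?S" for e
    using someI_ex[OF ex[OF that]] by (simp_all add: h_def)
  have "inj_on h ?S"
  proof (rule inj_onI)
    fix e f assume ef: "e \<in> ?S" "f \<in> ?S" "h e = h f"
    have en_f: "ends G f = {p, h e}" using h(2)[OF ef(2)] unfolding ef(3) .
    have mem: "e \<in> edges G" "e \<notin> R" "f \<in> edges G" using ef(1,2) by blast+
    show "e = f" by (rule nonremovable_nonrem(2)[OF mem(1) h(2)[OF ef(1)] p h(1)[OF ef(1)] mem(2,3) en_f, symmetric])
  qed
  moreover have "h ` ?S \<subseteq> nonrem p"
  proof
    fix x assume "x \<in> h ` ?S"
    then obtain e where e: "e \<in> ?S" "x = h e" by blast
    have mem: "e \<in> edges G" "e \<notin> R" using e(1) by blast+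
    show "x \<in> nonrem p" unfolding e(2) by (rule nonremovable_nonrem(1)[OF mem(1) h(2)[OF e(1)] p h(1)[OF e(1)] mem(2)])
  qed
  ultimately show ?thesis using fin_nonrem by (rule card_inj_on_le)
qed

lemma uncovered_nonrem:
  assumes p: "p \<in> A" "\<And>e. e \<in> R \<Longrightarrow> p \<notin> ends G e" shows "N {p} \<subseteq> nonrem p"
proof
  fix q assume "q \<in> N {p}"
  then obtain e where e: "e \<in> edges G" "ends G e = {p, q}" "q \<in> B" by (auto simp: cross_pairs_def)
  have "e \<notin> R" using p(2)[of e] e by auto
  then show "q \<in> nonrem p" using nonremovable_nonrem(1) e p by blast
qed

definition U :: "'a set" where "U = {p \<in> A. \<forall>e\<in>R. p \<notin> ends G e}"

lemma U_nonrem: assumes "p \<in> U" "p \<noteq> a1" "p \<noteq> a2" shows "3 \<le> card (nonrem p)"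
proof -
  have p: "p \<in> A" "N {p} \<subseteq> nonrem p" using assms(1) uncovered_nonrem by (auto simp: U_def)
  then show ?thesis using deg3[of p] assms card_mono[OF fin_nonrem p(2)] by simp
qed

text \<open>A vertex without removable edges that is not an end of \<open>e1\<close> has three
  nonremovable pairs, and there is at most one such vertex.\<close>

lemma U_sub: "\<exists>a. U \<subseteq> {a1, a2, a}"
proof (cases "U \<subseteq> {a1, a2}")
  case True then show ?thesis by blast
next
  case False
  then obtain a where a: "a \<in> U" "a \<noteq> a1" "a \<noteq> a2" by blast
  have "p = a" if "p \<in> U" "p \<noteq> a1" "p \<noteq> a2" for p
    by (rule nonrem_card3_unique) (use a that U_nonrem in \<open>auto simp: U_def\<close>)
  then show ?thesis by blast
qed

lemma card_U: "card U \<le> 3"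
proof -
  obtain a where "U \<subseteq> {a1, a2, a}" using U_sub by blast
  then have "card U \<le> card {a1, a2, a}" by (intro card_mono) simp_all
  also have "\<dots> \<le> 3" by (simp add: card_insert_if)
  finally show ?thesis .
qed

definition Aend :: "'b \<Rightarrow> 'a" where "Aend e = (THE p. p \<in> A \<and> p \<in> ends G e)"

lemma Aend_eq: assumes "e \<in> R" "p \<in> A" "p \<in> ends G e" shows "Aend e = p"
proof -
  obtain p' q where "p' \<in> A" "q \<in> B" "ends G e = {p', q}" by (rule R_cross[OF assms(1)])
  then show ?thesis unfolding Aend_def using assms dj by (intro the_equality) auto
qed

lemma covered_sub: "A - U \<subseteq> Aend ` R"
proof
  fix p assume "p \<in> A - U"
  then obtain e where "e \<in> R" "p \<in> A" "p \<in> ends G e" by (auto simp: U_def)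
  then show "p \<in> Aend ` R" using Aend_eq by blast
qed

lemma card_A_U: "card (A - U) + card U = card A"
proof -
  have s: "U \<subseteq> A" by (auto simp: U_def)
  show ?thesis using card_Diff_subset[OF finS[OF s] s] card_mono[OF finA s] by simp
qed

lemma card_R_ge: "card A \<le> card R + 3"
  using card_mono[OF finite_imageI[OF finR] covered_sub] card_image_le[OF finR, of Aend] card_A_U card_U by linarith

text \<open>In case of equality, both estimates behind \<open>card_R_ge\<close> are attained: three
  vertices of \<open>A\<close> have no removable edge, and distinct removable edges have distinct
  ends in \<open>A\<close>.\<close>

lemma extremal:
  assumes ex: "card R + 3 = card A"
  obtains a where "a \<in> A" "a \<noteq> a1" "a \<noteq> a2" "U = {a1, a2, a}" "3 \<le> card (nonrem a)"
    "\<And>e f p. e \<in> R \<Longrightarrow> f \<in> R \<Longrightarrow> p \<in> A \<Longrightarrow> p \<in> ends G e \<Longrightarrow> p \<in> ends G f \<Longrightarrow> e = f"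
proof -
  have c: "card (A - U) \<le> card (Aend ` R)" "card (Aend ` R) \<le> card R"
    using card_mono[OF finite_imageI[OF finR] covered_sub] card_image_le[OF finR] by blast+
  then have c3: "card U = 3" and ci: "card (Aend ` R) = card R" using card_A_U card_U ex by linarith+
  have inj: "inj_on Aend R" using finR ci by (rule eq_card_imp_inj_on)
  obtain a where a: "U \<subseteq> {a1, a2, a}" using U_sub by blast
  have "card {a1, a2, a} \<le> 3" by (simp add: card_insert_if)
  then have Ueq: "U = {a1, a2, a}" using a c3 by (intro card_seteq) simp_all
  then have na: "a \<noteq> a1" "a \<noteq> a2" using c3 distinct_ends by (auto simp: card_insert_if split: if_splits)
  have aU: "a \<in> U" using Ueq by blast
  then have aA: "a \<in> A" by (simp add: U_def)
  show thesis
  proof (rule that[OF aA na Ueq U_nonrem[OF aU na]])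
    fix e f p assume h: "e \<in> R" "f \<in> R" "p \<in> A" "p \<in> ends G e" "p \<in> ends G f"
    then have "Aend e = Aend f" using Aend_eq by simp
    then show "e = f" using inj h by (simp add: inj_on_def)
  qed
qed

text \<open>A vertex outside \<open>U\<close> has exactly one removable edge and at most two others,
  so degree three leaves two nonremovable ones. At a vertex of \<open>U\<close> all edges are
  nonremovable: at most three at the apex, and two besides \<open>e1\<close> at \<open>a1\<close>
  and \<open>a2\<close>.\<close>

lemma extremal_degree:
  assumes ex: "card R + 3 = card A" and d1: "card (E `` {a1}) = 2" "card (E `` {a2}) = 2" and p: "p \<in> A"
  shows "card {e \<in> edges G. p \<in> ends G e} = 3"
    "p \<notin> U \<Longrightarrow> 2 \<le> card (nonrem p)"
proof -
  let ?incident = "{e \<in> edges G. p \<in> ends G e}" and ?S = "{e \<in> edges G. p \<in> ends G e \<and> e \<notin> R \<and> e \<noteq> e1}"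
  obtain a where a: "a \<in> A" "a \<noteq> a1" "a \<noteq> a2" "U = {a1, a2, a}" "3 \<le> card (nonrem a)"
    and uniq: "\<And>e f p. e \<in> R \<Longrightarrow> f \<in> R \<Longrightarrow> p \<in> A \<Longrightarrow> p \<in> ends G e \<Longrightarrow> p \<in> ends G f \<Longrightarrow> e = f"
    using extremal[OF ex] by blast
  have finI: "finite ?incident" using fin by simp
  have SI: "card ?S \<le> card (nonrem p)" by (rule card_nonremovable_le[OF p])
  have ge: "card (N {p}) \<le> card (?incident - {e1})"
  proof -
    have "\<exists>e\<in>?incident - {e1}. ends G e = {p, q}" if "(p, q) \<in> E" for q
    proof -
      obtain e where e: "e \<in> edges G" "ends G e = {p, q}" "q \<in> B" using \<open>(p, q) \<in> E\<close> by (auto simp: cross_pairs_def)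
      then have "e \<noteq> e1" using en inA dj by auto
      then show ?thesis using e by auto
    qed
    then obtain h where h: "\<And>q. (p, q) \<in> E \<Longrightarrow> h q \<in> ?incident - {e1} \<and> ends G (h q) = {p, q}" by metis
    have "inj_on h (N {p})"
    proof (rule inj_onI)
      fix q q' assume "q \<in> N {p}" "q' \<in> N {p}" "h q = h q'"
      then have "{p, q} = {p, q'}" using h[of q] h[of q'] by simp
      then show "q = q'" by (auto simp: doubleton_eq_iff)
    qed
    moreover have "h ` N {p} \<subseteq> ?incident - {e1}" using h by blast
    ultimately show ?thesis using finI by (intro card_inj_on_le) simp_all
  qed
  have e1I: "e1 \<in> ?incident \<longleftrightarrow> p = a1 \<or> p = a2" using e12 en by auto
  have cI: "card ?incident = 3 \<and> (p \<notin> U \<longrightarrow> 2 \<le> card (nonrem p))"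
  proof (cases "p \<in> U")
    case True
    then have noR: "e \<notin> R" if "e \<in> ?incident" for e using that by (auto simp: U_def)
    have SI': "?S = ?incident - {e1}" using noR by blast
    show ?thesis
    proof (cases "p = a1 \<or> p = a2")
      case True
      have "nonrem p \<subseteq> N {p}" by (auto simp: nonrem_def)
      then have "card (nonrem p) \<le> card (N {p})" by (intro card_mono) simp_all
      then have "card (?incident - {e1}) = 2" using True d1 ge SI unfolding SI' by auto
      moreover have "e1 \<in> ?incident" using e1I True by blast
      then have "card (?incident - {e1}) + 1 = card ?incident" using card_Suc_Diff1[OF finI] by simp
      ultimately show ?thesis using \<open>p \<in> U\<close> by simp
    next
      case False
      then have "?incident - {e1} = ?incident" using e1I by blast
      then show ?thesis using SI ge deg3[of p] nonrem_card(1)[of p] False p \<open>p \<in> U\<close> unfolding SI' by simp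
    qed
  next
    case False
    then have pa: "p \<noteq> a1" "p \<noteq> a2" "p \<noteq> a" using a by blast+
    have e1n: "e1 \<notin> ?incident" using e1I pa by blast
    obtain e0 where e0: "e0 \<in> R" "p \<in> ends G e0" using False p by (auto simp: U_def)
    have e0I: "e0 \<in> ?incident" using e0 by (simp add: R_def)
    have "?S = ?incident - {e0}"
    proof
      show "?S \<subseteq> ?incident - {e0}" using e0 by blast
      show "?incident - {e0} \<subseteq> ?S" using uniq[OF _ e0(1) p _ e0(2)] e1n by blast
    qed
    then have cS: "card ?S + 1 = card ?incident" using card_Suc_Diff1[OF finI e0I] by simp
    have "card (nonrem p) \<noteq> 3"
    proof
      assume "card (nonrem p) = 3"
      then have "p = a" using nonrem_card3_unique[OF p pa(1,2) _ a(1-3,5)] by simp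
      then show False using pa by blast
    qed
    then have "card (nonrem p) \<le> 2" using nonrem_card(1)[OF p pa(1,2)] by simp
    moreover have "3 \<le> card ?incident"
    proof -
      have "?incident - {e1} = ?incident" using e1n by blast
      then show ?thesis using ge deg3[OF p pa(1,2)] by simp
    qed
    ultimately show ?thesis using cS SI by linarith
  qed
  show "card ?incident = 3" using cI by blast
  show "p \<notin> U \<Longrightarrow> 2 \<le> card (nonrem p)" using cI by blast
qed

text \<open>Equality holds for both classes at once. The exceptional vertex of \<open>A\<close>
  gives \<open>b1\<close>, \<open>b2\<close> degree two in the relation, and the one of
  \<open>B\<close> does the same for \<open>a1\<close>, \<open>a2\<close>; these are the degrees
  that \<open>extremal_degree\<close> takes as hypotheses.\<close>

lemma extremal_ladder:
  assumes ex: "card R + 3 = card A" shows "ladder G"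
proof -
  interpret d: brick_core G B A b1 b2 a1 a2 e2 e1 by (rule dual_brick_core)
  have exd: "card R + 3 = card B" using ex cardAB by simp
  obtain a where a: "a \<in> A" "a \<noteq> a1" "a \<noteq> a2" "U = {a1, a2, a}" "3 \<le> card (nonrem a)" using extremal[OF ex] by metis
  obtain b where b: "b \<in> B" "b \<noteq> b1" "b \<noteq> b2" "3 \<le> card (d.nonrem b)" using d.extremal[OF exd] by metis
  have na: "(a, b1) \<in> E" "(a, b2) \<in> E" "card (E\<inverse> `` {b1}) = 2" "card (E\<inverse> `` {b2}) = 2"
    using nonrem_card(2)[OF a(1-3,5)] by blast+
  have nb: "card (E `` {a1}) = 2" "card (E `` {a2}) = 2"
    using d.nonrem_card(2)[OF b] unfolding cross_pairs_dual by simp_all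
  have "cubic G" unfolding cubic_def
  proof
    fix v assume "v \<in> verts G"
    then consider "v \<in> A" | "v \<in> B" using V by blast
    then show "card {e \<in> edges G. v \<in> ends G e} = 3"
    proof cases
      case 1 then show ?thesis using extremal_degree(1)[OF ex nb] by blast
    next
      case 2 then show ?thesis using d.extremal_degree(1)[OF exd] na(3,4) unfolding cross_pairs_dual by blast
    qed
  qed
  then interpret k: cubic_core G A B a1 a2 b1 b2 e1 e2
    unfolding cubic_core_def cubic_core_axioms_def using bip_core_axioms by blast
  obtain a' c1 c2 where "cubic_tri A B E a1 a2 b1 b2 a a' c1 c2" using k.triangle_imp_cubic_tri[OF a(1) na(1,2)] by blast
  then have "cubic_core_tri G A B a1 a2 b1 b2 e1 e2 a a' c1 c2"
    unfolding cubic_core_tri_def using k.cubic_core_axioms by blast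
  then show ?thesis
  proof (rule quasi_extremal_ladder)
    fix p assume "p \<in> A" "p \<noteq> a1" "p \<noteq> a2" "p \<noteq> a"
    then show "2 \<le> card (nonrem p)" using extremal_degree(2)[OF ex nb] a(4) by blast
  qed
qed

text \<open>A ladder is cubic and hence simple, so removable edges correspond to removable pairs.
  \<open>ladder_bound\<close> gives one inequality and \<open>card_R_ge\<close> the other.\<close>

lemma ladder_extremal:
  assumes ladder: "ladder G" shows "card R + 3 = card A"
proof -
  interpret k: cubic_core G A B a1 a2 b1 b2 e1 e2
    unfolding cubic_core_def cubic_core_axioms_def using bip_core_axioms ladder_cubic[OF ladder wf] by blast
  have c: "card {(p, q). rm p q} + 3 \<le> card A"
    using ladder_imp_bound[OF ladder k.cubic_core_axioms] unfolding ladder_bound_def by blast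
  have ex: "\<exists>x. rm (fst x) (snd x) \<and> ends G e = {fst x, snd x}" if e: "e \<in> R" for e
  proof -
    obtain p q where pq: "p \<in> A" "q \<in> B" "ends G e = {p, q}" "e \<in> edges G" using R_cross[OF e] by metis
    have "\<not> (\<exists>e'\<in>edges G. e' \<noteq> e \<and> ends G e' = {p, q})" using k.simple pq by metis
    moreover have "removable G e" using e by (simp add: R_def)
    ultimately have "rm p q" using removable_cross[OF br mc pq(4,3,1,2)] by blast
    then show ?thesis using pq(3) by (intro exI[of _ "(p, q)"]) simp
  qed
  obtain h where h: "\<And>e. e \<in> R \<Longrightarrow> rm (fst (h e)) (snd (h e)) \<and> ends G e = {fst (h e), snd (h e)}"
    using ex by metis
  have "inj_on h R"
  proof (rule inj_onI)
    fix e f assume ef: "e \<in> R" "f \<in> R" "h e = h f"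
    have "ends G e = ends G f" using h[OF ef(1)] h[OF ef(2)] unfolding ef(3) by simp
    moreover have "e \<in> edges G" "f \<in> edges G" using ef by (simp_all add: R_def)
    ultimately show "e = f" using k.simple by blast
  qed
  moreover have "h ` R \<subseteq> {(p, q). rm p q}"
  proof
    fix x assume "x \<in> h ` R"
    then obtain e where "e \<in> R" "x = h e" by blast
    then show "x \<in> {(p, q). rm p q}" using h by (simp add: case_prod_beta)
  qed
  moreover have "finite {(p, q). rm p q}"
    by (rule finite_subset[of _ "A \<times> B"]) (use EAB finA finB in \<open>auto simp: removable_pair_def\<close>)
  ultimately have "card R \<le> card {(p, q). rm p q}" by (rule card_inj_on_le)
  then show ?thesis using c card_R_ge by linarith
qed

end

theorem theorem1p2:
  fixes G :: "('v, 'e) mgraph"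
  assumes "near_bipartite G" and "brick G" and "\<not> graph_iso G K4"
  shows "real (card {e \<in> edges G. removable G e}) \<ge> (real (card (verts G)) - 6) / 2
    \<and> (real (card {e \<in> edges G. removable G e}) = (real (card (verts G)) - 6) / 2
         \<longleftrightarrow> tri_ladder G)"
proof -
  let ?R = "{e \<in> edges G. removable G e}"
  obtain A B a1 a2 b1 b2 e1 e2 where pair: "bip_pair G A B a1 a2 b1 b2 e1 e2" and cAB: "card A = card B"
    and mcH: "matching_covered (delete_edges G {e1, e2})"
    using near_bipartite_pair[OF assms(1)] by metis
  interpret p: bip_pair G A B a1 a2 b1 b2 e1 e2 by (rule pair)
  have cV: "card (verts G) = 2 * card A"
    unfolding p.V using card_Un_disjoint[OF p.fin(1,2) p.dj] cAB by simp
  have ladder: "tri_ladder G \<longleftrightarrow> ladder G" using tri_ladder_imp_ladder ladder_imp_tri_ladder p.wf by blast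
  show ?thesis
  proof (cases "3 \<le> card A")
    case True
    interpret b: brick_core G A B a1 a2 b1 b2 e1 e2
      unfolding brick_core_def brick_core_axioms_def bip_core_def
      using pair p.core_of_brick[OF cAB assms(2) mcH True] assms(1,2) by (auto simp: near_bipartite_def)
    have R: "b.R = ?R" by (simp add: b.R_def)
    have "card ?R + 3 = card A \<longleftrightarrow> ladder G" using b.extremal_ladder b.ladder_extremal unfolding R by blast
    moreover have "card A \<le> card ?R + 3" using b.card_R_ge unfolding R .
    ultimately show ?thesis unfolding ladder cV by (simp add: field_simps) linarith
  next
    case False
    \<comment> \<open>With at most four vertices the bound is negative and is never attained, while
      a ladder has at least six vertices.\<close>
    then have "\<not> ladder G" using ladder_card[OF _ p.wf] cV by fastforce
    then show ?thesis unfolding ladder cV using False by (simp add: field_simps)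
  qed
qed

end
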